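(* Let $(A,\Delta)$ be a left and right full regular weak multiplier bialgebra over $\mathbb{C}$ whose base algebra is isomorphic to $\mathrm{Fun}_{\mathrm f}(I)$, the algebra of finitely supported complex functions on $I$, for some set $I$, and such that moreover $A^LA^R\subseteq A$. Then $(A,\Delta)$ is the total weak multiplier bialgebra of a uniquely determined partial bialgebra $\mathscr{A}$ over $I$.
   Context: $M(B)$ denotes the multiplier algebra of a non-degenerate algebra $B$. WEAK MULTIPLIER BIALGEBRAS (Böhm, Gómez-Torrecillas, López-Centella). A weak multiplier bialgebra is an idempotent algebra $A$ with non-degenerate multiplication, with an idempotent $E\in M(A\otimes A)$, a multiplicative linear map $\Delta:A\to M(A\otimes A)$ and a linear map $\epsilon:A\to\mathbb C$ such that: (i) $T_1(a\otimes b)=\Delta(a)(1\otimes b)$ and $T_2(a\otimes b)=(a\otimes1)\Delta(b)$ lie in $A\otimes A$; (ii) $(T_2\otimes\mathrm{id})(\mathrm{id}\otimes T_1)=(\mathrm{id}\otimes T_1)(T_2\otimes\mathrm{id})$; (iii) $(\epsilon\otimes\mathrm{id})T_1(a\otimes b)=ab=(\mathrm{id}\otimes\epsilon)T_2(a\otimes b)$; (iv) $\Delta(A)(A\otimes A)=E(A\otimes A)$ and $(A\otimes A)\Delta(A)=(A\otimes A)E$ (linear spans), so that $\Delta$ extends uniquely to multipliers with $\Delta(1)=E$; (v) $(E\otimes1)(1\otimes E)=(\Delta\otimes\mathrm{id})(E)=(\mathrm{id}\otimes\Delta)(E)=(1\otimes E)(E\otimes1)$; (vi) $(\epsilon\otimes\mathrm{id})(\Delta(a)(b\otimes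 c))=(\epsilon\otimes\mathrm{id})((1\otimes a)E(b\otimes c))$ and $(\epsilon\otimes\mathrm{id})((a\otimes b)\Delta(c))=(\epsilon\otimes\mathrm{id})((a\otimes b)E(1\otimes c))$. It is regular if moreover $\Delta(a)(b\otimes1)$ and $(1\otimes a)\Delta(b)$ lie in $A\otimes A$ for all $a,b$. It is left and right full if the left and right legs of $\Delta$ span $A$: for subspaces $V,W\subseteq A$ with $\Delta(A)(1\otimes A)\subseteq V\otimes A$, resp. $(A\otimes1)\Delta(A)\subseteq A\otimes W$, one has $V=A$, resp. $W=A$. BASE ALGEBRAS. In $M(A)$ put $\Pi^L(a)=(\epsilon\otimes\mathrm{id})(\Delta(1)(a\otimes1))$, $\bar\Pi^L(a)=(\epsilon\otimes\mathrm{id})((a\otimes1)\Delta(1))$, $\Pi^R(a)=(\mathrm{id}\otimes\epsilon)((1\otimes a)\Delta(1))$, $\bar\Pi^R(a)=(\mathrm{id}\otimes\epsilon)(\Delta(1)(1\otimes a))$ (interpreted as multipliers). In the regular left and right full case $A^L:=\Pi^L(A)=\bar\Pi^L(A)$ and $A^R:=\Pi^R(A)=\bar\Pi^R(A)$ are subalgebras of $M(A)$; $A^L$ is called the base algebra, and it is anti-isomorphic to $A^R$. PARTIAL BIALGEBRAS. An assignment $(r,s)\mapsto x_{rs}$ is rcf if for each fixed $r$ only finitely many $x_{rs}$ are nonzero, and likewise for each fixed $s$. A partial bialgebra $\mathscr{A}$ over $I$ consists of complex vector spaces $A^{kl}_{mn}$ ($k,l,m,n\in I$); associative multiplications $A^{kl}_{mn}\otimes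 A^{lp}_{nq}\to A^{kp}_{mq}$ with unit elements $\mathbf{1}^k_m\in A^{kk}_{mm}$ (possibly zero), so $\mathbf 1^k_m a=a=a\mathbf 1^l_n$ for $a\in A^{kl}_{mn}$; comultiplications $\Delta_{rs}:A^{kl}_{mn}\to A^{kl}_{rs}\otimes A^{rs}_{mn}$ with $(\Delta_{pq}\otimes\mathrm{id})\Delta_{rs}=(\mathrm{id}\otimes\Delta_{rs})\Delta_{pq}$; and counits $\epsilon:A^{kl}_{kl}\to\mathbb{C}$, extended by $0$ to $A^{kl}_{mn}$ with $(k,l)\ne(m,n)$, with $(\epsilon\otimes\mathrm{id})\Delta_{kl}(a)=a=(\mathrm{id}\otimes\epsilon)\Delta_{mn}(a)$ for $a\in A^{kl}_{mn}$; such that: (1) $\Delta_{l,l'}(\mathbf 1^k_m)=\delta_{l,l'}\mathbf 1^k_l\otimes\mathbf 1^l_m$; (2) $\epsilon(ab)=\epsilon(a)\epsilon(b)$ for $a\in A^{kl}_{mn},b\in A^{lp}_{nq}$; (3) $\epsilon(\mathbf 1^k_k)=1$; (4) for each $a\in A^{kl}_{mn}$, $(r,s)\mapsto\Delta_{rs}(a)$ is rcf; (5) $\Delta_{rs}(ab)=\sum_t\Delta_{rt}(a)\Delta_{ts}(b)$ for composable $a,b$. TOTAL WEAK MULTIPLIER BIALGEBRA of $\mathscr{A}$: the algebra $A=\bigoplus A^{kl}_{mn}$ (non-composable products are $0$), with $\epsilon$ extended linearly, $\lambda_k=\sum_l\mathbf 1^k_l$, $\rho_l=\sum_k\mathbf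 1^k_l\in M(A)$, with $\Delta:A\to M(A\otimes A)$ the homomorphism satisfying $\Delta_{rs}(a)=(1\otimes\lambda_r)\Delta(a)(1\otimes\lambda_s)=(\rho_r\otimes1)\Delta(a)(\rho_s\otimes1)$ for homogeneous $a$, and $\Delta(1)=\sum_l\rho_l\otimes\lambda_l$. *)

theory Defs
  imports Complex_Main "HOL-Library.Poly_Mapping"
begin

class complex_vector = ab_group_add +
  fixes scaleC :: "complex \<Rightarrow> 'a \<Rightarrow> 'a"  (infixr \<open>*\<^sub>C\<close> 75)
  assumes scaleC_add_right: "c *\<^sub>C (x + y) = c *\<^sub>C x + c *\<^sub>C y"
    and scaleC_add_left: "(c + d) *\<^sub>C x = c *\<^sub>C x + d *\<^sub>C x"
    and scaleC_scaleC: "c *\<^sub>C (d *\<^sub>C x) = (c * d) *\<^sub>C x"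
    and scaleC_one: "1 *\<^sub>C x = x"

interpretation cvec: vector_space "scaleC :: complex \<Rightarrow> 'a \<Rightarrow> 'a::complex_vector"
  by unfold_locales (simp_all add: scaleC_add_right scaleC_add_left scaleC_scaleC scaleC_one)

abbreviation clinear :: "('a::complex_vector \<Rightarrow> 'b::complex_vector) \<Rightarrow> bool" where
  "clinear \<equiv> Vector_Spaces.linear scaleC scaleC"

definition cbilinear ::
    "('a::complex_vector \<Rightarrow> 'b::complex_vector \<Rightarrow> 'c::complex_vector) \<Rightarrow> bool" where
  "cbilinear h \<longleftrightarrow> (\<forall>a. clinear (h a)) \<and> (\<forall>b. clinear (\<lambda>a. h a b))"

class complex_algebra = complex_vector + ring +
  assumes mult_scaleC_left: "(c *\<^sub>C x) * y = c *\<^sub>C (x * y)"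
    and mult_scaleC_right: "x * (c *\<^sub>C y) = c *\<^sub>C (x * y)"

instantiation complex :: complex_vector
begin
definition scaleC_complex :: "complex \<Rightarrow> complex \<Rightarrow> complex" where
  "scaleC_complex = (*)"
instance
  by standard (simp_all add: scaleC_complex_def algebra_simps)
end

lemma clinearI:
  assumes "\<And>x y. f (x + y) = f x + f y" "\<And>c x. f (c *\<^sub>C x) = c *\<^sub>C f x"
  shows "clinear f"
  by (simp add: Vector_Spaces.linear_iff cvec.vector_space_axioms assms)

lemma clinear_add: "clinear f \<Longrightarrow> f (x + y) = f x + f y"
  and clinear_scale: "clinear f \<Longrightarrow> f (c *\<^sub>C x) = c *\<^sub>C f x"
  by (auto simp: Vector_Spaces.linear_iff)

lemma clinear_zero: "clinear f \<Longrightarrow> f 0 = 0"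
  by (metis clinear_scale cvec.scale_zero_left)

lemma clinear_diff: "clinear f \<Longrightarrow> f (x - y) = f x - f y"
  by (metis add_diff_cancel clinear_add diff_add_cancel)

lemma clinear_minus: "clinear f \<Longrightarrow> f (- y) = - f y"
  by (metis clinear_diff clinear_zero diff_0)

lemma clinear_compose: "clinear f \<Longrightarrow> clinear g \<Longrightarrow> clinear (\<lambda>x. f (g x))"
  by (rule clinearI) (simp_all add: clinear_add clinear_scale)

lemma clinear_id: "clinear (\<lambda>x. x)"
  by (rule clinearI) simp_all

lemma clinear_scaleC: "clinear f \<Longrightarrow> clinear (\<lambda>x. c *\<^sub>C f x)"
  by (rule clinearI)
    (simp_all add: clinear_add clinear_scale scaleC_add_right scaleC_scaleC mult.commute)

lemma clinear_plus: "clinear f \<Longrightarrow> clinear g \<Longrightarrow> clinear (\<lambda>x. f x + g x)"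
  by (rule clinearI) (simp_all add: clinear_add clinear_scale scaleC_add_right add_ac)

lemma clinear_sub: "clinear f \<Longrightarrow> clinear g \<Longrightarrow> clinear (\<lambda>x. f x - g x)"
  by (rule clinearI)
    (simp_all add: clinear_add clinear_scale cvec.scale_right_diff_distrib add_diff_add)

lemma clinear_uminus: "clinear f \<Longrightarrow> clinear (\<lambda>x. - f x)"
  by (rule clinearI) (simp_all add: clinear_add clinear_scale)

lemma clinear_mult_left: "clinear f \<Longrightarrow> clinear (\<lambda>x. a * f x)"
  for a :: "'a::complex_algebra"
  by (rule clinearI) (simp_all add: clinear_add clinear_scale distrib_left mult_scaleC_right)

lemma clinear_mult_right: "clinear f \<Longrightarrow> clinear (\<lambda>x. f x * a)"
  for a :: "'a::complex_algebra"
  by (rule clinearI) (simp_all add: clinear_add clinear_scale distrib_right mult_scaleC_left)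

lemma cbilinearI:
  assumes "\<And>a. clinear (h a)" "\<And>b. clinear (\<lambda>a. h a b)"
  shows "cbilinear h"
  using assms by (simp add: cbilinear_def)

lemma cbilinear_right: "cbilinear h \<Longrightarrow> clinear (h a)"
  and cbilinear_left: "cbilinear h \<Longrightarrow> clinear (\<lambda>a. h a b)"
  by (simp_all add: cbilinear_def)

lemma cbilinear_mult: "cbilinear ((*) :: 'a::complex_algebra \<Rightarrow> _)"
  by (intro cbilinearI clinear_mult_left clinear_mult_right clinear_id)

instantiation poly_mapping :: (type, complex_vector) complex_vector
begin
lift_definition scaleC_poly_mapping :: "complex \<Rightarrow> ('a \<Rightarrow>\<^sub>0 'b) \<Rightarrow> 'a \<Rightarrow>\<^sub>0 'b"
  is "\<lambda>c f x. c *\<^sub>C f x"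
  by (rule finite_subset[rotated]) auto
instance
  by standard (transfer; simp add: fun_eq_iff scaleC_add_right scaleC_add_left
      scaleC_scaleC scaleC_one)+
end

definition tensor_relations :: "('a::complex_vector \<times> 'b::complex_vector \<Rightarrow>\<^sub>0 complex) set" where
  "tensor_relations = cvec.span
     ({Poly_Mapping.single (a + a', b) 1 - Poly_Mapping.single (a, b) 1
         - Poly_Mapping.single (a', b) 1 | a a' b. True}
    \<union> {Poly_Mapping.single (a, b + b') 1 - Poly_Mapping.single (a, b) 1
         - Poly_Mapping.single (a, b') 1 | a b b'. True}
    \<union> {Poly_Mapping.single (c *\<^sub>C a, b) 1 - c *\<^sub>C Poly_Mapping.single (a, b) 1 | c a b. True}
    \<union> {Poly_Mapping.single (a, c *\<^sub>C b) 1 - c *\<^sub>C Poly_Mapping.single (a, b) 1 | c a b. True})"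

lemma subspace_tensor_relations: "cvec.subspace tensor_relations"
  unfolding tensor_relations_def by (rule cvec.subspace_span)

lemmas tensor_relations_closed =
  cvec.subspace_0[OF subspace_tensor_relations] cvec.subspace_add[OF subspace_tensor_relations]
  cvec.subspace_diff[OF subspace_tensor_relations] cvec.subspace_neg[OF subspace_tensor_relations]
  cvec.subspace_scale[OF subspace_tensor_relations]

quotient_type (overloaded) ('a, 'b) tensor =
    "('a::complex_vector \<times> 'b::complex_vector) \<Rightarrow>\<^sub>0 complex"
  / "\<lambda>p q. p - q \<in> tensor_relations"
proof (rule equivpI)
  let ?R = "tensor_relations :: (('a \<times> 'b) \<Rightarrow>\<^sub>0 complex) set"
  show "reflp (\<lambda>p q. p - q \<in> ?R)"
    by (rule reflpI) (simp add: tensor_relations_closed(1))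
  show "symp (\<lambda>p q. p - q \<in> ?R)"
  proof (rule sympI)
    fix p q assume "p - q \<in> ?R"
    from tensor_relations_closed(4)[OF this] show "q - p \<in> ?R" by simp
  qed
  show "transp (\<lambda>p q. p - q \<in> ?R)"
  proof (rule transpI)
    fix p q r assume "p - q \<in> ?R" "q - r \<in> ?R"
    from tensor_relations_closed(2)[OF this] show "p - r \<in> ?R" by simp
  qed
qed

instantiation tensor :: (complex_vector, complex_vector) complex_vector
begin
lift_definition zero_tensor :: "('a, 'b) tensor" is 0 .
lift_definition plus_tensor :: "('a, 'b) tensor \<Rightarrow> ('a, 'b) tensor \<Rightarrow> ('a, 'b) tensor" is "(+)"
  subgoal for p p' q q' using tensor_relations_closed(2)[of "p - p'" "q - q'"]
    by (simp add: add_diff_add)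
  done
lift_definition uminus_tensor :: "('a, 'b) tensor \<Rightarrow> ('a, 'b) tensor" is uminus
  subgoal for p p' using tensor_relations_closed(4)[of "p - p'"] by simp
  done
lift_definition minus_tensor :: "('a, 'b) tensor \<Rightarrow> ('a, 'b) tensor \<Rightarrow> ('a, 'b) tensor" is "(-)"
  subgoal for p p' q q' using tensor_relations_closed(3)[of "p - p'" "q - q'"]
    by (simp add: algebra_simps)
  done
lift_definition scaleC_tensor :: "complex \<Rightarrow> ('a, 'b) tensor \<Rightarrow> ('a, 'b) tensor" is scaleC
  subgoal for c p p' using tensor_relations_closed(5)[of "p - p'" c]
    by (simp add: cvec.scale_right_diff_distrib)
  done
instance
  by standard
    (transfer; simp add: algebra_simps scaleC_add_right scaleC_add_left scaleC_scaleC scaleC_one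
       tensor_relations_closed(1))+
end

lift_definition tensor :: "'a::complex_vector \<Rightarrow> 'b::complex_vector \<Rightarrow> ('a, 'b) tensor"
    (infixr \<open>\<otimes>\<close> 76)
  is "\<lambda>a b. Poly_Mapping.single (a, b) 1" .

definition free_extension ::
    "('a \<Rightarrow> 'b \<Rightarrow> 'c::complex_vector) \<Rightarrow> ('a \<times> 'b \<Rightarrow>\<^sub>0 complex) \<Rightarrow> 'c" where
  "free_extension h p = (\<Sum>(a, b)\<in>Poly_Mapping.keys p. Poly_Mapping.lookup p (a, b) *\<^sub>C h a b)"

lemma free_extension_superset:
  assumes "finite S" "Poly_Mapping.keys p \<subseteq> S"
  shows "free_extension h p = (\<Sum>(a, b)\<in>S. Poly_Mapping.lookup p (a, b) *\<^sub>C h a b)"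
  unfolding free_extension_def
  by (rule sum.mono_neutral_left) (use assms in \<open>auto simp: in_keys_iff\<close>)

lemma clinear_free_extension: "clinear (free_extension h)"
proof (rule clinearI)
  fix p q :: "'a \<times> 'b \<Rightarrow>\<^sub>0 complex"
  let ?S = "Poly_Mapping.keys p \<union> Poly_Mapping.keys q"
  have "free_extension h (p + q) = (\<Sum>(a, b)\<in>?S. Poly_Mapping.lookup (p + q) (a, b) *\<^sub>C h a b)"
    by (rule free_extension_superset) (auto simp: Poly_Mapping.keys_add)
  moreover have "free_extension h p = (\<Sum>(a, b)\<in>?S. Poly_Mapping.lookup p (a, b) *\<^sub>C h a b)"
    by (rule free_extension_superset) auto
  moreover have "free_extension h q = (\<Sum>(a, b)\<in>?S. Poly_Mapping.lookup q (a, b) *\<^sub>C h a b)"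
    by (rule free_extension_superset) auto
  ultimately show "free_extension h (p + q) = free_extension h p + free_extension h q"
    by (simp add: lookup_add scaleC_add_left sum.distrib case_prod_unfold)
next
  fix c and p :: "'a \<times> 'b \<Rightarrow>\<^sub>0 complex"
  have "Poly_Mapping.lookup (c *\<^sub>C p) x = c * Poly_Mapping.lookup p x" for x
    by (simp add: scaleC_poly_mapping.rep_eq scaleC_complex_def)
  moreover have "Poly_Mapping.keys (c *\<^sub>C p) \<subseteq> Poly_Mapping.keys p"
    by (auto simp: in_keys_iff calculation)
  ultimately show "free_extension h (c *\<^sub>C p) = c *\<^sub>C free_extension h p"
    by (subst free_extension_superset[of "Poly_Mapping.keys p"])
      (auto simp: free_extension_def cvec.scale_sum_right scaleC_scaleC case_prod_unfold
        intro!: sum.cong)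
qed

lemma free_extension_single: "free_extension h (Poly_Mapping.single (a, b) 1) = h a b"
  by (simp add: free_extension_def scaleC_one)

lemma free_extension_relations:
  assumes "cbilinear h" "p \<in> tensor_relations"
  shows "free_extension h p = 0"
  using assms(2) unfolding tensor_relations_def
proof (induction rule: cvec.span_induct_alt)
  case base
  then show ?case by (simp add: free_extension_def)
next
  case (step c x y)
  note L = clinear_free_extension[of h]
  have "free_extension h x = 0"
    using step(1) assms(1)
    by (auto simp: clinear_diff[OF L] clinear_scale[OF L] free_extension_single
      clinear_add[OF cbilinear_left] clinear_add[OF cbilinear_right]
      clinear_scale[OF cbilinear_left] clinear_scale[OF cbilinear_right])
  then show ?case
    using step by (simp add: clinear_add[OF L] clinear_scale[OF L])
qed

text \<open>The linear map out of the tensor product induced by a bilinear map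
  (and \<open>0\<close> when \<open>h\<close> is not bilinear).\<close>

lift_definition tensor_lift ::
    "('a::complex_vector \<Rightarrow> 'b::complex_vector \<Rightarrow> 'c::complex_vector) \<Rightarrow> ('a, 'b) tensor \<Rightarrow> 'c"
  is "\<lambda>h p. if cbilinear h then free_extension h p else 0"
proof -
  fix h :: "'a \<Rightarrow> 'b \<Rightarrow> 'c" and p q :: "'a \<times> 'b \<Rightarrow>\<^sub>0 complex"
  assume "p - q \<in> tensor_relations"
  then have "free_extension h p = free_extension h q" if "cbilinear h"
    using free_extension_relations[OF that] clinear_diff[OF clinear_free_extension[of h]]
    by fastforce
  then show "(if cbilinear h then free_extension h p else 0)
    = (if cbilinear h then free_extension h q else 0)"
    by simp
qed

lemma tensor_lift_tensor: "cbilinear h \<Longrightarrow> tensor_lift h (a \<otimes> b) = h a b"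
  by transfer (simp add: free_extension_single)

lemma clinear_tensor_lift: "clinear (tensor_lift h)"
proof (rule clinearI)
  show "tensor_lift h (x + y) = tensor_lift h x + tensor_lift h y" for x y
    by transfer (simp add: clinear_add[OF clinear_free_extension])
  show "tensor_lift h (c *\<^sub>C x) = c *\<^sub>C tensor_lift h x" for c x
    by transfer (simp add: clinear_scale[OF clinear_free_extension])
qed

lemma cbilinear_tensor: "cbilinear (\<otimes>)"
proof (intro cbilinearI clinearI)
  have b: "p \<in> tensor_relations"
    if "p \<in> {Poly_Mapping.single (a + a', b) 1 - Poly_Mapping.single (a, b) 1
         - Poly_Mapping.single (a', b) 1 | a a' b. True}
    \<union> {Poly_Mapping.single (a, b + b') 1 - Poly_Mapping.single (a, b) 1
         - Poly_Mapping.single (a, b') 1 | a b b'. True}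
    \<union> {Poly_Mapping.single (c *\<^sub>C a, b) 1 - c *\<^sub>C Poly_Mapping.single (a, b) 1 | c a b. True}
    \<union> {Poly_Mapping.single (a, c *\<^sub>C b) 1 - c *\<^sub>C Poly_Mapping.single (a, b) 1 | c a b. True}"
    for p :: "'a \<times> 'b \<Rightarrow>\<^sub>0 complex"
    unfolding tensor_relations_def using that by (rule cvec.span_base)
  show "a \<otimes> (b + b') = a \<otimes> b + a \<otimes> b'" for a :: 'a and b b' :: 'b
    by transfer (rule b, simp add: diff_diff_eq[symmetric], blast)
  show "(a + a') \<otimes> b = a \<otimes> b + a' \<otimes> b" for a a' :: 'a and b :: 'b
    by transfer (rule b, simp add: diff_diff_eq[symmetric], blast)
  show "a \<otimes> (c *\<^sub>C b) = c *\<^sub>C (a \<otimes> b)" for c and a :: 'a and b :: 'b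
    by transfer (rule b, blast)
  show "(c *\<^sub>C a) \<otimes> b = c *\<^sub>C (a \<otimes> b)" for c and a :: 'a and b :: 'b
    by transfer (rule b, blast)
qed

lemma clinear_tensor_left: "clinear f \<Longrightarrow> clinear (\<lambda>x. f x \<otimes> b)"
  using clinear_compose[OF cbilinear_left[OF cbilinear_tensor]] .

lemma clinear_tensor_right: "clinear f \<Longrightarrow> clinear (\<lambda>x. a \<otimes> f x)"
  using clinear_compose[OF cbilinear_right[OF cbilinear_tensor]] .

lemma tensor_eqI:
  assumes "clinear f" "clinear g" "\<And>a b. f (a \<otimes> b) = g (a \<otimes> b)"
  shows "f t = g t"
proof -
  have "f (abs_tensor p) = g (abs_tensor p)" for p
  proof (induction p rule: update_induct)
    case const
    have "abs_tensor 0 = (0 :: ('a, 'b) tensor)"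
      by (simp add: zero_tensor.abs_eq)
    then show ?case using assms(1,2) by (simp add: clinear_zero)
  next
    case (update p k v)
    obtain a b where k: "k = (a, b)" by fastforce
    have "Poly_Mapping.update k v p = p + v *\<^sub>C Poly_Mapping.single (a, b) 1"
      using update(1) unfolding k
      by (intro poly_mapping_eqI) (auto simp: scaleC_poly_mapping.rep_eq lookup_single lookup_add
          lookup_update scaleC_complex_def when_def in_keys_iff)
    then have "abs_tensor (Poly_Mapping.update k v p) = abs_tensor p + v *\<^sub>C (a \<otimes> b)"
      by (simp add: scaleC_tensor.abs_eq tensor.abs_eq plus_tensor.abs_eq)
    then show ?case using assms update by (simp add: clinear_scale clinear_add)
  qed
  then show ?thesis by (metis Quotient3_abs_rep[OF Quotient3_tensor])
qed

definition tensor_map ::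
    "('a::complex_vector \<Rightarrow> 'c::complex_vector) \<Rightarrow> ('b::complex_vector \<Rightarrow> 'd::complex_vector)
      \<Rightarrow> ('a, 'b) tensor \<Rightarrow> ('c, 'd) tensor" where
  "tensor_map f g = tensor_lift (\<lambda>a b. f a \<otimes> g b)"

lemma clinear_tensor_map: "clinear (tensor_map f g)"
  by (simp add: tensor_map_def clinear_tensor_lift)

lemma tensor_map_tensor:
  "clinear f \<Longrightarrow> clinear g \<Longrightarrow> tensor_map f g (a \<otimes> b) = f a \<otimes> g b"
  unfolding tensor_map_def
  by (subst tensor_lift_tensor)
    (auto intro!: cbilinearI clinear_tensor_left clinear_tensor_right)

text \<open>Multiplication of elementary tensors by two bilinear maps:
  \<open>(a \<otimes> b, c \<otimes> d) \<mapsto> \<mu> a c \<otimes> \<nu> b d\<close>.\<close>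

definition tensor_map2 ::
    "('a::complex_vector \<Rightarrow> 'c::complex_vector \<Rightarrow> 'e::complex_vector)
      \<Rightarrow> ('b::complex_vector \<Rightarrow> 'd::complex_vector \<Rightarrow> 'f::complex_vector)
      \<Rightarrow> ('a, 'b) tensor \<Rightarrow> ('c, 'd) tensor \<Rightarrow> ('e, 'f) tensor" where
  "tensor_map2 \<mu> \<nu> t u = tensor_lift (\<lambda>a b. tensor_map (\<mu> a) (\<nu> b) u) t"

lemma cbilinear_tensor_map2_aux:
  assumes "cbilinear \<mu>" "cbilinear \<nu>"
  shows "cbilinear (\<lambda>a b. tensor_map (\<mu> a) (\<nu> b) u)"
proof (intro cbilinearI clinearI)
  note pure = tensor_map_tensor[OF cbilinear_right[OF assms(1)] cbilinear_right[OF assms(2)]]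
  note bil = clinear_add[OF cbilinear_left[OF assms(1)]] clinear_add[OF cbilinear_left[OF assms(2)]]
    clinear_scale[OF cbilinear_left[OF assms(1)]] clinear_scale[OF cbilinear_left[OF assms(2)]]
    clinear_add[OF cbilinear_left[OF cbilinear_tensor]]
    clinear_add[OF cbilinear_right[OF cbilinear_tensor]]
    clinear_scale[OF cbilinear_left[OF cbilinear_tensor]]
    clinear_scale[OF cbilinear_right[OF cbilinear_tensor]]
  note lin = clinear_plus clinear_scaleC clinear_tensor_map
  show "tensor_map (\<mu> a) (\<nu> (x + y)) u
      = tensor_map (\<mu> a) (\<nu> x) u + tensor_map (\<mu> a) (\<nu> y) u" for a x y
    by (rule tensor_eqI[where t = u]) (intro lin | simp only: pure | simp add: bil)+
  show "tensor_map (\<mu> (x + y)) (\<nu> b) u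
      = tensor_map (\<mu> x) (\<nu> b) u + tensor_map (\<mu> y) (\<nu> b) u" for b x y
    by (rule tensor_eqI[where t = u]) (intro lin | simp only: pure | simp add: bil)+
  show "tensor_map (\<mu> a) (\<nu> (c *\<^sub>C x)) u = c *\<^sub>C tensor_map (\<mu> a) (\<nu> x) u" for a c x
    by (rule tensor_eqI[where t = u]) (intro lin | simp only: pure | simp add: bil)+
  show "tensor_map (\<mu> (c *\<^sub>C x)) (\<nu> b) u = c *\<^sub>C tensor_map (\<mu> x) (\<nu> b) u" for b c x
    by (rule tensor_eqI[where t = u]) (intro lin | simp only: pure | simp add: bil)+
qed

lemma tensor_map2_tensor:
  assumes "cbilinear \<mu>" "cbilinear \<nu>"
  shows "tensor_map2 \<mu> \<nu> (a \<otimes> b) (c \<otimes> d) = \<mu> a c \<otimes> \<nu> b d"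
  unfolding tensor_map2_def tensor_lift_tensor[OF cbilinear_tensor_map2_aux[OF assms]]
  by (rule tensor_map_tensor) (use assms in \<open>simp_all add: cbilinear_right\<close>)

lemma cbilinear_tensor_map2:
  assumes "cbilinear \<mu>" "cbilinear \<nu>"
  shows "cbilinear (tensor_map2 \<mu> \<nu>)"
proof (intro cbilinearI)
  show *: "clinear (\<lambda>t. tensor_map2 \<mu> \<nu> t u)" for u
    unfolding tensor_map2_def by (rule clinear_tensor_lift)
  note aux = cbilinear_tensor_map2_aux[OF assms]
  have pure: "tensor_map2 \<mu> \<nu> (a \<otimes> b) u = tensor_map (\<mu> a) (\<nu> b) u" for a b u
    unfolding tensor_map2_def by (rule tensor_lift_tensor[OF aux])
  show "clinear (tensor_map2 \<mu> \<nu> t)" for t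
  proof (rule clinearI)
    show "tensor_map2 \<mu> \<nu> t (x + y) = tensor_map2 \<mu> \<nu> t x + tensor_map2 \<mu> \<nu> t y" for x y
      by (rule tensor_eqI[where t = t])
        (intro clinear_plus * | simp add: pure clinear_add[OF clinear_tensor_map])+
    show "tensor_map2 \<mu> \<nu> t (c *\<^sub>C x) = c *\<^sub>C tensor_map2 \<mu> \<nu> t x" for c x
      by (rule tensor_eqI[where t = t])
        (intro clinear_scaleC * | simp add: pure clinear_scale[OF clinear_tensor_map])+
  qed
qed

instantiation tensor :: (complex_algebra, complex_algebra) complex_algebra
begin
definition times_tensor :: "('a, 'b) tensor \<Rightarrow> ('a, 'b) tensor \<Rightarrow> ('a, 'b) tensor" where
  "times_tensor = tensor_map2 (*) (*)"
instance
proof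
  let ?m = "tensor_map2 (*) (*) :: ('a, 'b) tensor \<Rightarrow> _"
  note bil = cbilinear_tensor_map2[OF cbilinear_mult cbilinear_mult]
  note r = cbilinear_right[OF bil] and l = cbilinear_left[OF bil]
  note pure = tensor_map2_tensor[OF cbilinear_mult cbilinear_mult]
  fix a b c :: "('a, 'b) tensor" and z :: complex
  show "(a + b) * c = a * c + b * c" "a * (b + c) = a * b + a * c"
    "(z *\<^sub>C a) * b = z *\<^sub>C (a * b)" "a * (z *\<^sub>C b) = z *\<^sub>C (a * b)"
    unfolding times_tensor_def
    by (simp_all add: clinear_add[OF l] clinear_add[OF r] clinear_scale[OF l] clinear_scale[OF r])
  have 1: "?m (?m (a1 \<otimes> a2) (b1 \<otimes> b2)) c = ?m (a1 \<otimes> a2) (?m (b1 \<otimes> b2) c)" for a1 a2 b1 b2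
    by (rule tensor_eqI[where t = c])
      (auto intro!: r clinear_compose[OF r r] simp: pure mult.assoc)
  have 2: "?m (?m (a1 \<otimes> a2) b) c = ?m (a1 \<otimes> a2) (?m b c)" for a1 a2
    by (rule tensor_eqI[where t = b])
      (auto intro!: clinear_compose[OF l r] clinear_compose[OF r l] 1)
  show "a * b * c = a * (b * c)"
    unfolding times_tensor_def
    by (rule tensor_eqI[where t = a]) (auto intro!: clinear_compose[OF l l] l 2)
qed
end

lemma tensor_times_tensor: "(a \<otimes> b) * (c \<otimes> d) = (a * c) \<otimes> (b * d)"
  by (simp add: times_tensor_def tensor_map2_tensor cbilinear_mult)

text \<open>The slice maps \<open>f \<otimes> id\<close> and \<open>id \<otimes> f\<close> for a functional \<open>f\<close>, using
  \<open>\<complex> \<otimes> V = V = V \<otimes> \<complex>\<close>.\<close>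

definition slice_fst :: "('a::complex_vector \<Rightarrow> complex) \<Rightarrow> ('a, 'b::complex_vector) tensor \<Rightarrow> 'b" where
  "slice_fst f = tensor_lift (\<lambda>a b. f a *\<^sub>C b)"

definition slice_snd :: "('b::complex_vector \<Rightarrow> complex) \<Rightarrow> ('a::complex_vector, 'b) tensor \<Rightarrow> 'a" where
  "slice_snd f = tensor_lift (\<lambda>a b. f b *\<^sub>C a)"

text \<open>\<open>V \<otimes> W\<close> for subspaces, identified with its image in the tensor product of the ambient spaces.\<close>

definition tensor_subspace ::
    "'a::complex_vector set \<Rightarrow> 'b::complex_vector set \<Rightarrow> ('a, 'b) tensor set" where
  "tensor_subspace V W = cvec.span {v \<otimes> w | v w. v \<in> V \<and> w \<in> W}"

definition tensor_assoc ::
    "(('a::complex_vector, 'b::complex_vector) tensor, 'c::complex_vector) tensor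
      \<Rightarrow> ('a, ('b, 'c) tensor) tensor" where
  "tensor_assoc = tensor_lift (\<lambda>t c. tensor_map id (\<lambda>b. b \<otimes> c) t)"

definition tensor_assoc_inv ::
    "('a::complex_vector, ('b::complex_vector, 'c::complex_vector) tensor) tensor
      \<Rightarrow> (('a, 'b) tensor, 'c) tensor" where
  "tensor_assoc_inv = tensor_lift (\<lambda>a t. tensor_map (\<lambda>b. a \<otimes> b) id t)"

lemma clinear_ident: "clinear id"
  by (simp add: id_def clinear_id)

lemma cbilinear_assoc:
  "cbilinear (\<lambda>(t :: ('a::complex_vector, 'b::complex_vector) tensor) (c :: 'c::complex_vector).
     tensor_map id (\<lambda>b. b \<otimes> c) t)"
proof (intro cbilinearI clinear_tensor_map clinearI)
  note t = cbilinear_tensor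
  note pure = tensor_map_tensor[OF clinear_ident cbilinear_left[OF t]]
  fix t :: "('a, 'b) tensor" and x y :: 'c and z
  show "tensor_map id (\<lambda>b. b \<otimes> (x + y)) t
      = tensor_map id (\<lambda>b. b \<otimes> x) t + tensor_map id (\<lambda>b. b \<otimes> y) t"
    by (rule tensor_eqI[where t = t])
      (intro clinear_plus clinear_tensor_map | simp only: pure
        | simp add: clinear_add[OF cbilinear_right[OF t]])+
  show "tensor_map id (\<lambda>b. b \<otimes> (z *\<^sub>C x)) t = z *\<^sub>C tensor_map id (\<lambda>b. b \<otimes> x) t"
    by (rule tensor_eqI[where t = t])
      (intro clinear_scaleC clinear_tensor_map | simp only: pure
        | simp add: clinear_scale[OF cbilinear_right[OF t]])+
qed

lemma cbilinear_assoc_inv: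
  "cbilinear (\<lambda>(a :: 'a::complex_vector) (t :: ('b::complex_vector, 'c::complex_vector) tensor).
     tensor_map (\<lambda>b. a \<otimes> b) id t)"
proof (intro cbilinearI clinear_tensor_map clinearI)
  note t = cbilinear_tensor
  note pure = tensor_map_tensor[OF cbilinear_right[OF t] clinear_ident]
  fix t :: "('b, 'c) tensor" and x y :: 'a and z
  show "tensor_map (\<lambda>b. (x + y) \<otimes> b) id t
      = tensor_map (\<lambda>b. x \<otimes> b) id t + tensor_map (\<lambda>b. y \<otimes> b) id t"
    by (rule tensor_eqI[where t = t])
      (intro clinear_plus clinear_tensor_map | simp only: pure
        | simp add: clinear_add[OF cbilinear_left[OF t]])+
  show "tensor_map (\<lambda>b. (z *\<^sub>C x) \<otimes> b) id t = z *\<^sub>C tensor_map (\<lambda>b. x \<otimes> b) id t"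
    by (rule tensor_eqI[where t = t])
      (intro clinear_scaleC clinear_tensor_map | simp only: pure
        | simp add: clinear_scale[OF cbilinear_left[OF t]])+
qed

lemma clinear_tensor_assoc: "clinear tensor_assoc" "clinear tensor_assoc_inv"
  by (simp_all add: tensor_assoc_def tensor_assoc_inv_def clinear_tensor_lift)

lemma tensor_assoc_tensor: "tensor_assoc ((a \<otimes> b) \<otimes> c) = a \<otimes> (b \<otimes> c)"
  by (simp add: tensor_assoc_def tensor_lift_tensor[OF cbilinear_assoc]
      tensor_map_tensor[OF clinear_ident clinear_tensor_left[OF clinear_id]])

lemma tensor_assoc_inv_tensor: "tensor_assoc_inv (a \<otimes> (b \<otimes> c)) = (a \<otimes> b) \<otimes> c"
  by (simp add: tensor_assoc_inv_def tensor_lift_tensor[OF cbilinear_assoc_inv]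
      tensor_map_tensor[OF cbilinear_right[OF cbilinear_tensor] clinear_ident])

lemma tensor3_eqI:
  assumes "clinear f" "clinear g" "\<And>a b c. f ((a \<otimes> b) \<otimes> c) = g ((a \<otimes> b) \<otimes> c)"
  shows "f t = g t"
proof (rule tensor_eqI[OF assms(1,2)])
  fix s c
  show "f (s \<otimes> c) = g (s \<otimes> c)"
    by (rule tensor_eqI[where t = s])
      (auto intro!: clinear_compose[OF assms(1)] clinear_compose[OF assms(2)]
        clinear_tensor_left[OF clinear_id] assms(3))
qed

lemma tensor3_eqI':
  assumes "clinear f" "clinear g" "\<And>a b c. f (a \<otimes> (b \<otimes> c)) = g (a \<otimes> (b \<otimes> c))"
  shows "f t = g t"
proof (rule tensor_eqI[OF assms(1,2)])
  fix a s
  show "f (a \<otimes> s) = g (a \<otimes> s)"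
    by (rule tensor_eqI[where t = s])
      (auto intro!: clinear_compose[OF assms(1)] clinear_compose[OF assms(2)]
        clinear_tensor_right[OF clinear_id] assms(3))
qed

lemma tensor_assoc_inverse:
  "tensor_assoc_inv (tensor_assoc t) = t" "tensor_assoc (tensor_assoc_inv u) = u"
proof -
  show "tensor_assoc_inv (tensor_assoc t) = t"
    by (rule tensor3_eqI[where t = t and g = "\<lambda>t. t" and f = "\<lambda>t. tensor_assoc_inv (tensor_assoc t)"])
      (rule clinear_compose[OF clinear_tensor_assoc(2) clinear_tensor_assoc(1)] clinear_id
        | simp only: tensor_assoc_tensor tensor_assoc_inv_tensor)+
  show "tensor_assoc (tensor_assoc_inv u) = u"
    by (rule tensor3_eqI'[where t = u and g = "\<lambda>t. t" and f = "\<lambda>t. tensor_assoc (tensor_assoc_inv t)"])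
      (rule clinear_compose[OF clinear_tensor_assoc(1) clinear_tensor_assoc(2)] clinear_id
        | simp only: tensor_assoc_tensor tensor_assoc_inv_tensor)+
qed

lemma tensor_assoc_mult: "tensor_assoc (t * u) = tensor_assoc t * tensor_assoc u"
proof -
  note lin = clinear_tensor_assoc(1)
  have 1: "tensor_assoc (((a \<otimes> b) \<otimes> c) * u) = tensor_assoc ((a \<otimes> b) \<otimes> c) * tensor_assoc u"
    for a b c
  proof (rule tensor3_eqI[where t = u])
    show "clinear (\<lambda>u. tensor_assoc (((a \<otimes> b) \<otimes> c) * u))"
      by (rule clinear_compose[OF lin clinear_mult_left[OF clinear_id]])
    show "clinear (\<lambda>u. tensor_assoc ((a \<otimes> b) \<otimes> c) * tensor_assoc u)"
      by (rule clinear_mult_left[OF lin])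
  qed (simp add: tensor_times_tensor tensor_assoc_tensor)
  show ?thesis
  proof (rule tensor3_eqI[where t = t])
    show "clinear (\<lambda>t. tensor_assoc (t * u))"
      by (rule clinear_compose[OF lin clinear_mult_right[OF clinear_id]])
    show "clinear (\<lambda>t. tensor_assoc t * tensor_assoc u)"
      by (rule clinear_mult_right[OF lin])
  qed (rule 1)
qed

lemma tensor_assoc_inv_mult:
  "tensor_assoc_inv (t * u) = tensor_assoc_inv t * tensor_assoc_inv u"
  by (metis tensor_assoc_inverse tensor_assoc_mult)

text \<open>A multiplier \<open>m\<close> of \<open>B\<close> is the pair of maps \<open>b \<mapsto> m b\<close> and \<open>b \<mapsto> b m\<close>; for
  non-degenerate \<open>B\<close> these are automatically module maps.\<close>

typedef (overloaded) 'b multiplier =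
  "{m :: ('b::complex_algebra \<Rightarrow> 'b) \<times> ('b \<Rightarrow> 'b).
     clinear (fst m) \<and> clinear (snd m) \<and> (\<forall>a b. a * fst m b = snd m a * b)}"
  by (rule exI[of _ "(id, id)"]) (simp add: clinear_ident)

setup_lifting type_definition_multiplier

lift_definition act_left :: "'b::complex_algebra multiplier \<Rightarrow> 'b \<Rightarrow> 'b"  (infixr \<open>\<rhd>\<close> 74) is fst .

lift_definition act_right :: "'b::complex_algebra \<Rightarrow> 'b multiplier \<Rightarrow> 'b"  (infixl \<open>\<lhd>\<close> 74)
  is "\<lambda>b m. snd m b" .

lemma act_middle: "a * (m \<rhd> b) = (a \<lhd> m) * b"
  by transfer auto

instantiation multiplier :: (complex_algebra) complex_algebra
begin
lift_definition zero_multiplier :: "'a multiplier" is "(\<lambda>x. 0, \<lambda>x. 0)"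
  by (auto intro!: clinearI)
lift_definition plus_multiplier :: "'a multiplier \<Rightarrow> 'a multiplier \<Rightarrow> 'a multiplier"
  is "\<lambda>m n. (\<lambda>x. fst m x + fst n x, \<lambda>x. snd m x + snd n x)"
  by (auto intro!: clinear_plus simp: distrib_left distrib_right)
lift_definition uminus_multiplier :: "'a multiplier \<Rightarrow> 'a multiplier"
  is "\<lambda>m. (\<lambda>x. - fst m x, \<lambda>x. - snd m x)"
  by (auto intro!: clinear_uminus)
lift_definition minus_multiplier :: "'a multiplier \<Rightarrow> 'a multiplier \<Rightarrow> 'a multiplier"
  is "\<lambda>m n. (\<lambda>x. fst m x - fst n x, \<lambda>x. snd m x - snd n x)"
  by (auto intro!: clinear_sub simp: left_diff_distrib right_diff_distrib)
lift_definition scaleC_multiplier :: "complex \<Rightarrow> 'a multiplier \<Rightarrow> 'a multiplier"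
  is "\<lambda>c m. (\<lambda>x. c *\<^sub>C fst m x, \<lambda>x. c *\<^sub>C snd m x)"
  by (auto intro!: clinear_scaleC simp: mult_scaleC_left mult_scaleC_right)
lift_definition times_multiplier :: "'a multiplier \<Rightarrow> 'a multiplier \<Rightarrow> 'a multiplier"
  is "\<lambda>m n. (\<lambda>x. fst m (fst n x), \<lambda>x. snd n (snd m x))"
  subgoal for m n
    using clinear_compose[of "fst m" "fst n"] clinear_compose[of "snd n" "snd m"] by simp
  done
instance
proof
  fix a b c :: "'a multiplier" and y z :: complex
  show "a + b + c = a + (b + c)" by transfer (simp add: add.assoc)
  show "a + b = b + a" by transfer (simp add: add.commute)
  show "0 + a = a" by transfer simp
  show "- a + a = 0" by transfer simp
  show "a - b = a + - b" by transfer simp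
  show "y *\<^sub>C (a + b) = y *\<^sub>C a + y *\<^sub>C b" by transfer (simp add: scaleC_add_right)
  show "(y + z) *\<^sub>C a = y *\<^sub>C a + z *\<^sub>C a" by transfer (simp add: scaleC_add_left)
  show "y *\<^sub>C z *\<^sub>C a = (y * z) *\<^sub>C a" by transfer (simp add: scaleC_scaleC)
  show "1 *\<^sub>C a = a" by transfer (simp add: scaleC_one)
  show "a * b * c = a * (b * c)" by transfer simp
  show "(a + b) * c = a * c + b * c" by transfer (simp add: clinear_add)
  show "a * (b + c) = a * b + a * c" by transfer (simp add: clinear_add)
  show "(y *\<^sub>C a) * b = y *\<^sub>C (a * b)" by transfer (simp add: clinear_scale)
  show "a * (y *\<^sub>C b) = y *\<^sub>C (a * b)" by transfer (simp add: clinear_scale)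
qed
end

instantiation multiplier :: (complex_algebra) one
begin
lift_definition one_multiplier :: "'a multiplier" is "(\<lambda>x. x, \<lambda>x. x)"
  by (simp add: clinear_id)
instance ..
end

lemma multiplier_one: "1 * m = m" "m * 1 = m" for m :: "'a::complex_algebra multiplier"
  by (transfer; auto)+

text \<open>The canonical map \<open>B \<rightarrow> M(B)\<close>, injective for non-degenerate \<open>B\<close>, and its inverse.\<close>

lift_definition to_multiplier :: "'b::complex_algebra \<Rightarrow> 'b multiplier" is "\<lambda>b. (\<lambda>x. b * x, \<lambda>x. x * b)"
  by (auto intro!: clinear_mult_left clinear_mult_right clinear_id simp: mult.assoc)

definition from_multiplier :: "'b::complex_algebra multiplier \<Rightarrow> 'b" where
  "from_multiplier = inv to_multiplier"

text \<open>The canonical map \<open>M(B) \<times> M(C) \<rightarrow> M(B \<otimes> C)\<close>.\<close>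

lift_definition mtensor ::
    "'b::complex_algebra multiplier \<Rightarrow> 'c::complex_algebra multiplier \<Rightarrow> ('b, 'c) tensor multiplier"
    (infixr \<open>\<otimes>\<^sub>M\<close> 76)
  is "\<lambda>m n. (tensor_map (fst m) (fst n), tensor_map (snd m) (snd n))"
proof (clarsimp simp: clinear_tensor_map)
  fix L R :: "'b \<Rightarrow> 'b" and L' R' :: "'c \<Rightarrow> 'c" and t u :: "('b, 'c) tensor"
  assume lin: "clinear L" "clinear R" "clinear L'" "clinear R'"
    and eq: "\<forall>a b. a * L b = R a * b" "\<forall>a b. a * L' b = R' a * b"
  note lin' = clinear_mult_left clinear_mult_right
  have "(a \<otimes> b) * tensor_map L L' u = tensor_map R R' (a \<otimes> b) * u" for a b
    by (rule tensor_eqI[where t = u, OF lin'(1)[OF clinear_tensor_map] lin'(1)[OF clinear_id]])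
      (simp add: tensor_map_tensor lin tensor_times_tensor eq)
  then show "t * tensor_map L L' u = tensor_map R R' t * u"
    by (rule tensor_eqI[where t = t, OF lin'(2)[OF clinear_id] lin'(2)[OF clinear_tensor_map]])
qed

lift_definition multiplier_assoc ::
    "(('a::complex_algebra, 'b::complex_algebra) tensor, 'c::complex_algebra) tensor multiplier
      \<Rightarrow> ('a, ('b, 'c) tensor) tensor multiplier"
  is "\<lambda>m. (\<lambda>t. tensor_assoc (fst m (tensor_assoc_inv t)), \<lambda>t. tensor_assoc (snd m (tensor_assoc_inv t)))"
proof (clarsimp, intro conjI allI)
  fix L R :: "(('a, 'b) tensor, 'c) tensor \<Rightarrow> (('a, 'b) tensor, 'c) tensor"
    and t u :: "('a, ('b, 'c) tensor) tensor"
  assume lin: "clinear L" "clinear R" and eq: "\<forall>a b. a * L b = R a * b"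
  show "clinear (\<lambda>t. tensor_assoc (L (tensor_assoc_inv t)))"
    "clinear (\<lambda>t. tensor_assoc (R (tensor_assoc_inv t)))"
    using lin by (auto intro!: clinear_compose[OF clinear_tensor_assoc(1)]
        clinear_compose[OF _ clinear_tensor_assoc(2)])
  show "t * tensor_assoc (L (tensor_assoc_inv u)) = tensor_assoc (R (tensor_assoc_inv t)) * u"
    by (metis eq tensor_assoc_inverse tensor_assoc_mult)
qed

text \<open>The extension to multipliers of a homomorphism \<open>\<gamma> : B \<rightarrow> M(C)\<close> with
  \<open>\<gamma>(B) C = e C\<close> and \<open>C \<gamma>(B) = C e\<close> for an idempotent \<open>e\<close>: the unique homomorphism
  \<open>M(B) \<rightarrow> M(C)\<close> that restricts to \<open>\<gamma>\<close> and sends \<open>1\<close> to \<open>e\<close>.\<close>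

definition multiplier_extension ::
    "('b::complex_algebra \<Rightarrow> 'c::complex_algebra multiplier) \<Rightarrow> 'c multiplier
      \<Rightarrow> 'b multiplier \<Rightarrow> 'c multiplier" where
  "multiplier_extension \<gamma> e = (THE G. clinear G \<and> (\<forall>m n. G (m * n) = G m * G n)
     \<and> (\<forall>b. G (to_multiplier b) = \<gamma> b) \<and> G 1 = e)"

text \<open>Convergence of \<open>\<Sum>i\<in>S. f i\<close> to \<open>m\<close> in the strict topology for discrete \<open>B\<close>: on every
  element of \<open>B\<close> only finitely many of the \<open>f i\<close> act non-trivially, on either side.\<close>

definition has_strict_sum ::
    "('i \<Rightarrow> 'b::complex_algebra multiplier) \<Rightarrow> 'i set \<Rightarrow> 'b multiplier \<Rightarrow> bool" where
  "has_strict_sum f S m \<longleftrightarrow> (\<forall>b.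
      finite {i \<in> S. f i \<rhd> b \<noteq> 0} \<and> m \<rhd> b = (\<Sum>i\<in>{i \<in> S. f i \<rhd> b \<noteq> 0}. f i \<rhd> b) \<and>
      finite {i \<in> S. b \<lhd> f i \<noteq> 0} \<and> b \<lhd> m = (\<Sum>i\<in>{i \<in> S. b \<lhd> f i \<noteq> 0}. b \<lhd> f i))"

definition strict_sum ::
    "('i \<Rightarrow> 'b::complex_algebra multiplier) \<Rightarrow> 'i set \<Rightarrow> 'b multiplier" where
  "strict_sum f S = (THE m. has_strict_sum f S m)"

definition T1 :: "('a::complex_algebra \<Rightarrow> ('a, 'a) tensor multiplier)
    \<Rightarrow> ('a, 'a) tensor \<Rightarrow> ('a, 'a) tensor" where
  "T1 \<Delta> = tensor_lift (\<lambda>a b. from_multiplier (\<Delta> a * (1 \<otimes>\<^sub>M to_multiplier b)))"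

definition T2 :: "('a::complex_algebra \<Rightarrow> ('a, 'a) tensor multiplier)
    \<Rightarrow> ('a, 'a) tensor \<Rightarrow> ('a, 'a) tensor" where
  "T2 \<Delta> = tensor_lift (\<lambda>a b. from_multiplier ((to_multiplier a \<otimes>\<^sub>M 1) * \<Delta> b))"

definition comult_id :: "('a::complex_algebra \<Rightarrow> ('a, 'a) tensor multiplier) \<Rightarrow> ('a, 'a) tensor multiplier
    \<Rightarrow> ('a, 'a) tensor multiplier \<Rightarrow> (('a, 'a) tensor, 'a) tensor multiplier" where
  "comult_id \<Delta> E = multiplier_extension (tensor_lift (\<lambda>a b. \<Delta> a \<otimes>\<^sub>M to_multiplier b)) (E \<otimes>\<^sub>M 1)"

definition id_comult :: "('a::complex_algebra \<Rightarrow> ('a, 'a) tensor multiplier) \<Rightarrow> ('a, 'a) tensor multiplier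
    \<Rightarrow> ('a, 'a) tensor multiplier \<Rightarrow> ('a, ('a, 'a) tensor) tensor multiplier" where
  "id_comult \<Delta> E = multiplier_extension (tensor_lift (\<lambda>a b. to_multiplier a \<otimes>\<^sub>M \<Delta> b)) (1 \<otimes>\<^sub>M E)"

locale weak_multiplier_bialgebra =
  fixes \<Delta> :: "'a::complex_algebra \<Rightarrow> ('a, 'a) tensor multiplier"
    and E :: "('a, 'a) tensor multiplier"
    and \<epsilon> :: "'a \<Rightarrow> complex"
  assumes idempotent_algebra: "cvec.span {a * b | a b :: 'a. True} = UNIV"
    and nondegenerate_left: "\<And>a :: 'a. (\<And>b. a * b = 0) \<Longrightarrow> a = 0"
    and nondegenerate_right: "\<And>a :: 'a. (\<And>b. b * a = 0) \<Longrightarrow> a = 0"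
    and E_idempotent: "E * E = E"
    and comult_linear: "clinear \<Delta>"
    and comult_mult: "\<Delta> (a * b) = \<Delta> a * \<Delta> b"
    and counit_linear: "clinear \<epsilon>"
    and T1_range: "\<Delta> a * (1 \<otimes>\<^sub>M to_multiplier b) \<in> range to_multiplier"
    and T2_range: "(to_multiplier a \<otimes>\<^sub>M 1) * \<Delta> b \<in> range to_multiplier"
    and coassoc: "tensor_map (T2 \<Delta>) id \<circ> tensor_assoc_inv \<circ> tensor_map id (T1 \<Delta>) \<circ> tensor_assoc
      = tensor_assoc_inv \<circ> tensor_map id (T1 \<Delta>) \<circ> tensor_assoc \<circ> tensor_map (T2 \<Delta>) id"
    and counit_T1: "slice_fst \<epsilon> (T1 \<Delta> (a \<otimes> b)) = a * b"
    and counit_T2: "slice_snd \<epsilon> (T2 \<Delta> (a \<otimes> b)) = a * b"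
    and comult_E_left: "cvec.span {\<Delta> a \<rhd> t | a t. True} = range (\<lambda>t. E \<rhd> t)"
    and comult_E_right: "cvec.span {t \<lhd> \<Delta> a | a t. True} = range (\<lambda>t. t \<lhd> E)"
    and E_comult_id: "multiplier_assoc (E \<otimes>\<^sub>M 1) * (1 \<otimes>\<^sub>M E) = multiplier_assoc (comult_id \<Delta> E E)"
    and E_id_comult: "multiplier_assoc (comult_id \<Delta> E E) = id_comult \<Delta> E E"
    and E_commute: "id_comult \<Delta> E E = (1 \<otimes>\<^sub>M E) * multiplier_assoc (E \<otimes>\<^sub>M 1)"
    and counit_left: "slice_fst \<epsilon> (\<Delta> a \<rhd> (b \<otimes> c))
      = slice_fst \<epsilon> (((1 \<otimes>\<^sub>M to_multiplier a) * E) \<rhd> (b \<otimes> c))"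
    and counit_right: "slice_fst \<epsilon> ((a \<otimes> b) \<lhd> \<Delta> c)
      = slice_fst \<epsilon> ((a \<otimes> b) \<lhd> (E * (1 \<otimes>\<^sub>M to_multiplier c)))"

locale regular_weak_multiplier_bialgebra = weak_multiplier_bialgebra +
  assumes T3_range: "\<Delta> a * (to_multiplier b \<otimes>\<^sub>M 1) \<in> range to_multiplier"
    and T4_range: "(1 \<otimes>\<^sub>M to_multiplier a) * \<Delta> b \<in> range to_multiplier"

definition left_full :: "('a::complex_algebra \<Rightarrow> ('a, 'a) tensor multiplier) \<Rightarrow> bool" where
  "left_full \<Delta> \<longleftrightarrow> (\<forall>V. cvec.subspace V \<longrightarrow>
     (\<forall>a b. \<Delta> a * (1 \<otimes>\<^sub>M to_multiplier b) \<in> to_multiplier ` tensor_subspace V UNIV) \<longrightarrow> V = UNIV)"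

definition right_full :: "('a::complex_algebra \<Rightarrow> ('a, 'a) tensor multiplier) \<Rightarrow> bool" where
  "right_full \<Delta> \<longleftrightarrow> (\<forall>W. cvec.subspace W \<longrightarrow>
     (\<forall>a b. (to_multiplier a \<otimes>\<^sub>M 1) * \<Delta> b \<in> to_multiplier ` tensor_subspace UNIV W) \<longrightarrow> W = UNIV)"

text \<open>The slices \<open>(\<epsilon> \<otimes> id)(N)\<close> and \<open>(id \<otimes> \<epsilon>)(N)\<close> of \<open>N \<in> M(A \<otimes> A)\<close>, as multipliers of \<open>A\<close>:
  \<open>b (\<epsilon> \<otimes> id)(N) c = (\<epsilon> \<otimes> id)((1 \<otimes> b) N (1 \<otimes> c))\<close>, and similarly for the other one.  They are
  only used for \<open>N\<close> such that these elements of \<open>M(A \<otimes> A)\<close> lie in \<open>A \<otimes> A\<close>; non-degeneracy gives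
  uniqueness.  The two-sided formula is used because \<open>N (1 \<otimes> c)\<close> need not lie in \<open>A \<otimes> A\<close> for all
  these \<open>N\<close>.\<close>

definition mslice_fst ::
    "('a::complex_algebra \<Rightarrow> complex) \<Rightarrow> ('a, 'a) tensor multiplier \<Rightarrow> 'a multiplier" where
  "mslice_fst \<epsilon> N = (THE m. \<forall>b c. b * (m \<rhd> c)
      = slice_fst \<epsilon> (from_multiplier ((1 \<otimes>\<^sub>M to_multiplier b) * N * (1 \<otimes>\<^sub>M to_multiplier c))))"

definition mslice_snd ::
    "('a::complex_algebra \<Rightarrow> complex) \<Rightarrow> ('a, 'a) tensor multiplier \<Rightarrow> 'a multiplier" where
  "mslice_snd \<epsilon> N = (THE m. \<forall>b c. b * (m \<rhd> c)
      = slice_snd \<epsilon> (from_multiplier ((to_multiplier b \<otimes>\<^sub>M 1) * N * (to_multiplier c \<otimes>\<^sub>M 1))))"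

definition PiL :: "('a::complex_algebra, 'a) tensor multiplier \<Rightarrow> ('a \<Rightarrow> complex) \<Rightarrow> 'a \<Rightarrow> 'a multiplier" where
  "PiL E \<epsilon> a = mslice_fst \<epsilon> (E * (to_multiplier a \<otimes>\<^sub>M 1))"

definition PiR :: "('a::complex_algebra, 'a) tensor multiplier \<Rightarrow> ('a \<Rightarrow> complex) \<Rightarrow> 'a \<Rightarrow> 'a multiplier" where
  "PiR E \<epsilon> a = mslice_snd \<epsilon> ((1 \<otimes>\<^sub>M to_multiplier a) * E)"

definition baseL :: "('a::complex_algebra, 'a) tensor multiplier \<Rightarrow> ('a \<Rightarrow> complex) \<Rightarrow> 'a multiplier set" where
  "baseL E \<epsilon> = range (PiL E \<epsilon>)"

definition baseR :: "('a::complex_algebra, 'a) tensor multiplier \<Rightarrow> ('a \<Rightarrow> complex) \<Rightarrow> 'a multiplier set" where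
  "baseR E \<epsilon> = range (PiR E \<epsilon>)"

definition fun_fin :: "'i set \<Rightarrow> ('i \<Rightarrow> complex) set" where
  "fun_fin I = {f. finite {i. f i \<noteq> 0} \<and> {i. f i \<noteq> 0} \<subseteq> I}"

definition dirac :: "'i \<Rightarrow> 'i \<Rightarrow> complex" where
  "dirac k = (\<lambda>i. if i = k then 1 else 0)"

definition fun_fin_iso :: "'i set \<Rightarrow> 'b::complex_algebra set \<Rightarrow> (('i \<Rightarrow> complex) \<Rightarrow> 'b) \<Rightarrow> bool" where
  "fun_fin_iso I B \<phi> \<longleftrightarrow> bij_betw \<phi> (fun_fin I) B \<and>
     (\<forall>f\<in>fun_fin I. \<forall>g\<in>fun_fin I. \<phi> (\<lambda>i. f i + g i) = \<phi> f + \<phi> g) \<and>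
     (\<forall>c. \<forall>f\<in>fun_fin I. \<phi> (\<lambda>i. c * f i) = c *\<^sub>C \<phi> f) \<and>
     (\<forall>f\<in>fun_fin I. \<forall>g\<in>fun_fin I. \<phi> (\<lambda>i. f i * g i) = \<phi> f * \<phi> g)"

text \<open>The spaces \<open>A\<^sup>k\<^sup>l\<^sub>m\<^sub>n\<close> are the subspaces \<open>component k l m n\<close> of an ambient space, and
  \<open>pmul k l p m n q\<close> stands for the multiplication
  \<open>A\<^sup>k\<^sup>l\<^sub>m\<^sub>n \<times> A\<^sup>l\<^sup>p\<^sub>n\<^sub>q \<rightarrow> A\<^sup>k\<^sup>p\<^sub>m\<^sub>q\<close>, \<open>punit k m\<close> for \<open>1\<^sup>k\<^sub>m\<close>,
  \<open>pcomul r s k l m n\<close> for \<open>\<Delta>\<^sub>r\<^sub>s\<close> on \<open>A\<^sup>k\<^sup>l\<^sub>m\<^sub>n\<close> and \<open>pcounit k l\<close> for \<open>\<epsilon>\<close> on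
  \<open>A\<^sup>k\<^sup>l\<^sub>k\<^sub>l\<close>.  All structure maps are represented by (bi)linear maps on the whole ambient space, so
  that their tensor products make sense.  This is no restriction, since a linear map on a subspace
  extends; the values outside the subspaces are irrelevant.  Indices outside \<open>I\<close> are irrelevant,
  too.\<close>

record (overloaded) ('i, 'v) partial_bialgebra_data =
  component :: "'i \<Rightarrow> 'i \<Rightarrow> 'i \<Rightarrow> 'i \<Rightarrow> 'v set"
  pmul :: "'i \<Rightarrow> 'i \<Rightarrow> 'i \<Rightarrow> 'i \<Rightarrow> 'i \<Rightarrow> 'i \<Rightarrow> 'v \<Rightarrow> 'v \<Rightarrow> 'v"
  punit :: "'i \<Rightarrow> 'i \<Rightarrow> 'v"
  pcomul :: "'i \<Rightarrow> 'i \<Rightarrow> 'i \<Rightarrow> 'i \<Rightarrow> 'i \<Rightarrow> 'i \<Rightarrow> 'v \<Rightarrow> ('v, 'v) tensor"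
  pcounit :: "'i \<Rightarrow> 'i \<Rightarrow> 'v \<Rightarrow> complex"

definition counit_ext ::
    "('i, 'v::complex_vector) partial_bialgebra_data \<Rightarrow> 'i \<Rightarrow> 'i \<Rightarrow> 'i \<Rightarrow> 'i \<Rightarrow> 'v \<Rightarrow> complex" where
  "counit_ext \<A> k l m n a = (if (k, l) = (m, n) then pcounit \<A> k l a else 0)"

definition rcf_on :: "'i set \<Rightarrow> ('i \<Rightarrow> 'i \<Rightarrow> 'x::zero) \<Rightarrow> bool" where
  "rcf_on I x \<longleftrightarrow> (\<forall>r\<in>I. finite {s \<in> I. x r s \<noteq> 0}) \<and> (\<forall>s\<in>I. finite {r \<in> I. x r s \<noteq> 0})"

locale partial_bialgebra =
  fixes I :: "'i set" and \<A> :: "('i, 'v::complex_vector) partial_bialgebra_data"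
  assumes comp_subspace:
    "\<lbrakk>k \<in> I; l \<in> I; m \<in> I; n \<in> I\<rbrakk> \<Longrightarrow> cvec.subspace (component \<A> k l m n)"
  and mul_bilinear:
    "\<lbrakk>k \<in> I; l \<in> I; p \<in> I; m \<in> I; n \<in> I; q \<in> I\<rbrakk> \<Longrightarrow> cbilinear (pmul \<A> k l p m n q)"
  and mul_comp:
    "\<lbrakk>k \<in> I; l \<in> I; p \<in> I; m \<in> I; n \<in> I; q \<in> I; a \<in> component \<A> k l m n; b \<in> component \<A> l p n q\<rbrakk>
      \<Longrightarrow> pmul \<A> k l p m n q a b \<in> component \<A> k p m q"
  and mul_assoc:
    "\<lbrakk>k \<in> I; l \<in> I; p \<in> I; u \<in> I; m \<in> I; n \<in> I; q \<in> I; v \<in> I;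
      a \<in> component \<A> k l m n; b \<in> component \<A> l p n q; c \<in> component \<A> p u q v\<rbrakk>
      \<Longrightarrow> pmul \<A> k p u m q v (pmul \<A> k l p m n q a b) c
        = pmul \<A> k l u m n v a (pmul \<A> l p u n q v b c)"
  and unit_comp: "\<lbrakk>k \<in> I; m \<in> I\<rbrakk> \<Longrightarrow> punit \<A> k m \<in> component \<A> k k m m"
  and unit_mul:
    "\<lbrakk>k \<in> I; l \<in> I; m \<in> I; n \<in> I; a \<in> component \<A> k l m n\<rbrakk>
      \<Longrightarrow> pmul \<A> k k l m m n (punit \<A> k m) a = a"
  and mul_unit:
    "\<lbrakk>k \<in> I; l \<in> I; m \<in> I; n \<in> I; a \<in> component \<A> k l m n\<rbrakk>
      \<Longrightarrow> pmul \<A> k l l m n n a (punit \<A> l n) = a"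
  and comul_linear:
    "\<lbrakk>r \<in> I; s \<in> I; k \<in> I; l \<in> I; m \<in> I; n \<in> I\<rbrakk> \<Longrightarrow> clinear (pcomul \<A> r s k l m n)"
  and comul_comp:
    "\<lbrakk>r \<in> I; s \<in> I; k \<in> I; l \<in> I; m \<in> I; n \<in> I; a \<in> component \<A> k l m n\<rbrakk>
      \<Longrightarrow> pcomul \<A> r s k l m n a \<in> tensor_subspace (component \<A> k l r s) (component \<A> r s m n)"
  and comul_coassoc:
    "\<lbrakk>p \<in> I; q \<in> I; r \<in> I; s \<in> I; k \<in> I; l \<in> I; m \<in> I; n \<in> I; a \<in> component \<A> k l m n\<rbrakk>
      \<Longrightarrow> tensor_assoc (tensor_map (pcomul \<A> p q k l r s) id (pcomul \<A> r s k l m n a))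
        = tensor_map id (pcomul \<A> r s p q m n) (pcomul \<A> p q k l m n a)"
  and counit_linear:
    "\<lbrakk>k \<in> I; l \<in> I\<rbrakk> \<Longrightarrow> clinear (pcounit \<A> k l)"
  and counit_left:
    "\<lbrakk>k \<in> I; l \<in> I; m \<in> I; n \<in> I; a \<in> component \<A> k l m n\<rbrakk>
      \<Longrightarrow> slice_fst (pcounit \<A> k l) (pcomul \<A> k l k l m n a) = a"
  and counit_right:
    "\<lbrakk>k \<in> I; l \<in> I; m \<in> I; n \<in> I; a \<in> component \<A> k l m n\<rbrakk>
      \<Longrightarrow> slice_snd (pcounit \<A> m n) (pcomul \<A> m n k l m n a) = a"
  and comul_unit:
    "\<lbrakk>k \<in> I; m \<in> I; l \<in> I; l' \<in> I\<rbrakk>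
      \<Longrightarrow> pcomul \<A> l l' k k m m (punit \<A> k m)
        = (if l = l' then punit \<A> k l \<otimes> punit \<A> l m else 0)"
  and counit_mul:
    "\<lbrakk>k \<in> I; l \<in> I; p \<in> I; m \<in> I; n \<in> I; q \<in> I; a \<in> component \<A> k l m n; b \<in> component \<A> l p n q\<rbrakk>
      \<Longrightarrow> counit_ext \<A> k p m q (pmul \<A> k l p m n q a b)
        = counit_ext \<A> k l m n a * counit_ext \<A> l p n q b"
  and counit_unit: "k \<in> I \<Longrightarrow> pcounit \<A> k k (punit \<A> k k) = 1"
  and comul_rcf:
    "\<lbrakk>k \<in> I; l \<in> I; m \<in> I; n \<in> I; a \<in> component \<A> k l m n\<rbrakk>
      \<Longrightarrow> rcf_on I (\<lambda>r s. pcomul \<A> r s k l m n a)"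
  and comul_mul:
    "\<lbrakk>r \<in> I; s \<in> I; k \<in> I; l \<in> I; p \<in> I; m \<in> I; n \<in> I; q \<in> I;
      a \<in> component \<A> k l m n; b \<in> component \<A> l p n q\<rbrakk>
      \<Longrightarrow> pcomul \<A> r s k p m q (pmul \<A> k l p m n q a b)
        = (\<Sum>t\<in>{t \<in> I. pcomul \<A> r t k l m n a \<noteq> 0}.
            tensor_map2 (pmul \<A> k l p r t s) (pmul \<A> r t s m n q)
              (pcomul \<A> r t k l m n a) (pcomul \<A> t s l p n q b))"

text \<open>Isomorphisms over a bijection \<open>\<pi>\<close> of \<open>I\<close>; the case \<open>\<pi> = id\<close> is isomorphism over \<open>I\<close>.\<close>

locale partial_bialgebra_iso =
  fixes I :: "'i set" and \<pi> :: "'i \<Rightarrow> 'i"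
    and \<A> :: "('i, 'v::complex_vector) partial_bialgebra_data"
    and \<B> :: "('i, 'w::complex_vector) partial_bialgebra_data"
    and \<theta> :: "'i \<Rightarrow> 'i \<Rightarrow> 'i \<Rightarrow> 'i \<Rightarrow> 'v \<Rightarrow> 'w"
  assumes relabelling: "bij_betw \<pi> I I"
  and iso_linear: "\<lbrakk>k \<in> I; l \<in> I; m \<in> I; n \<in> I\<rbrakk> \<Longrightarrow> clinear (\<theta> k l m n)"
  and iso_bij:
    "\<lbrakk>k \<in> I; l \<in> I; m \<in> I; n \<in> I\<rbrakk>
      \<Longrightarrow> bij_betw (\<theta> k l m n) (component \<A> k l m n) (component \<B> (\<pi> k) (\<pi> l) (\<pi> m) (\<pi> n))"
  and iso_mul:
    "\<lbrakk>k \<in> I; l \<in> I; p \<in> I; m \<in> I; n \<in> I; q \<in> I; a \<in> component \<A> k l m n; b \<in> component \<A> l p n q\<rbrakk>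
      \<Longrightarrow> \<theta> k p m q (pmul \<A> k l p m n q a b)
        = pmul \<B> (\<pi> k) (\<pi> l) (\<pi> p) (\<pi> m) (\<pi> n) (\<pi> q) (\<theta> k l m n a) (\<theta> l p n q b)"
  and iso_unit: "\<lbrakk>k \<in> I; m \<in> I\<rbrakk> \<Longrightarrow> \<theta> k k m m (punit \<A> k m) = punit \<B> (\<pi> k) (\<pi> m)"
  and iso_comul:
    "\<lbrakk>r \<in> I; s \<in> I; k \<in> I; l \<in> I; m \<in> I; n \<in> I; a \<in> component \<A> k l m n\<rbrakk>
      \<Longrightarrow> tensor_map (\<theta> k l r s) (\<theta> r s m n) (pcomul \<A> r s k l m n a)
        = pcomul \<B> (\<pi> r) (\<pi> s) (\<pi> k) (\<pi> l) (\<pi> m) (\<pi> n) (\<theta> k l m n a)"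
  and iso_counit:
    "\<lbrakk>k \<in> I; l \<in> I; a \<in> component \<A> k l k l\<rbrakk>
      \<Longrightarrow> pcounit \<B> (\<pi> k) (\<pi> l) (\<theta> k l k l a) = pcounit \<A> k l a"

definition direct_sum ::
    "'i set \<Rightarrow> ('i, 'v::complex_vector) partial_bialgebra_data \<Rightarrow> ('i \<times> 'i \<times> 'i \<times> 'i \<Rightarrow> 'v) set" where
  "direct_sum I \<A> = {x. finite {i. x i \<noteq> 0} \<and>
     (\<forall>k l m n. if {k, l, m, n} \<subseteq> I then x (k, l, m, n) \<in> component \<A> k l m n else x (k, l, m, n) = 0)}"

definition direct_sum_map ::
    "('i \<Rightarrow> 'i \<Rightarrow> 'i \<Rightarrow> 'i \<Rightarrow> 'v::complex_vector \<Rightarrow> 'a::complex_vector)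
      \<Rightarrow> ('i \<times> 'i \<times> 'i \<times> 'i \<Rightarrow> 'v) \<Rightarrow> 'a" where
  "direct_sum_map \<iota> x = (\<Sum>(k, l, m, n)\<in>{i. x i \<noteq> 0}. \<iota> k l m n (x (k, l, m, n)))"

definition total_lambda ::
    "'i set \<Rightarrow> ('i, 'v::complex_vector) partial_bialgebra_data
      \<Rightarrow> ('i \<Rightarrow> 'i \<Rightarrow> 'i \<Rightarrow> 'i \<Rightarrow> 'v \<Rightarrow> 'a::complex_algebra) \<Rightarrow> 'i \<Rightarrow> 'a multiplier" where
  "total_lambda I \<A> \<iota> k = strict_sum (\<lambda>l. to_multiplier (\<iota> k k l l (punit \<A> k l))) I"

definition total_rho ::
    "'i set \<Rightarrow> ('i, 'v::complex_vector) partial_bialgebra_data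
      \<Rightarrow> ('i \<Rightarrow> 'i \<Rightarrow> 'i \<Rightarrow> 'i \<Rightarrow> 'v \<Rightarrow> 'a::complex_algebra) \<Rightarrow> 'i \<Rightarrow> 'a multiplier" where
  "total_rho I \<A> \<iota> l = strict_sum (\<lambda>k. to_multiplier (\<iota> k k l l (punit \<A> k l))) I"

text \<open>\<open>(A, \<Delta>)\<close>, with \<open>\<Delta>(1) = E\<close> and counit \<open>\<epsilon>\<close>, is the total weak multiplier bialgebra of
  \<open>\<A>\<close>, where the maps \<open>\<iota> k l m n\<close> are the inclusions of the summands \<open>A\<^sup>k\<^sup>l\<^sub>m\<^sub>n\<close> in the direct
  sum \<open>A\<close>.\<close>

locale total_weak_multiplier_bialgebra =
  partial_bialgebra I \<A>
  for I :: "'i set" and \<A> :: "('i, 'v::complex_vector) partial_bialgebra_data" +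
  fixes \<iota> :: "'i \<Rightarrow> 'i \<Rightarrow> 'i \<Rightarrow> 'i \<Rightarrow> 'v \<Rightarrow> 'a::complex_algebra"
    and \<Delta> :: "'a \<Rightarrow> ('a, 'a) tensor multiplier"
    and E :: "('a, 'a) tensor multiplier"
    and \<epsilon> :: "'a \<Rightarrow> complex"
  assumes incl_linear:
    "\<lbrakk>k \<in> I; l \<in> I; m \<in> I; n \<in> I\<rbrakk> \<Longrightarrow> clinear (\<iota> k l m n)"
  and total_direct_sum: "bij_betw (direct_sum_map \<iota>) (direct_sum I \<A>) UNIV"
  and total_mult:
    "\<lbrakk>k \<in> I; l \<in> I; m \<in> I; n \<in> I; l' \<in> I; p \<in> I; n' \<in> I; q \<in> I;
      a \<in> component \<A> k l m n; b \<in> component \<A> l' p n' q\<rbrakk>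
      \<Longrightarrow> \<iota> k l m n a * \<iota> l' p n' q b
        = (if l = l' \<and> n = n' then \<iota> k p m q (pmul \<A> k l p m n q a b) else 0)"
  and total_counit_linear: "clinear \<epsilon>"
  and total_counit:
    "\<lbrakk>k \<in> I; l \<in> I; m \<in> I; n \<in> I; a \<in> component \<A> k l m n\<rbrakk>
      \<Longrightarrow> \<epsilon> (\<iota> k l m n a) = counit_ext \<A> k l m n a"
  and total_comult_linear: "clinear \<Delta>"
  and total_comult_mult: "\<Delta> (x * y) = \<Delta> x * \<Delta> y"
  and total_comult_lambda:
    "\<lbrakk>r \<in> I; s \<in> I; k \<in> I; l \<in> I; m \<in> I; n \<in> I; a \<in> component \<A> k l m n\<rbrakk>
      \<Longrightarrow> (1 \<otimes>\<^sub>M total_lambda I \<A> \<iota> r) * \<Delta> (\<iota> k l m n a) * (1 \<otimes>\<^sub>M total_lambda I \<A> \<iota> s)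
        = to_multiplier (tensor_map (\<iota> k l r s) (\<iota> r s m n) (pcomul \<A> r s k l m n a))"
  and total_comult_rho:
    "\<lbrakk>r \<in> I; s \<in> I; k \<in> I; l \<in> I; m \<in> I; n \<in> I; a \<in> component \<A> k l m n\<rbrakk>
      \<Longrightarrow> (total_rho I \<A> \<iota> r \<otimes>\<^sub>M 1) * \<Delta> (\<iota> k l m n a) * (total_rho I \<A> \<iota> s \<otimes>\<^sub>M 1)
        = to_multiplier (tensor_map (\<iota> k l r s) (\<iota> r s m n) (pcomul \<A> r s k l m n a))"
  and total_E:
    "has_strict_sum (\<lambda>l. total_rho I \<A> \<iota> l \<otimes>\<^sub>M total_lambda I \<A> \<iota> l) I E"

end

theory Submission
  imports Defs
begin

text \<open>
  The base algebra \<open>A\<^sup>L\<close> has a basis of orthogonal idempotents \<open>\<lambda>\<^sub>k\<close>, the images of the indicator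
  functions of the points of \<open>I\<close>.  The core of the proof is to find the partners \<open>\<rho>\<^sub>k\<close> of these
  idempotents in the other base algebra and to show that \<open>E = \<Sum>\<^sub>k \<rho>\<^sub>k \<otimes> \<lambda>\<^sub>k\<close> strictly.  The partial bialgebra
  then consists of the corners \<open>\<lambda>\<^sub>k \<rho>\<^sub>m A \<lambda>\<^sub>l \<rho>\<^sub>n\<close> of \<open>A\<close>, with units \<open>\<lambda>\<^sub>k \<rho>\<^sub>m\<close>.  These units lie in \<open>A\<close> by the
  hypothesis on products of the two base algebras, so all structure maps live on algebraic
  tensor products.

  The partners come from the identity \<open>x\<^sub>1 \<otimes> \<Pi>\<^sup>L(x\<^sub>2) = E (x \<otimes> 1)\<close> (\<open>E_first_leg_left\<close>), a consequence of
  \<open>(\<Delta> \<otimes> id)(E) = E\<^sub>2\<^sub>3 E\<^sub>1\<^sub>2\<close>: the second leg of \<open>E\<close> lies in the span of the \<open>\<lambda>\<^sub>k\<close>, so that \<open>\<lambda>\<^sub>k\<close> in the second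
  leg cuts an elementary tensor \<open>\<rho>\<^sub>k \<otimes> \<lambda>\<^sub>k\<close> out of \<open>E\<close>, from either side (\<open>rho_exists\<close>).  The counit identities
  give \<open>A = \<Pi>\<^sup>L(A) A\<close>, hence \<open>A = \<Sum>\<^sub>k \<lambda>\<^sub>k A\<close>.  They also give \<open>A = A B\<close> for the image \<open>B\<close> of the barred
  variant of \<open>\<Pi>\<^sup>L\<close>, and right fullness places \<open>B\<close> in the base algebra (\<open>barPiL_in_PiL\<close>), hence
  \<open>A = \<Sum>\<^sub>k A \<lambda>\<^sub>k\<close>.  The relations between the two families result from cutting the
  axioms with the \<open>\<lambda>\<^sub>k\<close> and slicing with the counit: \<open>E\<^sub>1\<^sub>2 E\<^sub>2\<^sub>3 = E\<^sub>2\<^sub>3 E\<^sub>1\<^sub>2\<close> makes them commute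
  (\<open>lam_rho_commute\<close>), the values of the comultiplication on \<open>E\<close> show that \<open>\<Delta>\<close> carries \<open>\<lambda>\<^sub>k\<close> to the first
  leg and \<open>\<rho>\<^sub>k\<close> to the second one (\<open>comult_lam_left\<close>, \<open>comult_rho_left\<close>), and the weak
  multiplicativity of the counit gives the orthogonality of the \<open>\<rho>\<^sub>k\<close> and \<open>\<epsilon>(\<lambda>\<^sub>k a) = \<epsilon>(\<rho>\<^sub>k a)\<close>
  (\<open>counit_rho_mult\<close>, \<open>counit_lam_eq_rho_left\<close>).

  For uniqueness, let \<open>\<B>\<close> be a partial bialgebra with the same total object.  Its idempotents
  \<open>\<lambda>'\<^sub>k\<close> lie in the base algebra too, and multiplication by an element of the base algebra acts on
  each of them by a scalar, because \<open>E = \<Sum>\<^sub>k \<rho>'\<^sub>k \<otimes> \<lambda>'\<^sub>k\<close>.  So \<open>\<lambda>'\<^sub>k\<close> is a minimal idempotent of the algebra of finitely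
  supported functions, hence one of the \<open>\<lambda>\<^sub>j\<close> (\<open>L_is_lam\<close>).  This yields the
  permutation of \<open>I\<close>; after relabelling, the two partial bialgebras have the same corners of \<open>A\<close> as
  components, and the isomorphism is the comparison of the two inclusions.

  The comultiplication of \<open>E\<close> involves the extension of homomorphisms to multiplier algebras, whose
  existence is shown in \<open>extension_exists\<close>.  Equations in tensor products are checked by
  slicing with linear functionals, which separate points (\<open>slice_snd_eqI\<close>).
\<close>

section \<open>Tensor products and linear functionals\<close>

text \<open>Every tensor is a sum of elementary ones, as scalars can be moved into the first factor; so
  this rule asks for neither scalar multiples nor zero.\<close>

lemma tensor_induct [case_names pure add]:
  assumes pure: "\<And>a b. P (a \<otimes> b)" and add: "\<And>s t. P s \<Longrightarrow> P t \<Longrightarrow> P (s + t)"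
  shows "P t"
proof -
  have "P (abs_tensor p)" for p
  proof (induction p rule: update_induct)
    case const
    have "(0 :: ('a, 'b) tensor) = 0 \<otimes> 0"
      using clinear_zero[OF cbilinear_right[OF cbilinear_tensor]] by metis
    moreover have "abs_tensor 0 = (0 :: ('a, 'b) tensor)"
      by (simp add: zero_tensor.abs_eq)
    ultimately show ?case using pure by metis
  next
    case (update p k v)
    obtain a b where k: "k = (a, b)" by fastforce
    have "Poly_Mapping.update k v p = p + v *\<^sub>C Poly_Mapping.single (a, b) 1"
      using update(1) unfolding k
      by (intro poly_mapping_eqI) (auto simp: scaleC_poly_mapping.rep_eq lookup_single lookup_add
          lookup_update scaleC_complex_def when_def in_keys_iff)
    then have "abs_tensor (Poly_Mapping.update k v p) = abs_tensor p + v *\<^sub>C (a \<otimes> b)"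
      by (simp add: scaleC_tensor.abs_eq tensor.abs_eq plus_tensor.abs_eq)
    then have "abs_tensor (Poly_Mapping.update k v p) = abs_tensor p + (v *\<^sub>C a) \<otimes> b"
      by (simp add: clinear_scale[OF cbilinear_left[OF cbilinear_tensor]])
    then show ?case using update pure add by simp
  qed
  then show ?thesis by (metis Quotient3_abs_rep[OF Quotient3_tensor])
qed

lemmas tensor_add_left = clinear_add[OF cbilinear_left[OF cbilinear_tensor]]
  and tensor_add_right = clinear_add[OF cbilinear_right[OF cbilinear_tensor]]
  and tensor_scale_left = clinear_scale[OF cbilinear_left[OF cbilinear_tensor]]
  and tensor_scale_right = clinear_scale[OF cbilinear_right[OF cbilinear_tensor]]
  and tensor_zero_left [simp] = clinear_zero[OF cbilinear_left[OF cbilinear_tensor]]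
  and tensor_zero_right [simp] = clinear_zero[OF cbilinear_right[OF cbilinear_tensor]]

lemma clinear_sum: "clinear f \<Longrightarrow> f (\<Sum>i\<in>S. g i) = (\<Sum>i\<in>S. f (g i))"
  by (induction S rule: infinite_finite_induct) (simp_all add: clinear_zero clinear_add)

lemmas tensor_sum_left = clinear_sum[OF cbilinear_left[OF cbilinear_tensor]]
  and tensor_sum_right = clinear_sum[OF cbilinear_right[OF cbilinear_tensor]]

lemma tensor_map_add: "tensor_map f g (s + t) = tensor_map f g s + tensor_map f g t"
  by (rule clinear_add[OF clinear_tensor_map])

lemma tensor_assoc_add: "tensor_assoc (s + t) = tensor_assoc s + tensor_assoc t"
  and tensor_assoc_inv_add: "tensor_assoc_inv (u + v) = tensor_assoc_inv u + tensor_assoc_inv v"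
  by (rule clinear_add[OF clinear_tensor_assoc(1)] clinear_add[OF clinear_tensor_assoc(2)])+

lemma clinear_slice_fst: "clinear (slice_fst f)"
  and clinear_slice_snd: "clinear (slice_snd f)"
  by (simp_all add: slice_fst_def slice_snd_def clinear_tensor_lift)

lemmas slice_fst_add = clinear_add[OF clinear_slice_fst]
  and slice_snd_add = clinear_add[OF clinear_slice_snd]
  and slice_snd_diff = clinear_diff[OF clinear_slice_snd]
  and slice_fst_zero [simp] = clinear_zero[OF clinear_slice_fst]
  and slice_snd_zero [simp] = clinear_zero[OF clinear_slice_snd]

lemma clinear_scaled: "clinear f \<Longrightarrow> clinear (\<lambda>x. f x *\<^sub>C v)"
  by (rule clinearI) (simp_all add: clinear_add clinear_scale scaleC_add_left scaleC_scaleC scaleC_complex_def)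

lemma slice_fst_tensor: "clinear f \<Longrightarrow> slice_fst f (a \<otimes> b) = f a *\<^sub>C b"
  unfolding slice_fst_def
  by (subst tensor_lift_tensor)
    (auto intro!: cbilinearI clinear_scaled clinear_scaleC clinear_id)

lemma slice_snd_tensor: "clinear f \<Longrightarrow> slice_snd f (a \<otimes> b) = f b *\<^sub>C a"
  unfolding slice_snd_def
  by (subst tensor_lift_tensor)
    (auto intro!: cbilinearI clinear_scaled clinear_scaleC clinear_id)

lemma slice_exchange:
  assumes "clinear f" "clinear g"
  shows "f (slice_fst g t) = g (slice_snd f t)"
proof (induction t rule: tensor_induct)
  case (pure a b)
  then show ?case
    using assms by (simp add: slice_fst_tensor slice_snd_tensor clinear_scale scaleC_complex_def)
next
  case (add s t)
  then show ?case using assms by (simp add: slice_fst_add slice_snd_add clinear_add)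
qed

text \<open>A basis of \<open>W\<close> together with \<open>v\<close> is independent, so the values on it can be prescribed.\<close>

lemma functional_separates_subspace:
  fixes W :: "'a::complex_vector set"
  assumes W: "cvec.subspace W" and v: "v \<notin> W"
  obtains f :: "'a \<Rightarrow> complex" where "clinear f" "\<And>w. w \<in> W \<Longrightarrow> f w = 0" "f v = 1"
proof -
  interpret pair: vector_space_pair "scaleC :: complex \<Rightarrow> 'a \<Rightarrow> 'a" "scaleC :: complex \<Rightarrow> complex \<Rightarrow> complex" ..
  obtain B where B: "B \<subseteq> W" "cvec.independent B" "W \<subseteq> cvec.span B"
    using cvec.basis_exists[of W] by metis
  have "v \<notin> cvec.span B"
    using v cvec.span_minimal[OF B(1) W] by blast
  then have "cvec.independent (insert v B)" and vB: "v \<notin> B"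
    using B(2) cvec.independent_insert[of v B] cvec.span_base[of v B] by auto
  then obtain f :: "'a \<Rightarrow> complex" where f: "clinear f" "\<forall>x\<in>insert v B. f x = (if x = v then 1 else 0)"
    using pair.linear_independent_extend[of "insert v B" "\<lambda>x. if x = v then 1 else 0"] by blast
  have "f w = 0" if "w \<in> W" for w
  proof -
    have "w \<in> cvec.span B" using that B(3) by blast
    then show ?thesis
    proof (induction rule: cvec.span_induct_alt)
      case base
      then show ?case using f(1) by (simp add: clinear_zero)
    next
      case (step c x y)
      moreover have "f x = 0" using f(2) step vB by auto
      ultimately show ?case using f(1) by (simp add: clinear_add clinear_scale)
    qed
  qed
  then show thesis using that f by auto
qed

lemma functional_exists:
  fixes v :: "'a::complex_vector"
  assumes "v \<noteq> 0"
  obtains f :: "'a \<Rightarrow> complex" where "clinear f" "f v = 1"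
proof -
  have "v \<notin> {0}" using assms by simp
  from functional_separates_subspace[OF cvec.subspace_single_0 this] that show thesis by blast
qed

lemma functionals_eqI:
  fixes v w :: "'a::complex_vector"
  assumes "\<And>f :: 'a \<Rightarrow> complex. clinear f \<Longrightarrow> f v = f w"
  shows "v = w"
proof (rule ccontr)
  assume "v \<noteq> w"
  then obtain f :: "'a \<Rightarrow> complex" where "clinear f" "f (v - w) = 1"
    using functional_exists[of "v - w"] by auto
  then show False using assms[of f] by (simp add: clinear_diff)
qed

text \<open>Expand the second factor in a basis.  The coordinates are linear functionals, so the
  coefficients in the first factor are slices, and an element is recovered from its slices.\<close>

lemma tensor_expansion_right:
  fixes t :: "('a::complex_vector, 'b::complex_vector) tensor"
  obtains F and e :: "'b \<Rightarrow> 'b \<Rightarrow> complex"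
  where "finite F" "\<And>b. clinear (e b)" "t = (\<Sum>b\<in>F. slice_snd (e b) t \<otimes> b)"
proof -
  obtain B :: "'b set" where B: "cvec.independent B" "UNIV \<subseteq> cvec.span B"
    using cvec.basis_exists[of UNIV] by metis
  define e where "e = (\<lambda>b v. cvec.representation B v b)"
  have in_span: "v \<in> cvec.span B" for v using B(2) by blast
  have e: "clinear (e b)" for b
    unfolding e_def
    by (rule clinearI)
      (simp_all add: cvec.representation_add[OF B(1) in_span in_span]
        cvec.representation_scale[OF B(1) in_span] scaleC_complex_def)
  have "\<exists>F. finite F \<and> (\<forall>F'. finite F' \<longrightarrow> F \<subseteq> F' \<longrightarrow> t = (\<Sum>b\<in>F'. slice_snd (e b) t \<otimes> b))" for t :: "('a, 'b) tensor"
  proof (induction t rule: tensor_induct)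
    case (pure a v)
    let ?F = "{b. e b v \<noteq> 0}"
    have fin: "finite ?F" unfolding e_def by (rule cvec.finite_representation)
    have "a \<otimes> v = (\<Sum>b\<in>F'. slice_snd (e b) (a \<otimes> v) \<otimes> b)" if "finite F'" "?F \<subseteq> F'" for F'
    proof -
      have v: "v = (\<Sum>b\<in>?F. e b v *\<^sub>C b)"
        unfolding e_def by (rule cvec.sum_nonzero_representation_eq[OF B(1) in_span, symmetric])
      also have "\<dots> = (\<Sum>b\<in>F'. e b v *\<^sub>C b)"
        by (rule sum.mono_neutral_left) (use that in auto)
      finally have "a \<otimes> v = (\<Sum>b\<in>F'. a \<otimes> (e b v *\<^sub>C b))"
        by (simp flip: tensor_sum_right)
      also have "\<dots> = (\<Sum>b\<in>F'. slice_snd (e b) (a \<otimes> v) \<otimes> b)"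
        by (simp add: slice_snd_tensor[OF e] tensor_scale_left tensor_scale_right)
      finally show ?thesis .
    qed
    then show ?case using fin by blast
  next
    case (add s t)
    then obtain F G where FG: "finite F" "\<And>F'. finite F' \<Longrightarrow> F \<subseteq> F' \<Longrightarrow> s = (\<Sum>b\<in>F'. slice_snd (e b) s \<otimes> b)"
      "finite G" "\<And>F'. finite F' \<Longrightarrow> G \<subseteq> F' \<Longrightarrow> t = (\<Sum>b\<in>F'. slice_snd (e b) t \<otimes> b)"
      by blast
    show ?case
    proof (intro exI[of _ "F \<union> G"] conjI allI impI)
      show "finite (F \<union> G)" using FG by simp
    next
      fix F' assume F': "finite F'" "F \<union> G \<subseteq> F'"
      have "s + t = (\<Sum>b\<in>F'. slice_snd (e b) s \<otimes> b) + (\<Sum>b\<in>F'. slice_snd (e b) t \<otimes> b)"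
        using FG(2)[of F'] FG(4)[of F'] F' by simp
      also have "\<dots> = (\<Sum>b\<in>F'. slice_snd (e b) (s + t) \<otimes> b)"
        by (simp add: slice_snd_add tensor_add_left sum.distrib)
      finally show "s + t = (\<Sum>b\<in>F'. slice_snd (e b) (s + t) \<otimes> b)" .
    qed
  qed
  then obtain F where "finite F" "t = (\<Sum>b\<in>F. slice_snd (e b) t \<otimes> b)" by blast
  then show thesis using e that by blast
qed

lemma slice_snd_eqI:
  fixes s t :: "('a::complex_vector, 'b::complex_vector) tensor"
  assumes "\<And>f. clinear f \<Longrightarrow> slice_snd f s = slice_snd f t"
  shows "s = t"
proof -
  obtain F and e :: "'b \<Rightarrow> 'b \<Rightarrow> complex" where "finite F" and e: "\<And>b. clinear (e b)"
    and st: "s - t = (\<Sum>b\<in>F. slice_snd (e b) (s - t) \<otimes> b)"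
    by (rule tensor_expansion_right[of "s - t"]) (rule that)
  have "slice_snd (e b) (s - t) = 0" for b
    using assms[OF e] by (simp add: slice_snd_diff)
  then have "s - t = 0" by (subst st) simp
  then show ?thesis by simp
qed

lemma slice_fst_eqI:
  fixes s t :: "('a::complex_vector, 'b::complex_vector) tensor"
  assumes "\<And>f. clinear f \<Longrightarrow> slice_fst f s = slice_fst f t"
  shows "s = t"
proof (rule slice_snd_eqI, rule functionals_eqI)
  fix f :: "'b \<Rightarrow> complex" and g :: "'a \<Rightarrow> complex"
  assume "clinear f" "clinear g"
  then show "g (slice_snd f s) = g (slice_snd f t)"
    using assms[of g] by (simp flip: slice_exchange)
qed

text \<open>The flip transports the expansion of the second factor to the first one.\<close>

definition tensor_flip :: "('a::complex_vector, 'b::complex_vector) tensor \<Rightarrow> ('b, 'a) tensor" where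
  "tensor_flip = tensor_lift (\<lambda>a b. b \<otimes> a)"

lemma clinear_tensor_flip: "clinear tensor_flip"
  unfolding tensor_flip_def by (rule clinear_tensor_lift)

lemma tensor_flip_tensor: "tensor_flip (a \<otimes> b) = b \<otimes> a"
  unfolding tensor_flip_def
  by (subst tensor_lift_tensor)
    (auto intro!: cbilinearI clinear_tensor_left clinear_tensor_right clinear_id)

lemma slice_snd_flip: "clinear f \<Longrightarrow> slice_snd f (tensor_flip t) = slice_fst f t"
  by (induction t rule: tensor_induct)
    (simp_all add: tensor_flip_tensor slice_snd_tensor slice_fst_tensor slice_snd_add slice_fst_add
      clinear_add[OF clinear_tensor_flip])

lemma tensor_flip_flip: "tensor_flip (tensor_flip t) = t"
  by (induction t rule: tensor_induct)
    (simp_all add: tensor_flip_tensor clinear_add[OF clinear_tensor_flip])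

text \<open>In the expansion along a basis of the first factor the second factors are slices.\<close>

lemma tensor_subspace_UNIV_leftI:
  fixes t :: "('a::complex_vector, 'b::complex_vector) tensor"
  assumes "\<And>h. clinear h \<Longrightarrow> slice_fst h t \<in> W"
  shows "t \<in> tensor_subspace UNIV W"
proof -
  obtain F and e :: "'a \<Rightarrow> 'a \<Rightarrow> complex" where "finite F" and e: "\<And>b. clinear (e b)"
    and t: "tensor_flip t = (\<Sum>b\<in>F. slice_snd (e b) (tensor_flip t) \<otimes> b)"
    by (rule tensor_expansion_right[of "tensor_flip t"]) (rule that)
  have "t = tensor_flip (\<Sum>b\<in>F. slice_fst (e b) t \<otimes> b)"
    using arg_cong[OF t, of tensor_flip] by (simp add: tensor_flip_flip slice_snd_flip[OF e])
  also have "\<dots> = (\<Sum>b\<in>F. b \<otimes> slice_fst (e b) t)"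
    by (simp add: clinear_sum[OF clinear_tensor_flip] tensor_flip_tensor)
  also have "\<dots> \<in> tensor_subspace UNIV W"
    unfolding tensor_subspace_def using assms e
    by (intro cvec.span_sum cvec.span_base) blast
  finally show ?thesis .
qed

lemma tensor_cancel_right:
  assumes "a \<otimes> b = a' \<otimes> b" "b \<noteq> 0"
  shows "a = a'"
proof -
  obtain f :: "_ \<Rightarrow> complex" where "clinear f" "f b = 1"
    using functional_exists[OF assms(2)] by blast
  then show ?thesis
    using arg_cong[OF assms(1), of "slice_snd f"] by (simp add: slice_snd_tensor scaleC_one)
qed

lemma tensor_map_in_subspace:
  assumes "clinear f" "clinear g" "\<And>a. f a \<in> V" "\<And>b. g b \<in> W"
  shows "tensor_map f g t \<in> tensor_subspace V W"
proof (induction t rule: tensor_induct)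
  case (pure a b)
  then show ?case
    unfolding tensor_subspace_def using assms
    by (intro cvec.span_base) (auto simp: tensor_map_tensor)
next
  case (add s t)
  then show ?case
    unfolding tensor_subspace_def tensor_map_add by (intro cvec.span_add)
qed

section \<open>Multipliers of non-degenerate algebras\<close>

lemma clinear_act_left: "clinear ((\<rhd>) m)"
  and clinear_act_right: "clinear (\<lambda>x. x \<lhd> m)"
  by (transfer; simp)+

lemmas act_left_add = clinear_add[OF clinear_act_left]
  and act_right_add = clinear_add[OF clinear_act_right]
  and act_left_scale = clinear_scale[OF clinear_act_left]
  and act_right_scale = clinear_scale[OF clinear_act_right]
  and act_left_zero [simp] = clinear_zero[OF clinear_act_left]
  and act_right_zero [simp] = clinear_zero[OF clinear_act_right]
  and act_left_sum = clinear_sum[OF clinear_act_left]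
  and act_right_sum = clinear_sum[OF clinear_act_right]

lemma act_left_times [simp]: "(m * n) \<rhd> x = m \<rhd> (n \<rhd> x)"
  and act_right_times [simp]: "x \<lhd> (m * n) = x \<lhd> m \<lhd> n"
  and act_left_one [simp]: "1 \<rhd> x = x"
  and act_right_one [simp]: "x \<lhd> 1 = x"
  and act_left_zero_multiplier [simp]: "0 \<rhd> x = 0"
  and act_right_zero_multiplier [simp]: "x \<lhd> 0 = 0"
  and act_left_plus: "(m + n) \<rhd> x = m \<rhd> x + n \<rhd> x"
  and act_right_plus: "x \<lhd> (m + n) = x \<lhd> m + x \<lhd> n"
  and act_left_scaleC: "(c *\<^sub>C m) \<rhd> x = c *\<^sub>C (m \<rhd> x)"
  and act_right_scaleC: "x \<lhd> (c *\<^sub>C m) = c *\<^sub>C (x \<lhd> m)"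
  and act_left_to_multiplier [simp]: "to_multiplier a \<rhd> x = a * x"
  and act_right_to_multiplier [simp]: "x \<lhd> to_multiplier a = x * a"
  by (transfer; simp)+

lemma multiplier_eqI: "(\<And>x. m \<rhd> x = n \<rhd> x) \<Longrightarrow> (\<And>x. x \<lhd> m = x \<lhd> n) \<Longrightarrow> m = n"
  by transfer (auto simp: prod_eq_iff)

lemma mtensor_act_left [simp]: "(m \<otimes>\<^sub>M n) \<rhd> (a \<otimes> b) = (m \<rhd> a) \<otimes> (n \<rhd> b)"
  and mtensor_act_right [simp]: "(a \<otimes> b) \<lhd> (m \<otimes>\<^sub>M n) = (a \<lhd> m) \<otimes> (b \<lhd> n)"
  using Rep_multiplier[of m] Rep_multiplier[of n]
  by (simp_all add: act_left.rep_eq act_right.rep_eq mtensor.rep_eq tensor_map_tensor)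

lemma multiplier_tensor_eqI:
  fixes m n :: "('a::complex_algebra, 'b::complex_algebra) tensor multiplier"
  assumes "\<And>a b. m \<rhd> (a \<otimes> b) = n \<rhd> (a \<otimes> b)" "\<And>a b. (a \<otimes> b) \<lhd> m = (a \<otimes> b) \<lhd> n"
  shows "m = n"
proof (rule multiplier_eqI)
  show "m \<rhd> t = n \<rhd> t" for t
    by (induction t rule: tensor_induct) (simp_all add: assms act_left_add)
  show "t \<lhd> m = t \<lhd> n" for t
    by (induction t rule: tensor_induct) (simp_all add: assms act_right_add)
qed

lemma mtensor_mult: "(m \<otimes>\<^sub>M n) * (m' \<otimes>\<^sub>M n') = (m * m') \<otimes>\<^sub>M (n * n')"
  and mtensor_one [simp]: "1 \<otimes>\<^sub>M 1 = 1"
  and mtensor_zero_left [simp]: "0 \<otimes>\<^sub>M n = 0"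
  and mtensor_zero_right [simp]: "m \<otimes>\<^sub>M 0 = 0"
  and to_multiplier_tensor: "to_multiplier (a \<otimes> b) = to_multiplier a \<otimes>\<^sub>M to_multiplier b"
  by (rule multiplier_tensor_eqI; simp add: tensor_times_tensor)+

lemma clinear_to_multiplier: "clinear to_multiplier"
  by (rule clinearI; rule multiplier_eqI)
    (simp_all add: act_left_plus act_right_plus act_left_scaleC act_right_scaleC
      distrib_left distrib_right mult_scaleC_left mult_scaleC_right)

lemma to_multiplier_mult: "to_multiplier (a * b) = to_multiplier a * to_multiplier b"
  by (rule multiplier_eqI) (simp_all add: mult.assoc)

lemma cbilinear_mtensor: "cbilinear (\<otimes>\<^sub>M)"
proof (rule cbilinearI; rule clinearI; rule multiplier_tensor_eqI)
qed (simp_all add: act_left_plus act_right_plus act_left_scaleC act_right_scaleC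
      tensor_add_left tensor_add_right tensor_scale_left tensor_scale_right)

lemma clinear_mtensor_left: "clinear f \<Longrightarrow> clinear (\<lambda>x. f x \<otimes>\<^sub>M n)"
  and clinear_mtensor_right: "clinear f \<Longrightarrow> clinear (\<lambda>x. m \<otimes>\<^sub>M f x)"
  using clinear_compose[OF cbilinear_left[OF cbilinear_mtensor]]
    clinear_compose[OF cbilinear_right[OF cbilinear_mtensor]] by blast+

lemma clinear_eval_left: "clinear f \<Longrightarrow> clinear (\<lambda>x. f x \<rhd> t)"
  and clinear_eval_right: "clinear f \<Longrightarrow> clinear (\<lambda>x. t \<lhd> f x)"
  by (rule clinearI; simp add: clinear_add clinear_scale act_left_plus act_right_plus
      act_left_scaleC act_right_scaleC)+

lemma slice_fst_act:
  assumes "clinear f"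
  shows "slice_fst f ((1 \<otimes>\<^sub>M m) \<rhd> t) = m \<rhd> slice_fst f t"
    and "slice_fst f (t \<lhd> (1 \<otimes>\<^sub>M m)) = slice_fst f t \<lhd> m"
    and "slice_fst f ((m \<otimes>\<^sub>M 1) \<rhd> t) = slice_fst (\<lambda>x. f (m \<rhd> x)) t"
    and "slice_fst f (t \<lhd> (m \<otimes>\<^sub>M 1)) = slice_fst (\<lambda>x. f (x \<lhd> m)) t"
proof -
  note lin = assms clinear_compose[OF assms clinear_act_left] clinear_compose[OF assms clinear_act_right]
  show "slice_fst f ((1 \<otimes>\<^sub>M m) \<rhd> t) = m \<rhd> slice_fst f t"
    "slice_fst f (t \<lhd> (1 \<otimes>\<^sub>M m)) = slice_fst f t \<lhd> m"
    "slice_fst f ((m \<otimes>\<^sub>M 1) \<rhd> t) = slice_fst (\<lambda>x. f (m \<rhd> x)) t"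
    "slice_fst f (t \<lhd> (m \<otimes>\<^sub>M 1)) = slice_fst (\<lambda>x. f (x \<lhd> m)) t"
    by (induction t rule: tensor_induct; simp add: lin slice_fst_tensor slice_fst_add
        act_left_add act_right_add act_left_scale act_right_scale)+
qed

lemma slice_snd_act:
  assumes "clinear f"
  shows "slice_snd f ((m \<otimes>\<^sub>M 1) \<rhd> t) = m \<rhd> slice_snd f t"
    and "slice_snd f (t \<lhd> (m \<otimes>\<^sub>M 1)) = slice_snd f t \<lhd> m"
    and "slice_snd f ((1 \<otimes>\<^sub>M m) \<rhd> t) = slice_snd (\<lambda>x. f (m \<rhd> x)) t"
    and "slice_snd f (t \<lhd> (1 \<otimes>\<^sub>M m)) = slice_snd (\<lambda>x. f (x \<lhd> m)) t"
proof -
  note lin = assms clinear_compose[OF assms clinear_act_left] clinear_compose[OF assms clinear_act_right]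
  show "slice_snd f ((m \<otimes>\<^sub>M 1) \<rhd> t) = m \<rhd> slice_snd f t"
    "slice_snd f (t \<lhd> (m \<otimes>\<^sub>M 1)) = slice_snd f t \<lhd> m"
    "slice_snd f ((1 \<otimes>\<^sub>M m) \<rhd> t) = slice_snd (\<lambda>x. f (m \<rhd> x)) t"
    "slice_snd f (t \<lhd> (1 \<otimes>\<^sub>M m)) = slice_snd (\<lambda>x. f (x \<lhd> m)) t"
    by (induction t rule: tensor_induct; simp add: lin slice_snd_tensor slice_snd_add
        act_left_add act_right_add act_left_scale act_right_scale)+
qed

lemma multiplier_assoc_act:
  "multiplier_assoc M \<rhd> tensor_assoc t = tensor_assoc (M \<rhd> t)"
  "tensor_assoc t \<lhd> multiplier_assoc M = tensor_assoc (t \<lhd> M)"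
  by (simp_all add: act_left.rep_eq act_right.rep_eq multiplier_assoc.rep_eq tensor_assoc_inverse)

locale nondegenerate_algebra =
  fixes T :: "'a::complex_algebra itself"
  assumes nondeg_left: "\<And>a :: 'a. (\<And>b. a * b = 0) \<Longrightarrow> a = 0"
    and nondeg_right: "\<And>a :: 'a. (\<And>b. b * a = 0) \<Longrightarrow> a = 0"
begin

lemma eq_leftI: "(\<And>c. a * c = b * c) \<Longrightarrow> a = b" for a b :: 'a
  using nondeg_left[of "a - b"] by (simp add: left_diff_distrib)

lemma eq_rightI: "(\<And>c. c * a = c * b) \<Longrightarrow> a = b" for a b :: 'a
  using nondeg_right[of "a - b"] by (simp add: right_diff_distrib)

lemma act_left_mult: "(m \<rhd> x) * y = m \<rhd> (x * y)" for x y :: 'a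
  by (rule eq_rightI) (simp add: act_middle flip: mult.assoc)

lemma act_right_mult: "x * (y \<lhd> m) = (x * y) \<lhd> m" for x y :: 'a
  by (rule eq_leftI) (simp add: mult.assoc flip: act_middle)

lemma act_left_right: "(m \<rhd> x) \<lhd> n = m \<rhd> (x \<lhd> n)" for x :: 'a
  by (rule eq_rightI) (simp add: act_right_mult act_middle)

lemma mult_to_multiplier:
  "m * to_multiplier x = to_multiplier (m \<rhd> x)"
  "to_multiplier x * m = to_multiplier (x \<lhd> m)" for x :: 'a
  by (rule multiplier_eqI; simp add: act_left_mult act_right_mult act_middle)+

lemma to_multiplier_inject: "to_multiplier x = to_multiplier y \<longleftrightarrow> x = y" for x y :: 'a
proof
  assume "to_multiplier x = to_multiplier y"
  then have "to_multiplier x \<rhd> c = to_multiplier y \<rhd> c" for c by simp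
  then show "x = y" using eq_leftI[of x y] by simp
qed simp

lemma from_to_multiplier [simp]: "from_multiplier (to_multiplier x) = x" for x :: 'a
  unfolding from_multiplier_def by (rule inv_f_f) (simp add: inj_def to_multiplier_inject)

lemma to_from_multiplier: "m \<in> range to_multiplier \<Longrightarrow> to_multiplier (from_multiplier m) = m"
  for m :: "'a multiplier"
  by auto

lemma multiplier_eq_leftI: "(\<And>x. m \<rhd> x = n \<rhd> x) \<Longrightarrow> m = n" for m :: "'a multiplier"
proof (rule multiplier_eqI)
  fix x assume eq: "\<And>x. m \<rhd> x = n \<rhd> x"
  show "x \<lhd> m = x \<lhd> n" by (rule eq_leftI) (simp add: eq flip: act_middle)
qed

lemma multiplier_eq_rightI: "(\<And>x. x \<lhd> m = x \<lhd> n) \<Longrightarrow> m = n" for m :: "'a multiplier"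
proof (rule multiplier_eqI)
  fix x assume eq: "\<And>x. x \<lhd> m = x \<lhd> n"
  show "m \<rhd> x = n \<rhd> x" by (rule eq_rightI) (simp add: eq act_middle)
qed

end

text \<open>A product with an elementary tensor \<open>a \<otimes> b\<close> is sliced by \<open>f\<close> to the product of \<open>a\<close> with a slice by
  \<open>x \<mapsto> f (x b)\<close>.  So non-degeneracy of the first factor kills these slices, and
  non-degeneracy of the second factor kills all others.\<close>

lemma nondegenerate_tensor:
  assumes "nondegenerate_algebra TYPE('a::complex_algebra)" "nondegenerate_algebra TYPE('b::complex_algebra)"
  shows "nondegenerate_algebra TYPE(('a, 'b) tensor)"
proof -
  interpret A: nondegenerate_algebra "TYPE('a)" by fact
  interpret B: nondegenerate_algebra "TYPE('b)" by fact
  show ?thesis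
  proof
    fix t :: "('a, 'b) tensor"
    assume t: "t * u = 0" for u
    have eq: "slice_snd f (t * (a \<otimes> b)) = slice_snd (\<lambda>x. f (x * b)) t * a"
      if "clinear f" for f and a b
      by (induction t rule: tensor_induct)
        (use that in \<open>simp_all add: tensor_times_tensor slice_snd_tensor slice_snd_add
          mult_scaleC_left distrib_right clinear_compose[OF _ clinear_mult_right[OF clinear_id]]\<close>)
    have "slice_snd (\<lambda>x. f (x * b)) t = 0" if "clinear f" for f b
      by (rule A.nondeg_left) (use eq[OF that] t in \<open>simp flip: eq\<close>)
    then have f0: "f (slice_fst h t * b) = 0" if "clinear f" "clinear h" for f :: "'b \<Rightarrow> complex" and h b
      using slice_exchange[OF clinear_compose[OF that(1) clinear_mult_right[OF clinear_id, of b]] that(2), of t] that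
      by (simp add: clinear_zero)
    have "slice_fst h t * b = 0" if "clinear h" for h b
      by (rule functionals_eqI) (simp add: f0 that clinear_zero)
    then have "slice_fst h t = slice_fst h 0" if "clinear h" for h
      using that B.nondeg_left by simp
    then show "t = 0" by (rule slice_fst_eqI)
  next
    fix t :: "('a, 'b) tensor"
    assume t: "u * t = 0" for u
    have eq: "slice_snd f ((a \<otimes> b) * t) = a * slice_snd (\<lambda>x. f (b * x)) t"
      if "clinear f" for f and a b
      by (induction t rule: tensor_induct)
        (use that in \<open>simp_all add: tensor_times_tensor slice_snd_tensor slice_snd_add
          mult_scaleC_right distrib_left clinear_compose[OF _ clinear_mult_left[OF clinear_id]]\<close>)
    have "slice_snd (\<lambda>x. f (b * x)) t = 0" if "clinear f" for f b
      by (rule A.nondeg_right) (use eq[OF that] t in \<open>simp flip: eq\<close>)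
    then have f0: "f (b * slice_fst h t) = 0" if "clinear f" "clinear h" for f :: "'b \<Rightarrow> complex" and h b
      using slice_exchange[OF clinear_compose[OF that(1) clinear_mult_left[OF clinear_id, of b]] that(2), of t] that
      by (simp add: clinear_zero)
    have "b * slice_fst h t = 0" if "clinear h" for h b
      by (rule functionals_eqI) (simp add: f0 that clinear_zero)
    then have "slice_fst h t = slice_fst h 0" if "clinear h" for h
      using that B.nondeg_right by simp
    then show "t = 0" by (rule slice_fst_eqI)
  qed
qed

lemma (in nondegenerate_algebra) multiplier_tensor_eq_leftI:
  fixes m n :: "('a, 'b::complex_algebra) tensor multiplier"
  assumes "nondegenerate_algebra TYPE('b)"
    and "\<And>a b. m \<rhd> (a \<otimes> b) = n \<rhd> (a \<otimes> b)"
  shows "m = n"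
proof -
  interpret AB: nondegenerate_algebra "TYPE(('a, 'b) tensor)"
    using nondegenerate_algebra_axioms assms(1) by (rule nondegenerate_tensor)
  have "m \<rhd> t = n \<rhd> t" for t
    by (induction t rule: tensor_induct) (simp_all add: assms act_left_add)
  then show ?thesis by (rule AB.multiplier_eq_leftI)
qed

subsection \<open>Extension of homomorphisms to multipliers\<close>

text \<open>The data for which \<open>multiplier_extension\<close> is meaningful.  On \<open>e C = \<gamma>(B) C\<close> the extension has
  to send \<open>\<gamma>(b) c\<close> to \<open>\<gamma>(m b) c\<close>.  That this is well defined is seen by testing against \<open>\<gamma>(b')\<close> on the
  left, where \<open>\<gamma>(b') \<gamma>(m b) = \<gamma>(b' m) \<gamma>(b)\<close> no longer involves \<open>m b\<close>.\<close>

locale extendable_homomorphism =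
  B: nondegenerate_algebra "TYPE('b::complex_algebra)" +
  C: nondegenerate_algebra "TYPE('c::complex_algebra)"
  for \<gamma> :: "'b::complex_algebra \<Rightarrow> 'c::complex_algebra multiplier" and e :: "'c multiplier" +
  assumes linear: "clinear \<gamma>"
    and mult: "\<gamma> (a * b) = \<gamma> a * \<gamma> b"
    and idem: "e * e = e"
    and span_left: "cvec.span {\<gamma> b \<rhd> c | b c. True} = range (\<lambda>c. e \<rhd> c)"
    and span_right: "cvec.span {c \<lhd> \<gamma> b | b c. True} = range (\<lambda>c. c \<lhd> e)"
begin

lemma mult_e: "\<gamma> b * e = \<gamma> b"
proof (rule C.multiplier_eq_rightI)
  fix c
  have "c \<lhd> \<gamma> b \<in> range (\<lambda>c. c \<lhd> e)"
    unfolding span_right[symmetric] by (rule cvec.span_base) blast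
  then obtain d where "c \<lhd> \<gamma> b = d \<lhd> e" by blast
  moreover have "d \<lhd> e \<lhd> e = d \<lhd> e" using idem by (metis act_right_times)
  ultimately show "c \<lhd> (\<gamma> b * e) = c \<lhd> \<gamma> b" by simp
qed

lemma e_mult: "e * \<gamma> b = \<gamma> b"
proof (rule C.multiplier_eq_leftI)
  fix c
  have "\<gamma> b \<rhd> c \<in> range (\<lambda>c. e \<rhd> c)"
    unfolding span_left[symmetric] by (rule cvec.span_base) blast
  then obtain d where "\<gamma> b \<rhd> c = e \<rhd> d" by blast
  moreover have "e \<rhd> (e \<rhd> d) = e \<rhd> d" using idem by (metis act_left_times)
  ultimately show "(e * \<gamma> b) \<rhd> c = \<gamma> b \<rhd> c" by simp
qed

lemma cancel_left:
  assumes "\<And>b. \<gamma> b \<rhd> x = \<gamma> b \<rhd> y"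
  shows "e \<rhd> x = e \<rhd> y"
proof (rule C.eq_rightI)
  fix c
  have "u * x = u * y" if "u \<in> cvec.span {c \<lhd> \<gamma> b | b c. True}" for u
    using that
  proof (induction rule: cvec.span_induct_alt)
    case (step r u v)
    then show ?case
      using assms by (auto simp: distrib_right mult_scaleC_left simp flip: act_middle)
  qed simp
  from this[of "c \<lhd> e"] show "c * (e \<rhd> x) = c * (e \<rhd> y)"
    unfolding span_right by (simp add: act_middle)
qed

text \<open>The vector \<open>x = m c\<close> is characterised by its position in \<open>e C\<close> and by the values \<open>\<gamma>(b) x = \<gamma>(b m) c\<close>; in
  this form it is unique by \<open>cancel_left\<close>, and the action of a sum or product of multipliers can be
  recognised without choosing representatives.\<close>

lemma left_action_exists: "\<exists>x. e \<rhd> x = x \<and> (\<forall>b. \<gamma> b \<rhd> x = \<gamma> (b \<lhd> m) \<rhd> c)"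
proof -
  have "\<exists>x. e \<rhd> x = x \<and> (\<forall>b. \<gamma> b \<rhd> x = \<gamma> (b \<lhd> m) \<rhd> u)" if "u \<in> cvec.span {\<gamma> b \<rhd> c | b c. True}" for u
    using that
  proof (induction rule: cvec.span_induct_alt)
    case base
    then show ?case by (intro exI[of _ 0]) simp
  next
    case (step r u v)
    then obtain y d c where y: "e \<rhd> y = y" "\<And>b. \<gamma> b \<rhd> y = \<gamma> (b \<lhd> m) \<rhd> v" and u: "u = \<gamma> d \<rhd> c"
      by blast
    have "e \<rhd> (r *\<^sub>C (\<gamma> (m \<rhd> d) \<rhd> c) + y) = r *\<^sub>C (\<gamma> (m \<rhd> d) \<rhd> c) + y"
      using y e_mult[of "m \<rhd> d"] by (simp add: act_left_add act_left_scale flip: act_left_times)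
    moreover have "\<gamma> b \<rhd> (r *\<^sub>C (\<gamma> (m \<rhd> d) \<rhd> c) + y) = \<gamma> (b \<lhd> m) \<rhd> (r *\<^sub>C u + v)" for b
      using y by (simp add: u act_left_add act_left_scale act_middle mult[symmetric]
          flip: act_left_times)
    ultimately show ?case by blast
  qed
  from this[of "e \<rhd> c"] obtain x where "e \<rhd> x = x" "\<And>b. \<gamma> b \<rhd> x = \<gamma> (b \<lhd> m) \<rhd> (e \<rhd> c)"
    unfolding span_left by blast
  then show ?thesis
    using mult_e by (metis act_left_times)
qed

definition left_action :: "'b multiplier \<Rightarrow> 'c \<Rightarrow> 'c" where
  "left_action m c = (SOME x. e \<rhd> x = x \<and> (\<forall>b. \<gamma> b \<rhd> x = \<gamma> (b \<lhd> m) \<rhd> c))"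

lemma left_action: "e \<rhd> left_action m c = left_action m c"
    "\<gamma> b \<rhd> left_action m c = \<gamma> (b \<lhd> m) \<rhd> c"
  using someI_ex[OF left_action_exists, of m c] unfolding left_action_def by blast+

lemma left_action_eqI:
  assumes "e \<rhd> x = x" "\<And>b. \<gamma> b \<rhd> x = \<gamma> (b \<lhd> m) \<rhd> c"
  shows "left_action m c = x"
  using cancel_left[of "left_action m c" x] left_action assms by simp

text \<open>Non-degeneracy reduces the right action to the left one: \<open>a m\<close> is determined by the
  products \<open>(a m) c = a (m c)\<close>.\<close>

lemma right_action_exists: "\<exists>y. \<forall>c. y * c = a * left_action m c"
proof -
  have "\<exists>y. \<forall>c. y * c = u * left_action m c" if "u \<in> cvec.span {c \<lhd> \<gamma> b | b c. True}" for u
    using that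
  proof (induction rule: cvec.span_induct_alt)
    case base
    then show ?case by (intro exI[of _ 0]) simp
  next
    case (step r u v)
    then obtain y d c where y: "\<And>c. y * c = v * left_action m c" and u: "u = c \<lhd> \<gamma> d"
      by blast
    have "(r *\<^sub>C (c \<lhd> \<gamma> (d \<lhd> m)) + y) * x = (r *\<^sub>C u + v) * left_action m x" for x
      using y by (simp add: u distrib_right mult_scaleC_left left_action flip: act_middle)
    then show ?case by blast
  qed
  from this[of "a \<lhd> e"] obtain y where "\<And>c. y * c = (a \<lhd> e) * left_action m c"
    unfolding span_right by blast
  then show ?thesis
    by (auto simp: left_action simp flip: act_middle)
qed

definition right_action :: "'b multiplier \<Rightarrow> 'c \<Rightarrow> 'c" where
  "right_action m a = (SOME y. \<forall>c. y * c = a * left_action m c)"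

lemma right_action: "right_action m a * c = a * left_action m c"
  using someI_ex[OF right_action_exists, of a m] unfolding right_action_def by blast

lemma extension_exists:
  obtains G where "clinear G" "\<And>m n. G (m * n) = G m * G n" "\<And>b. G (to_multiplier b) = \<gamma> b" "G 1 = e"
proof -
  have "clinear (left_action m)" for m
    by (rule clinearI; rule left_action_eqI)
      (simp_all add: act_left_add act_left_scale left_action)
  moreover have "clinear (right_action m)" for m
    by (rule clinearI; rule C.eq_leftI)
      (simp_all add: right_action distrib_right mult_scaleC_left)
  ultimately have "(left_action m, right_action m) \<in> {m. clinear (fst m) \<and> clinear (snd m) \<and> (\<forall>a b. a * fst m b = snd m a * b)}" for m
    by (simp add: right_action)
  then have G: "Abs_multiplier (left_action m, right_action m) \<rhd> c = left_action m c" for m c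
    by (simp add: act_left_def Abs_multiplier_inverse)
  show thesis
  proof
    let ?G = "\<lambda>m. Abs_multiplier (left_action m, right_action m)"
    show "clinear ?G"
      by (rule clinearI; rule C.multiplier_eq_leftI)
        (auto simp: G act_left_plus act_left_scaleC act_left_add act_left_scale left_action
          act_right_plus act_right_scaleC clinear_add[OF linear] clinear_scale[OF linear]
          intro!: left_action_eqI)
    show "?G (m * n) = ?G m * ?G n" for m n
      by (rule C.multiplier_eq_leftI) (auto simp: G left_action intro!: left_action_eqI)
    show "?G (to_multiplier b) = \<gamma> b" for b
      using e_mult by (intro C.multiplier_eq_leftI)
        (auto simp: G mult simp flip: act_left_times intro!: left_action_eqI)
    show "?G 1 = e"
      using idem mult_e by (intro C.multiplier_eq_leftI)
        (auto simp: G mult simp flip: act_left_times intro!: left_action_eqI)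
  qed
qed

lemma extension_unique:
  assumes "clinear G" "\<And>m n. G (m * n) = G m * G n" "\<And>b. G (to_multiplier b) = \<gamma> b" "G 1 = e"
    and "clinear H" "\<And>m n. H (m * n) = H m * H n" "\<And>b. H (to_multiplier b) = \<gamma> b" "H 1 = e"
  shows "G = H"
proof (rule ext, rule C.multiplier_eq_leftI)
  fix m c
  have "\<gamma> b * G m = \<gamma> b * H m" for b
    using assms(2)[of "to_multiplier b" m] assms(3) assms(6)[of "to_multiplier b" m] assms(7)
    by (simp add: B.mult_to_multiplier)
  then have "e \<rhd> (G m \<rhd> c) = e \<rhd> (H m \<rhd> c)"
    by (intro cancel_left) (metis act_left_times)
  moreover have "e * G m = G m" "e * H m = H m"
    using assms(2)[of 1 m] assms(4) assms(6)[of 1 m] assms(8) by (simp_all add: multiplier_one)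
  ultimately show "G m \<rhd> c = H m \<rhd> c"
    by (metis act_left_times)
qed

lemma multiplier_extension_mult:
  "multiplier_extension \<gamma> e m * \<gamma> b = \<gamma> (m \<rhd> b)"
  "\<gamma> b * multiplier_extension \<gamma> e m = \<gamma> (b \<lhd> m)"
proof -
  let ?P = "\<lambda>G. clinear G \<and> (\<forall>m n. G (m * n) = G m * G n) \<and> (\<forall>b. G (to_multiplier b) = \<gamma> b) \<and> G 1 = e"
  have "\<exists>!G. ?P G"
  proof (rule ex_ex1I)
    show "\<exists>G. ?P G" using extension_exists by metis
    show "G = H" if "?P G" "?P H" for G H using that by (intro extension_unique) auto
  qed
  from theI'[OF this] have "?P (multiplier_extension \<gamma> e)"
    unfolding multiplier_extension_def .
  then show "multiplier_extension \<gamma> e m * \<gamma> b = \<gamma> (m \<rhd> b)"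
    "\<gamma> b * multiplier_extension \<gamma> e m = \<gamma> (b \<lhd> m)"
    by (metis B.mult_to_multiplier)+
qed

end

subsection \<open>Strictly convergent sums\<close>

lemma has_strict_sumI:
  assumes "\<And>b. \<exists>F. finite F \<and> F \<subseteq> S \<and> (\<forall>i\<in>S - F. f i \<rhd> b = 0) \<and> m \<rhd> b = (\<Sum>i\<in>F. f i \<rhd> b)"
    and "\<And>b. \<exists>F. finite F \<and> F \<subseteq> S \<and> (\<forall>i\<in>S - F. b \<lhd> f i = 0) \<and> b \<lhd> m = (\<Sum>i\<in>F. b \<lhd> f i)"
  shows "has_strict_sum f S m"
  unfolding has_strict_sum_def
proof (intro allI conjI)
  fix b
  obtain F where F: "finite F" "F \<subseteq> S" "\<forall>i\<in>S - F. f i \<rhd> b = 0" "m \<rhd> b = (\<Sum>i\<in>F. f i \<rhd> b)"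
    using assms(1) by metis
  show "finite {i \<in> S. f i \<rhd> b \<noteq> 0}" by (rule finite_subset[OF _ F(1)]) (use F in auto)
  show "m \<rhd> b = (\<Sum>i\<in>{i \<in> S. f i \<rhd> b \<noteq> 0}. f i \<rhd> b)"
    unfolding F(4) by (rule sum.mono_neutral_right) (use F in auto)
  obtain G where G: "finite G" "G \<subseteq> S" "\<forall>i\<in>S - G. b \<lhd> f i = 0" "b \<lhd> m = (\<Sum>i\<in>G. b \<lhd> f i)"
    using assms(2) by metis
  show "finite {i \<in> S. b \<lhd> f i \<noteq> 0}" by (rule finite_subset[OF _ G(1)]) (use G in auto)
  show "b \<lhd> m = (\<Sum>i\<in>{i \<in> S. b \<lhd> f i \<noteq> 0}. b \<lhd> f i)"
    unfolding G(4) by (rule sum.mono_neutral_right) (use G in auto)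
qed

lemma has_strict_sumD:
  assumes "has_strict_sum f S m"
  shows "finite {i \<in> S. f i \<rhd> b \<noteq> 0}" "m \<rhd> b = (\<Sum>i\<in>{i \<in> S. f i \<rhd> b \<noteq> 0}. f i \<rhd> b)"
    "finite {i \<in> S. b \<lhd> f i \<noteq> 0}" "b \<lhd> m = (\<Sum>i\<in>{i \<in> S. b \<lhd> f i \<noteq> 0}. b \<lhd> f i)"
  using assms unfolding has_strict_sum_def by blast+

lemma strict_sum_eq: "has_strict_sum f S m \<Longrightarrow> strict_sum f S = m"
  unfolding strict_sum_def
  by (rule the_equality) (auto simp: has_strict_sum_def intro!: multiplier_eqI)

lemma clinear_finite_sum:
  assumes lin: "\<And>i. clinear (f i)" and fin: "\<And>b. finite {i \<in> S. f i b \<noteq> 0}"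
  shows "clinear (\<lambda>b. \<Sum>i\<in>{i \<in> S. f i b \<noteq> 0}. f i b)" (is "clinear ?L")
proof (rule clinearI)
  have L: "?L b = (\<Sum>i\<in>F. f i b)" if "finite F" "F \<subseteq> S" "{i \<in> S. f i b \<noteq> 0} \<subseteq> F" for b F
    by (rule sum.mono_neutral_left) (use that in auto)
  fix x y c
  let ?F = "{i \<in> S. f i x \<noteq> 0} \<union> {i \<in> S. f i y \<noteq> 0}"
  have F: "finite ?F" "?F \<subseteq> S" using fin by auto
  have "?L (x + y) = (\<Sum>i\<in>?F. f i (x + y))" "?L x = (\<Sum>i\<in>?F. f i x)" "?L y = (\<Sum>i\<in>?F. f i y)"
    by (rule L[OF F]; auto simp: clinear_add[OF lin])+
  then show "?L (x + y) = ?L x + ?L y" by (simp add: clinear_add[OF lin] sum.distrib)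
  have "?L (c *\<^sub>C x) = (\<Sum>i\<in>{i \<in> S. f i x \<noteq> 0}. f i (c *\<^sub>C x))"
    by (rule L) (use fin in \<open>auto simp: clinear_scale[OF lin]\<close>)
  then show "?L (c *\<^sub>C x) = c *\<^sub>C ?L x"
    by (simp add: clinear_scale[OF lin] cvec.scale_sum_right)
qed

text \<open>Local finiteness suffices: the two sums are linear, and they are compatible because \<open>a\<close> and
  \<open>b\<close> together see only finitely many indices.\<close>

lemma strict_sum_exists:
  assumes "\<And>b. finite {i \<in> S. f i \<rhd> b \<noteq> 0}" "\<And>b. finite {i \<in> S. b \<lhd> f i \<noteq> 0}"
  shows "\<exists>m. has_strict_sum f S m"
proof -
  define L where "L b = (\<Sum>i\<in>{i \<in> S. f i \<rhd> b \<noteq> 0}. f i \<rhd> b)" for b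
  define R where "R b = (\<Sum>i\<in>{i \<in> S. b \<lhd> f i \<noteq> 0}. b \<lhd> f i)" for b
  have L: "L b = (\<Sum>i\<in>F. f i \<rhd> b)" if "finite F" "F \<subseteq> S" "{i \<in> S. f i \<rhd> b \<noteq> 0} \<subseteq> F" for b F
    unfolding L_def by (rule sum.mono_neutral_left) (use that in auto)
  have R: "R b = (\<Sum>i\<in>F. b \<lhd> f i)" if "finite F" "F \<subseteq> S" "{i \<in> S. b \<lhd> f i \<noteq> 0} \<subseteq> F" for b F
    unfolding R_def by (rule sum.mono_neutral_left) (use that in auto)
  have "clinear L" "clinear R"
    unfolding L_def R_def
    by (rule clinear_finite_sum; fact clinear_act_left clinear_act_right assms)+
  moreover have "a * L b = R a * b" for a b
  proof -
    let ?F = "{i \<in> S. f i \<rhd> b \<noteq> 0} \<union> {i \<in> S. a \<lhd> f i \<noteq> 0}"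
    have F: "finite ?F" "?F \<subseteq> S" using assms by auto
    have "L b = (\<Sum>i\<in>?F. f i \<rhd> b)" "R a = (\<Sum>i\<in>?F. a \<lhd> f i)"
      by (rule L[OF F] R[OF F]; auto)+
    then show ?thesis by (simp add: sum_distrib_left sum_distrib_right act_middle)
  qed
  ultimately have "Abs_multiplier (L, R) \<rhd> b = L b" "b \<lhd> Abs_multiplier (L, R) = R b" for b
    by (simp_all add: act_left_def act_right_def Abs_multiplier_inverse)
  then have "has_strict_sum f S (Abs_multiplier (L, R))"
    using assms by (simp add: has_strict_sum_def L_def R_def)
  then show ?thesis ..
qed

text \<open>A multiplier that is orthogonal to all summands but one picks out that summand.\<close>

lemma has_strict_sum_mult:
  assumes "has_strict_sum f S m" "k \<in> S"
  shows "(\<And>i. i \<in> S \<Longrightarrow> i \<noteq> k \<Longrightarrow> g * f i = 0) \<Longrightarrow> g * m = g * f k"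
    and "(\<And>i. i \<in> S \<Longrightarrow> i \<noteq> k \<Longrightarrow> f i * g = 0) \<Longrightarrow> m * g = f k * g"
proof -
  note D = has_strict_sumD[OF assms(1)]
  have single: "(\<Sum>i\<in>F. h i) = h k" if "finite F" "\<And>i. i \<in> F \<Longrightarrow> i \<noteq> k \<Longrightarrow> h i = 0" "k \<notin> F \<Longrightarrow> h k = 0" for F and h :: "'a \<Rightarrow> 'b"
    using that by (cases "k \<in> F") (auto simp: sum.remove[of F k] intro!: sum.neutral)
  show "g * m = g * f k" if *: "\<And>i. i \<in> S \<Longrightarrow> i \<noteq> k \<Longrightarrow> g * f i = 0"
  proof (rule multiplier_eqI)
    fix b
    have "g \<rhd> f i \<rhd> b = 0" "b \<lhd> g \<lhd> f i = 0" if "i \<in> S" "i \<noteq> k" for i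
      using *[OF that] by (metis act_left_times act_left_zero_multiplier act_right_times act_right_zero_multiplier)+
    then show "(g * m) \<rhd> b = (g * f k) \<rhd> b" "b \<lhd> (g * m) = b \<lhd> (g * f k)"
      using assms(2) by (auto simp: D(2)[of b] D(4)[of "b \<lhd> g"] act_left_sum D(1,3) intro!: single)
  qed
  show "m * g = f k * g" if *: "\<And>i. i \<in> S \<Longrightarrow> i \<noteq> k \<Longrightarrow> f i * g = 0"
  proof (rule multiplier_eqI)
    fix b
    have "f i \<rhd> g \<rhd> b = 0" "b \<lhd> f i \<lhd> g = 0" if "i \<in> S" "i \<noteq> k" for i
      using *[OF that] by (metis act_left_times act_left_zero_multiplier act_right_times act_right_zero_multiplier)+
    then show "(m * g) \<rhd> b = (f k * g) \<rhd> b" "b \<lhd> (m * g) = b \<lhd> (f k * g)"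
      using assms(2) by (auto simp: D(2)[of "g \<rhd> b"] D(4)[of b] act_right_sum D(1,3) intro!: single)
  qed
qed

lemma has_strict_sum_one_separates:
  assumes "has_strict_sum f S 1"
  shows "(\<And>i. i \<in> S \<Longrightarrow> f i \<rhd> x = f i \<rhd> y) \<Longrightarrow> x = y"
    and "(\<And>i. i \<in> S \<Longrightarrow> x \<lhd> f i = y \<lhd> f i) \<Longrightarrow> x = y"
proof -
  note D = has_strict_sumD[OF assms]
  show "x = y" if eq: "\<And>i. i \<in> S \<Longrightarrow> f i \<rhd> x = f i \<rhd> y"
  proof -
    have supp: "{i \<in> S. f i \<rhd> x \<noteq> 0} = {i \<in> S. f i \<rhd> y \<noteq> 0}"
      by (rule Collect_cong) (auto simp: eq)
    have "x = (\<Sum>i\<in>{i \<in> S. f i \<rhd> x \<noteq> 0}. f i \<rhd> x)" using D(2)[of x] by simp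
    also have "\<dots> = (\<Sum>i\<in>{i \<in> S. f i \<rhd> y \<noteq> 0}. f i \<rhd> y)"
      by (rule sum.cong[OF supp]) (simp add: eq)
    also have "\<dots> = y" using D(2)[of y] by simp
    finally show ?thesis .
  qed
  show "x = y" if eq: "\<And>i. i \<in> S \<Longrightarrow> x \<lhd> f i = y \<lhd> f i"
  proof -
    have supp: "{i \<in> S. x \<lhd> f i \<noteq> 0} = {i \<in> S. y \<lhd> f i \<noteq> 0}"
      by (rule Collect_cong) (auto simp: eq)
    have "x = (\<Sum>i\<in>{i \<in> S. x \<lhd> f i \<noteq> 0}. x \<lhd> f i)" using D(4)[of x] by simp
    also have "\<dots> = (\<Sum>i\<in>{i \<in> S. y \<lhd> f i \<noteq> 0}. y \<lhd> f i)"
      by (rule sum.cong[OF supp]) (simp add: eq)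
    also have "\<dots> = y" using D(4)[of y] by simp
    finally show ?thesis .
  qed
qed

text \<open>Orthogonality turns a spanning set of vectors \<open>f i b\<close> into a decomposition \<open>x = \<Sum>\<^sub>i f i x\<close> with
  finite support.\<close>

lemma orthogonal_decomposition:
  fixes f :: "'i \<Rightarrow> 'b::complex_vector \<Rightarrow> 'b"
  assumes lin: "\<And>i. clinear (f i)"
    and orth: "\<And>i j x. i \<in> S \<Longrightarrow> j \<in> S \<Longrightarrow> f i (f j x) = (if i = j then f j x else 0)"
    and span: "UNIV \<subseteq> cvec.span {f i b | i b. i \<in> S}"
  shows "\<exists>F. finite F \<and> F \<subseteq> S \<and> (\<forall>i\<in>S - F. f i x = 0) \<and> x = (\<Sum>i\<in>F. f i x)"
proof -
  have "x \<in> cvec.span {f i b | i b. i \<in> S}" using span by blast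
  then have "\<exists>F. finite F \<and> F \<subseteq> S \<and> (\<forall>G. finite G \<and> F \<subseteq> G \<and> G \<subseteq> S
      \<longrightarrow> (\<forall>i\<in>S - G. f i x = 0) \<and> x = (\<Sum>i\<in>G. f i x))"
  proof (induction rule: cvec.span_induct_alt)
    case base
    then show ?case by (intro exI[of _ "{}"]) (simp add: clinear_zero[OF lin])
  next
    case (step c u v)
    from step(1) obtain j b where u: "u = f j b" and j: "j \<in> S" by blast
    from step(2) obtain F where F: "finite F \<and> F \<subseteq> S \<and> (\<forall>G. finite G \<and> F \<subseteq> G \<and> G \<subseteq> S
        \<longrightarrow> (\<forall>i\<in>S - G. f i v = 0) \<and> v = (\<Sum>i\<in>G. f i v))"
      by (rule exE)
    note F3 = F[THEN conjunct2, THEN conjunct2, THEN spec, THEN mp]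
    have fu: "f i u = (if i = j then u else 0)" if "i \<in> S" for i
      using orth[OF that j] unfolding u by simp
    have *: "(\<forall>i\<in>S - G. f i (c *\<^sub>C u + v) = 0) \<and> c *\<^sub>C u + v = (\<Sum>i\<in>G. f i (c *\<^sub>C u + v))"
      if G: "finite G" "insert j F \<subseteq> G" "G \<subseteq> S" for G
    proof
      have "(\<Sum>i\<in>G. f i u) = (\<Sum>i\<in>G. if i = j then u else 0)"
        by (rule sum.cong) (use G fu in auto)
      also have "\<dots> = u" using G by simp
      finally show "c *\<^sub>C u + v = (\<Sum>i\<in>G. f i (c *\<^sub>C u + v))"
        using conjunct2[OF F3[of G]] G
        by (simp add: clinear_add[OF lin] clinear_scale[OF lin] sum.distrib flip: cvec.scale_sum_right)
      show "\<forall>i\<in>S - G. f i (c *\<^sub>C u + v) = 0"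
        using conjunct1[OF F3[of G]] G fu by (auto simp: clinear_add[OF lin] clinear_scale[OF lin])
    qed
    have "\<forall>G. finite G \<and> insert j F \<subseteq> G \<and> G \<subseteq> S \<longrightarrow>
        (\<forall>i\<in>S - G. f i (c *\<^sub>C u + v) = 0) \<and> c *\<^sub>C u + v = (\<Sum>i\<in>G. f i (c *\<^sub>C u + v))"
      by (intro allI impI, elim conjE, rule *)
    moreover have "finite (insert j F)" "insert j F \<subseteq> S" using F j by auto
    ultimately show ?case by (intro exI[of _ "insert j F"] conjI)
  qed
  then obtain F where F: "finite F \<and> F \<subseteq> S \<and> (\<forall>G. finite G \<and> F \<subseteq> G \<and> G \<subseteq> S
      \<longrightarrow> (\<forall>i\<in>S - G. f i x = 0) \<and> x = (\<Sum>i\<in>G. f i x))"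
    by (rule exE)
  show ?thesis
    using F[THEN conjunct2, THEN conjunct2, THEN spec, THEN mp, of F] F
    by (intro exI[of _ F]) simp
qed

lemma orthogonal_family_strict_sum:
  fixes f :: "'i \<Rightarrow> 'b::complex_algebra multiplier"
  assumes orth: "\<And>i j. i \<in> S \<Longrightarrow> j \<in> S \<Longrightarrow> f i * f j = (if i = j then f i else 0)"
    and left: "UNIV \<subseteq> cvec.span {f i \<rhd> b | i b. i \<in> S}"
    and right: "UNIV \<subseteq> cvec.span {b \<lhd> f i | i b. i \<in> S}"
  shows "has_strict_sum f S 1"
proof (rule has_strict_sumI)
  fix x
  have "f i \<rhd> f j \<rhd> x = (if i = j then f j \<rhd> x else 0)"
    "x \<lhd> f j \<lhd> f i = (if i = j then x \<lhd> f j else 0)" if "i \<in> S" "j \<in> S" for i j x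
    using arg_cong[OF orth[OF that], of "\<lambda>m. m \<rhd> x"] arg_cong[OF orth[OF that(2,1)], of "\<lambda>m. x \<lhd> m"]
    by auto
  note orth' = this
  show "\<exists>F. finite F \<and> F \<subseteq> S \<and> (\<forall>i\<in>S - F. f i \<rhd> x = 0) \<and> 1 \<rhd> x = (\<Sum>i\<in>F. f i \<rhd> x)"
    unfolding act_left_one
    by (rule orthogonal_decomposition[OF clinear_act_left orth'(1) left])
  show "\<exists>F. finite F \<and> F \<subseteq> S \<and> (\<forall>i\<in>S - F. x \<lhd> f i = 0) \<and> x \<lhd> 1 = (\<Sum>i\<in>F. x \<lhd> f i)"
    unfolding act_right_one
    by (rule orthogonal_decomposition[where f = "\<lambda>i x. x \<lhd> f i", OF clinear_act_right orth'(2) right])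
qed

section \<open>Comultiplication and counit slices\<close>

lemma subspace_range: "clinear f \<Longrightarrow> cvec.subspace (range f)"
  unfolding cvec.subspace_def image_iff
  by (auto simp flip: clinear_zero[of f] clinear_add[of f] clinear_scale[of f])

lemma tensor_span:
  assumes "v \<in> cvec.span V" "w \<in> cvec.span W" "cvec.subspace S"
    and "\<And>v w. v \<in> V \<Longrightarrow> w \<in> W \<Longrightarrow> v \<otimes> w \<in> S"
  shows "v \<otimes> w \<in> S"
  using assms(1)
proof (induction rule: cvec.span_induct_alt)
  case base
  then show ?case using cvec.subspace_0[OF assms(3)] by simp
next
  case (step c x y)
  have "x \<otimes> w \<in> S"
    using assms(2)
  proof (induction rule: cvec.span_induct_alt)
    case base
    then show ?case using cvec.subspace_0[OF assms(3)] by simp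
  next
    case (step d p q)
    then show ?case
      using assms(4)[OF \<open>x \<in> V\<close>] assms(3)
      by (simp add: tensor_add_right tensor_scale_right cvec.subspace_add cvec.subspace_scale)
  qed
  then show ?case
    using step assms(3)
    by (simp add: tensor_add_left tensor_scale_left cvec.subspace_add cvec.subspace_scale)
qed

lemma act_elementary_tensor:
  "t \<lhd> (to_multiplier b \<otimes>\<^sub>M 1) \<lhd> (1 \<otimes>\<^sub>M to_multiplier c) = t * (b \<otimes> c)"
  "(1 \<otimes>\<^sub>M to_multiplier c) \<rhd> (to_multiplier b \<otimes>\<^sub>M 1) \<rhd> t = (b \<otimes> c) * t"
proof -
  have "t \<lhd> ((to_multiplier b \<otimes>\<^sub>M 1) * (1 \<otimes>\<^sub>M to_multiplier c)) = t \<lhd> to_multiplier (b \<otimes> c)"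
    "((1 \<otimes>\<^sub>M to_multiplier c) * (to_multiplier b \<otimes>\<^sub>M 1)) \<rhd> t = to_multiplier (b \<otimes> c) \<rhd> t"
    by (simp_all only: mtensor_mult multiplier_one to_multiplier_tensor)
  then show "t \<lhd> (to_multiplier b \<otimes>\<^sub>M 1) \<lhd> (1 \<otimes>\<^sub>M to_multiplier c) = t * (b \<otimes> c)"
    "(1 \<otimes>\<^sub>M to_multiplier c) \<rhd> (to_multiplier b \<otimes>\<^sub>M 1) \<rhd> t = (b \<otimes> c) * t"
    by simp_all
qed

text \<open>The homomorphism \<open>f \<otimes> g\<close> with values in multipliers.  With the canonical embedding for one of
  the factors it is \<open>\<Delta> \<otimes> id\<close> or \<open>id \<otimes> \<Delta>\<close>, whose extensions are \<open>comult_id\<close> and \<open>id_comult\<close>.\<close>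

definition mtensor_hom :: "('a::complex_vector \<Rightarrow> 'c::complex_algebra multiplier)
    \<Rightarrow> ('b::complex_vector \<Rightarrow> 'd::complex_algebra multiplier)
    \<Rightarrow> ('a, 'b) tensor \<Rightarrow> ('c, 'd) tensor multiplier" where
  "mtensor_hom f g = tensor_lift (\<lambda>a b. f a \<otimes>\<^sub>M g b)"

lemma mtensor_hom_add: "mtensor_hom f g (s + t) = mtensor_hom f g s + mtensor_hom f g t"
  unfolding mtensor_hom_def by (rule clinear_add[OF clinear_tensor_lift])

lemma mtensor_hom_tensor: "clinear f \<Longrightarrow> clinear g \<Longrightarrow> mtensor_hom f g (a \<otimes> b) = f a \<otimes>\<^sub>M g b"
  unfolding mtensor_hom_def
  by (subst tensor_lift_tensor)
    (auto intro!: cbilinearI clinear_mtensor_left clinear_mtensor_right)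

lemma extendable_tensor:
  assumes "extendable_homomorphism f d" "extendable_homomorphism g e"
  shows "extendable_homomorphism (mtensor_hom f g) (d \<otimes>\<^sub>M e)"
proof -
  interpret F: extendable_homomorphism f d by fact
  interpret G: extendable_homomorphism g e by fact
  note lift = mtensor_hom_tensor[OF F.linear G.linear]
  let ?h = "mtensor_hom f g"
  have mult: "?h (s * t) = ?h s * ?h t" for s t
  proof (induction s rule: tensor_induct)
    case (pure a b)
    show ?case
      by (induction t rule: tensor_induct)
        (simp_all add: lift tensor_times_tensor mtensor_mult F.mult G.mult distrib_left mtensor_hom_add)
  qed (simp add: distrib_right mtensor_hom_add)
  have left: "(d \<otimes>\<^sub>M e) * ?h t = ?h t" for t
    by (induction t rule: tensor_induct)
      (simp_all add: lift mtensor_mult F.e_mult G.e_mult distrib_left mtensor_hom_add)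
  have right: "?h t * (d \<otimes>\<^sub>M e) = ?h t" for t
    by (induction t rule: tensor_induct)
      (simp_all add: lift mtensor_mult F.mult_e G.mult_e distrib_right mtensor_hom_add)
  have sl: "cvec.span {?h b \<rhd> c | b c. True} = range (\<lambda>c. (d \<otimes>\<^sub>M e) \<rhd> c)"
  proof
    show "cvec.span {?h b \<rhd> c | b c. True} \<subseteq> range (\<lambda>c. (d \<otimes>\<^sub>M e) \<rhd> c)"
      by (rule cvec.span_minimal[OF _ subspace_range[OF clinear_act_left]])
        (auto, metis act_left_times left rangeI)
    have "(d \<otimes>\<^sub>M e) \<rhd> t \<in> cvec.span {?h b \<rhd> c | b c. True}" for t
    proof (induction t rule: tensor_induct)
      case (pure x y)
      have "d \<rhd> x \<in> cvec.span {f b \<rhd> c | b c. True}" "e \<rhd> y \<in> cvec.span {g b \<rhd> c | b c. True}"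
        using F.span_left G.span_left by auto
      then have "(d \<rhd> x) \<otimes> (e \<rhd> y) \<in> cvec.span {?h b \<rhd> c | b c. True}"
        by (rule tensor_span[OF _ _ cvec.subspace_span])
          (auto intro!: cvec.span_base, metis mtensor_hom_tensor[OF F.linear G.linear] mtensor_act_left)
      then show ?case by simp
    qed (simp add: act_left_add cvec.span_add)
    then show "range (\<lambda>c. (d \<otimes>\<^sub>M e) \<rhd> c) \<subseteq> cvec.span {?h b \<rhd> c | b c. True}" by blast
  qed
  have sr: "cvec.span {c \<lhd> ?h b | b c. True} = range (\<lambda>c. c \<lhd> (d \<otimes>\<^sub>M e))"
  proof
    show "cvec.span {c \<lhd> ?h b | b c. True} \<subseteq> range (\<lambda>c. c \<lhd> (d \<otimes>\<^sub>M e))"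
      by (rule cvec.span_minimal[OF _ subspace_range[OF clinear_act_right]])
        (auto, metis act_right_times right rangeI)
    have "t \<lhd> (d \<otimes>\<^sub>M e) \<in> cvec.span {c \<lhd> ?h b | b c. True}" for t
    proof (induction t rule: tensor_induct)
      case (pure x y)
      have "x \<lhd> d \<in> cvec.span {c \<lhd> f b | b c. True}" "y \<lhd> e \<in> cvec.span {c \<lhd> g b | b c. True}"
        using F.span_right G.span_right by auto
      then have "(x \<lhd> d) \<otimes> (y \<lhd> e) \<in> cvec.span {c \<lhd> ?h b | b c. True}"
        by (rule tensor_span[OF _ _ cvec.subspace_span])
          (auto intro!: cvec.span_base, metis mtensor_hom_tensor[OF F.linear G.linear] mtensor_act_right)
      then show ?case by simp
    qed (simp add: act_right_add cvec.span_add)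
    then show "range (\<lambda>c. c \<lhd> (d \<otimes>\<^sub>M e)) \<subseteq> cvec.span {c \<lhd> ?h b | b c. True}" by blast
  qed
  interpret B: nondegenerate_algebra "TYPE(('a, 'c) tensor)"
    by (rule nondegenerate_tensor) (fact F.B.nondegenerate_algebra_axioms G.B.nondegenerate_algebra_axioms)+
  interpret C: nondegenerate_algebra "TYPE(('b, 'd) tensor)"
    by (rule nondegenerate_tensor) (fact F.C.nondegenerate_algebra_axioms G.C.nondegenerate_algebra_axioms)+
  show ?thesis
  proof (intro extendable_homomorphism.intro extendable_homomorphism_axioms.intro)
    show "clinear ?h" unfolding mtensor_hom_def by (rule clinear_tensor_lift)
    show "(d \<otimes>\<^sub>M e) * (d \<otimes>\<^sub>M e) = d \<otimes>\<^sub>M e" by (simp add: mtensor_mult F.idem G.idem)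
  qed (rule mult sl sr B.nondegenerate_algebra_axioms C.nondegenerate_algebra_axioms)+
qed

context weak_multiplier_bialgebra
begin

sublocale A: nondegenerate_algebra "TYPE('a)"
  by unfold_locales (fact nondegenerate_left nondegenerate_right)+

sublocale AA: nondegenerate_algebra "TYPE(('a, 'a) tensor)"
  by (rule nondegenerate_tensor[OF A.nondegenerate_algebra_axioms A.nondegenerate_algebra_axioms])

sublocale AAA: nondegenerate_algebra "TYPE(('a, ('a, 'a) tensor) tensor)"
  by (rule nondegenerate_tensor[OF A.nondegenerate_algebra_axioms AA.nondegenerate_algebra_axioms])

sublocale D: extendable_homomorphism \<Delta> E
  by (intro extendable_homomorphism.intro extendable_homomorphism_axioms.intro)
    (fact comult_linear comult_mult E_idempotent comult_E_left comult_E_right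
      A.nondegenerate_algebra_axioms AA.nondegenerate_algebra_axioms)+

sublocale M: extendable_homomorphism "to_multiplier :: 'a \<Rightarrow> _" 1
proof (intro extendable_homomorphism.intro extendable_homomorphism_axioms.intro)
  have "{c * b | b (c :: 'a). True} = {a * b | a b. True}" by blast
  then show "cvec.span {to_multiplier b \<rhd> c |b (c :: 'a). True} = range ((\<rhd>) 1)"
    "cvec.span {c \<lhd> to_multiplier b |b (c :: 'a). True} = range (\<lambda>c. c \<lhd> 1)"
    using idempotent_algebra by simp_all
qed (fact A.nondegenerate_algebra_axioms clinear_to_multiplier to_multiplier_mult multiplier_one)+

lemma E_comult_act [simp]: "E \<rhd> (\<Delta> x \<rhd> u) = \<Delta> x \<rhd> u" "u \<lhd> \<Delta> x \<lhd> E = u \<lhd> \<Delta> x"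
  by (simp_all add: D.e_mult D.mult_e flip: act_left_times act_right_times)

sublocale DM: extendable_homomorphism "mtensor_hom \<Delta> (to_multiplier :: 'a \<Rightarrow> _)" "E \<otimes>\<^sub>M 1"
  by (rule extendable_tensor[OF D.extendable_homomorphism_axioms M.extendable_homomorphism_axioms])

sublocale MD: extendable_homomorphism "mtensor_hom (to_multiplier :: 'a \<Rightarrow> _) \<Delta>" "1 \<otimes>\<^sub>M E"
  by (rule extendable_tensor[OF M.extendable_homomorphism_axioms D.extendable_homomorphism_axioms])

lemmas DM_tensor = mtensor_hom_tensor[OF comult_linear clinear_to_multiplier]
  and MD_tensor = mtensor_hom_tensor[OF clinear_to_multiplier comult_linear]

definition E12 :: "('a, ('a, 'a) tensor) tensor multiplier" where
  "E12 = multiplier_assoc (E \<otimes>\<^sub>M 1)"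

definition E23 :: "('a, ('a, 'a) tensor) tensor multiplier" where
  "E23 = 1 \<otimes>\<^sub>M E"

lemma E12_E23: "E12 * E23 = E23 * E12"
  and comult_id_E: "multiplier_assoc (comult_id \<Delta> E E) = E12 * E23"
  and id_comult_E: "id_comult \<Delta> E E = E12 * E23"
  using E_comult_id E_id_comult E_commute by (simp_all add: E12_def E23_def)

lemma comult_id_mult:
  "comult_id \<Delta> E m * mtensor_hom \<Delta> to_multiplier t = mtensor_hom \<Delta> to_multiplier (m \<rhd> t)"
  "mtensor_hom \<Delta> to_multiplier t * comult_id \<Delta> E m = mtensor_hom \<Delta> to_multiplier (t \<lhd> m)"
  using DM.multiplier_extension_mult unfolding comult_id_def mtensor_hom_def by blast+

lemma id_comult_mult:
  "id_comult \<Delta> E m * mtensor_hom to_multiplier \<Delta> t = mtensor_hom to_multiplier \<Delta> (m \<rhd> t)"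
  "mtensor_hom to_multiplier \<Delta> t * id_comult \<Delta> E m = mtensor_hom to_multiplier \<Delta> (t \<lhd> m)"
  using MD.multiplier_extension_mult unfolding id_comult_def mtensor_hom_def by blast+

text \<open>Since \<open>E \<Delta>(x) = \<Delta>(x)\<close>, one factor of \<open>(\<Delta> \<otimes> id)(E) = E\<^sub>2\<^sub>3 E\<^sub>1\<^sub>2\<close> is absorbed by \<open>\<Delta>(x) \<otimes> z\<close>, and so
  \<open>E\<^sub>2\<^sub>3 (\<Delta>(x) \<otimes> z) = (\<Delta> \<otimes> id)(E (x \<otimes> z))\<close>.  This identity, its mirror image and the two analogues for
  \<open>id \<otimes> \<Delta>\<close> are the form in which the comultiplication of \<open>E\<close> enters the proof.  They are evaluated on
  elements, because \<open>\<Delta>(x)\<close> is only a multiplier.\<close>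

lemma E23_comult_left:
  "E23 \<rhd> tensor_assoc ((\<Delta> x \<rhd> u) \<otimes> (z * c)) = tensor_assoc (mtensor_hom \<Delta> to_multiplier (E \<rhd> (x \<otimes> z)) \<rhd> (u \<otimes> c))"
proof -
  let ?h = "mtensor_hom \<Delta> to_multiplier"
  have "tensor_assoc (?h (E \<rhd> (x \<otimes> z)) \<rhd> (u \<otimes> c)) = tensor_assoc (comult_id \<Delta> E E \<rhd> ?h (x \<otimes> z) \<rhd> (u \<otimes> c))"
    by (simp flip: comult_id_mult act_left_times)
  also have "\<dots> = E23 \<rhd> E12 \<rhd> tensor_assoc (?h (x \<otimes> z) \<rhd> (u \<otimes> c))"
    by (simp add: comult_id_E E12_E23 flip: multiplier_assoc_act(1))
  also have "\<dots> = E23 \<rhd> tensor_assoc ((E \<otimes>\<^sub>M 1) \<rhd> ?h (x \<otimes> z) \<rhd> (u \<otimes> c))"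
    by (simp add: E12_def multiplier_assoc_act)
  also have "(E \<otimes>\<^sub>M 1) \<rhd> ?h (x \<otimes> z) \<rhd> (u \<otimes> c) = (\<Delta> x \<rhd> u) \<otimes> (z * c)"
    by (simp add: DM_tensor)
  finally show ?thesis by simp
qed

lemma E23_comult_right:
  "tensor_assoc ((u \<lhd> \<Delta> x) \<otimes> (c * z)) \<lhd> E23 = tensor_assoc ((u \<otimes> c) \<lhd> mtensor_hom \<Delta> to_multiplier ((x \<otimes> z) \<lhd> E))"
proof -
  let ?h = "mtensor_hom \<Delta> to_multiplier"
  have "tensor_assoc ((u \<otimes> c) \<lhd> ?h ((x \<otimes> z) \<lhd> E)) = tensor_assoc ((u \<otimes> c) \<lhd> ?h (x \<otimes> z) \<lhd> comult_id \<Delta> E E)"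
    by (simp flip: comult_id_mult act_right_times)
  also have "\<dots> = tensor_assoc ((u \<otimes> c) \<lhd> ?h (x \<otimes> z)) \<lhd> E12 \<lhd> E23"
    by (simp add: comult_id_E flip: multiplier_assoc_act(2))
  also have "\<dots> = tensor_assoc ((u \<otimes> c) \<lhd> ?h (x \<otimes> z) \<lhd> (E \<otimes>\<^sub>M 1)) \<lhd> E23"
    by (simp add: E12_def multiplier_assoc_act)
  also have "(u \<otimes> c) \<lhd> ?h (x \<otimes> z) \<lhd> (E \<otimes>\<^sub>M 1) = (u \<lhd> \<Delta> x) \<otimes> (c * z)"
    by (simp add: DM_tensor)
  finally show ?thesis by simp
qed

lemma E12_comult_left:
  "E12 \<rhd> ((x * y) \<otimes> (\<Delta> z \<rhd> u)) = mtensor_hom to_multiplier \<Delta> (E \<rhd> (x \<otimes> z)) \<rhd> (y \<otimes> u)"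
proof -
  let ?h = "mtensor_hom to_multiplier \<Delta>"
  have "?h (E \<rhd> (x \<otimes> z)) \<rhd> (y \<otimes> u) = id_comult \<Delta> E E \<rhd> ?h (x \<otimes> z) \<rhd> (y \<otimes> u)"
    by (simp flip: id_comult_mult act_left_times)
  also have "\<dots> = E12 \<rhd> E23 \<rhd> ?h (x \<otimes> z) \<rhd> (y \<otimes> u)"
    by (simp add: id_comult_E)
  also have "E23 \<rhd> ?h (x \<otimes> z) \<rhd> (y \<otimes> u) = (x * y) \<otimes> (\<Delta> z \<rhd> u)"
    by (simp add: MD_tensor E23_def)
  finally show ?thesis by simp
qed

lemma E12_comult_right:
  "((y * x) \<otimes> (u \<lhd> \<Delta> z)) \<lhd> E12 = (y \<otimes> u) \<lhd> mtensor_hom to_multiplier \<Delta> ((x \<otimes> z) \<lhd> E)"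
proof -
  let ?h = "mtensor_hom to_multiplier \<Delta>"
  have "(y \<otimes> u) \<lhd> ?h ((x \<otimes> z) \<lhd> E) = (y \<otimes> u) \<lhd> ?h (x \<otimes> z) \<lhd> id_comult \<Delta> E E"
    by (simp flip: id_comult_mult act_right_times)
  also have "\<dots> = (y \<otimes> u) \<lhd> ?h (x \<otimes> z) \<lhd> E23 \<lhd> E12"
    by (simp add: id_comult_E E12_E23)
  also have "(y \<otimes> u) \<lhd> ?h (x \<otimes> z) \<lhd> E23 = (y * x) \<otimes> (u \<lhd> \<Delta> z)"
    by (simp add: MD_tensor E23_def)
  finally show ?thesis by simp
qed

text \<open>The elements \<open>\<Delta>(a) (1 \<otimes> b)\<close> and \<open>(a \<otimes> 1) \<Delta>(b)\<close> of \<open>A \<otimes> A\<close>; below, \<open>D3\<close> and \<open>D4\<close> are the two further ones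
  that regularity provides.  Equations between them are checked in the multiplier algebra.\<close>

definition D1 :: "'a \<Rightarrow> 'a \<Rightarrow> ('a, 'a) tensor" where
  "D1 a b = from_multiplier (\<Delta> a * (1 \<otimes>\<^sub>M to_multiplier b))"

definition D2 :: "'a \<Rightarrow> 'a \<Rightarrow> ('a, 'a) tensor" where
  "D2 a b = from_multiplier ((to_multiplier a \<otimes>\<^sub>M 1) * \<Delta> b)"

lemma to_multiplier_D1: "to_multiplier (D1 a b) = \<Delta> a * (1 \<otimes>\<^sub>M to_multiplier b)"
  and to_multiplier_D2: "to_multiplier (D2 a b) = (to_multiplier a \<otimes>\<^sub>M 1) * \<Delta> b"
  unfolding D1_def D2_def using AA.to_from_multiplier[OF T1_range] AA.to_from_multiplier[OF T2_range] by blast+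

lemmas mtensor_linear_simps =
  clinear_add[OF clinear_to_multiplier] clinear_scale[OF clinear_to_multiplier]
  clinear_add[OF cbilinear_left[OF cbilinear_mtensor]] clinear_add[OF cbilinear_right[OF cbilinear_mtensor]]
  clinear_scale[OF cbilinear_left[OF cbilinear_mtensor]] clinear_scale[OF cbilinear_right[OF cbilinear_mtensor]]
  clinear_add[OF comult_linear] clinear_scale[OF comult_linear]
  distrib_left distrib_right mult_scaleC_left mult_scaleC_right

lemma cbilinear_D1: "cbilinear D1"
  and cbilinear_D2: "cbilinear D2"
  by (intro cbilinearI clinearI;
      simp add: mtensor_linear_simps to_multiplier_D1 to_multiplier_D2 flip: AA.to_multiplier_inject)+

lemma T1_tensor: "T1 \<Delta> (a \<otimes> b) = D1 a b"
  and T2_tensor: "T2 \<Delta> (a \<otimes> b) = D2 a b"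
  using tensor_lift_tensor[OF cbilinear_D1] tensor_lift_tensor[OF cbilinear_D2]
  unfolding T1_def T2_def D1_def D2_def by blast+

lemma counit_D1: "slice_fst \<epsilon> (D1 a b) = a * b"
  and counit_D2: "slice_snd \<epsilon> (D2 a b) = a * b"
  using counit_T1 counit_T2 by (simp_all add: T1_tensor T2_tensor)

lemma assoc_eq_leftI:
  assumes "\<And>u c. s * tensor_assoc (u \<otimes> c) = t * tensor_assoc (u \<otimes> c)"
  shows "s = (t :: ('a, ('a, 'a) tensor) tensor)"
proof (rule AAA.eq_leftI)
  have *: "s * tensor_assoc w = t * tensor_assoc w" for w
    by (induction w rule: tensor_induct) (simp_all add: assms tensor_assoc_add distrib_left)
  show "s * w = t * w" for w
    using *[of "tensor_assoc_inv w"] by (simp add: tensor_assoc_inverse)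
qed

lemma assoc_eq_rightI:
  assumes "\<And>u c. tensor_assoc (u \<otimes> c) * s = tensor_assoc (u \<otimes> c) * t"
  shows "s = (t :: ('a, ('a, 'a) tensor) tensor)"
proof (rule AAA.eq_rightI)
  have *: "tensor_assoc w * s = tensor_assoc w * t" for w
    by (induction w rule: tensor_induct) (simp_all add: assms tensor_assoc_add distrib_right)
  show "w * s = w * t" for w
    using *[of "tensor_assoc_inv w"] by (simp add: tensor_assoc_inverse)
qed

lemma assoc_mtensor_first:
  "tensor_assoc (((m \<otimes>\<^sub>M 1) \<rhd> t) \<otimes> c) = (m \<otimes>\<^sub>M 1) \<rhd> tensor_assoc (t \<otimes> c)"
  "tensor_assoc ((t \<lhd> (m \<otimes>\<^sub>M 1)) \<otimes> c) = tensor_assoc (t \<otimes> c) \<lhd> (m \<otimes>\<^sub>M 1)"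
  for t :: "('x::complex_algebra, 'y::complex_algebra) tensor" and c :: "'z::complex_algebra"
proof -
  have *: "(m \<otimes>\<^sub>M 1) \<rhd> (a \<otimes> (t :: ('y, 'z) tensor)) = (m \<rhd> a) \<otimes> t"
    "(a \<otimes> (t :: ('y, 'z) tensor)) \<lhd> (m \<otimes>\<^sub>M 1) = (a \<lhd> m) \<otimes> t" for a t
    by simp_all
  show "tensor_assoc (((m \<otimes>\<^sub>M 1) \<rhd> t) \<otimes> c) = (m \<otimes>\<^sub>M 1) \<rhd> tensor_assoc (t \<otimes> c)"
    "tensor_assoc ((t \<lhd> (m \<otimes>\<^sub>M 1)) \<otimes> c) = tensor_assoc (t \<otimes> c) \<lhd> (m \<otimes>\<^sub>M 1)"
    by (induction t rule: tensor_induct;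
        simp add: tensor_assoc_tensor act_left_add act_right_add tensor_add_left tensor_assoc_add)+
qed

lemma slice_middle:
  "tensor_map id (slice_fst \<epsilon>) (tensor_assoc (t \<otimes> c)) = slice_snd \<epsilon> t \<otimes> c"
proof (induction t rule: tensor_induct)
  case (pure a b)
  then show ?case
    by (simp add: tensor_assoc_tensor tensor_map_tensor clinear_ident clinear_id clinear_slice_fst slice_fst_tensor
        slice_snd_tensor counit_linear tensor_scale_left tensor_scale_right)
qed (simp add: tensor_add_left tensor_assoc_add tensor_map_add slice_snd_add)

lemma clinear_slice_E: "clinear (\<lambda>v. slice_fst \<epsilon> (E \<rhd> (v \<otimes> z)))" "clinear (\<lambda>v. slice_fst \<epsilon> (E \<rhd> (z \<otimes> v)))"
    "clinear (\<lambda>v. slice_fst \<epsilon> ((v \<otimes> z) \<lhd> E))" "clinear (\<lambda>v. slice_fst \<epsilon> ((z \<otimes> v) \<lhd> E))"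
  by (rule clinearI; simp add: tensor_add_left tensor_add_right tensor_scale_left tensor_scale_right
      act_left_add act_right_add act_left_scale act_right_scale slice_fst_add clinear_scale[OF clinear_slice_fst])+

text \<open>In Sweedler notation \<open>x\<^sub>1 \<otimes> \<Pi>\<^sup>L(x\<^sub>2) = E (x \<otimes> 1)\<close>: apply \<open>id \<otimes> \<epsilon> \<otimes> id\<close> to
  \<open>E\<^sub>2\<^sub>3 (\<Delta>(x) \<otimes> z) = (\<Delta> \<otimes> id)(E (x \<otimes> z))\<close>, where the counit undoes the comultiplication on the right.
  The factor \<open>y\<close> in the first leg makes every term an element of the algebraic tensor product.\<close>

lemma E_first_leg_left:
  "tensor_map id (\<lambda>v. slice_fst \<epsilon> (E \<rhd> (v \<otimes> z))) (D2 y x) = (to_multiplier y \<otimes>\<^sub>M 1) \<rhd> (E \<rhd> (x \<otimes> z))"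
proof -
  let ?h = "mtensor_hom \<Delta> to_multiplier"
  note lin = cbilinear_right[OF cbilinear_D2]
  have H: "tensor_map (D2 y) id r * (u \<otimes> c) = ((to_multiplier y \<otimes>\<^sub>M 1) \<otimes>\<^sub>M 1) \<rhd> (?h r \<rhd> (u \<otimes> c))" for r u c
  proof (induction r rule: tensor_induct)
    case (pure p q)
    have "D2 y p * u = (to_multiplier y \<otimes>\<^sub>M 1) \<rhd> (\<Delta> p \<rhd> u)"
      by (metis act_left_times act_left_to_multiplier to_multiplier_D2)
    then show ?case
      by (simp add: tensor_map_tensor lin clinear_ident clinear_id tensor_times_tensor DM_tensor)
  qed (simp add: tensor_map_add distrib_right mtensor_hom_add act_left_plus act_left_add)
  \<comment> \<open>The identity before slicing, tested against arbitrary elements to get rid of the multiplier \<open>\<Delta>(x)\<close>.\<close>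
  have *: "E23 \<rhd> tensor_assoc (D2 y x \<otimes> z) = tensor_assoc (tensor_map (D2 y) id (E \<rhd> (x \<otimes> z)))"
  proof (rule assoc_eq_leftI)
    fix u c
    have "(E23 \<rhd> tensor_assoc (D2 y x \<otimes> z)) * tensor_assoc (u \<otimes> c) = E23 \<rhd> tensor_assoc ((D2 y x * u) \<otimes> (z * c))"
      by (simp add: AAA.act_left_mult tensor_times_tensor flip: tensor_assoc_mult)
    also have "D2 y x * u = (to_multiplier y \<otimes>\<^sub>M 1) \<rhd> (\<Delta> x \<rhd> u)"
      by (metis act_left_times act_left_to_multiplier to_multiplier_D2)
    also have "E23 \<rhd> tensor_assoc (((to_multiplier y \<otimes>\<^sub>M 1) \<rhd> (\<Delta> x \<rhd> u)) \<otimes> (z * c))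
        = (to_multiplier y \<otimes>\<^sub>M 1) \<rhd> (E23 \<rhd> tensor_assoc ((\<Delta> x \<rhd> u) \<otimes> (z * c)))"
      unfolding assoc_mtensor_first E23_def by (simp add: mtensor_mult multiplier_one flip: act_left_times)
    also have "\<dots> = (to_multiplier y \<otimes>\<^sub>M 1) \<rhd> tensor_assoc (?h (E \<rhd> (x \<otimes> z)) \<rhd> (u \<otimes> c))"
      by (simp only: E23_comult_left)
    also have "\<dots> = tensor_assoc (((to_multiplier y \<otimes>\<^sub>M 1) \<otimes>\<^sub>M 1) \<rhd> (?h (E \<rhd> (x \<otimes> z)) \<rhd> (u \<otimes> c)))"
    proof -
      have "(to_multiplier y \<otimes>\<^sub>M 1) \<rhd> tensor_assoc w = tensor_assoc (((to_multiplier y \<otimes>\<^sub>M 1) \<otimes>\<^sub>M 1) \<rhd> w)"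
        for w :: "(('a, 'a) tensor, 'a) tensor"
        by (induction w rule: tensor_induct)
          (simp_all add: assoc_mtensor_first tensor_assoc_add act_left_add)
      then show ?thesis by simp
    qed
    also have "\<dots> = tensor_assoc (tensor_map (D2 y) id (E \<rhd> (x \<otimes> z))) * tensor_assoc (u \<otimes> c)"
      by (simp add: H flip: tensor_assoc_mult)
    finally show "(E23 \<rhd> tensor_assoc (D2 y x \<otimes> z)) * tensor_assoc (u \<otimes> c)
      = tensor_assoc (tensor_map (D2 y) id (E \<rhd> (x \<otimes> z))) * tensor_assoc (u \<otimes> c)" .
  qed
  have "tensor_map id (slice_fst \<epsilon>) (E23 \<rhd> tensor_assoc (t \<otimes> z))
      = tensor_map id (\<lambda>v. slice_fst \<epsilon> (E \<rhd> (v \<otimes> z))) t" for t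
    by (induction t rule: tensor_induct)
      (simp_all add: tensor_add_left tensor_assoc_add act_left_add tensor_map_add tensor_assoc_tensor E23_def
        tensor_map_tensor clinear_ident clinear_id clinear_slice_fst clinear_slice_E)
  moreover have "tensor_map id (slice_fst \<epsilon>) (tensor_assoc (tensor_map (D2 y) id t)) = (to_multiplier y \<otimes>\<^sub>M 1) \<rhd> t" for t
    by (induction t rule: tensor_induct)
      (simp_all add: tensor_map_tensor lin clinear_ident clinear_id slice_middle[unfolded id_def] counit_D2 tensor_assoc_add act_left_add tensor_map_add)
  ultimately show ?thesis using * by metis
qed

end

context regular_weak_multiplier_bialgebra
begin

definition D3 :: "'a \<Rightarrow> 'a \<Rightarrow> ('a, 'a) tensor" where
  "D3 a b = from_multiplier (\<Delta> a * (to_multiplier b \<otimes>\<^sub>M 1))"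

definition D4 :: "'a \<Rightarrow> 'a \<Rightarrow> ('a, 'a) tensor" where
  "D4 a b = from_multiplier ((1 \<otimes>\<^sub>M to_multiplier a) * \<Delta> b)"

lemma to_multiplier_D3: "to_multiplier (D3 a b) = \<Delta> a * (to_multiplier b \<otimes>\<^sub>M 1)"
  and to_multiplier_D4: "to_multiplier (D4 a b) = (1 \<otimes>\<^sub>M to_multiplier a) * \<Delta> b"
  unfolding D3_def D4_def using AA.to_from_multiplier[OF T3_range] AA.to_from_multiplier[OF T4_range] by blast+

lemma cbilinear_D3: "cbilinear D3"
  by (intro cbilinearI clinearI;
      simp add: mtensor_linear_simps to_multiplier_D3 flip: AA.to_multiplier_inject)

text \<open>The counit axioms concern \<open>D1\<close> and \<open>D2\<close> only; multiplication by \<open>y\<close> on the free side turns \<open>D3\<close>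
  into a multiple of \<open>D2\<close>.\<close>

lemma counit_D3: "slice_snd \<epsilon> (D3 a b) = a * b"
proof (rule A.eq_rightI)
  fix y
  have "(to_multiplier y \<otimes>\<^sub>M 1) \<rhd> D3 a b = D2 y a \<lhd> (to_multiplier b \<otimes>\<^sub>M 1)"
    by (simp add: to_multiplier_D3 to_multiplier_D2 mult.assoc
        flip: AA.to_multiplier_inject AA.mult_to_multiplier)
  from arg_cong[OF this, of "slice_snd \<epsilon>"] show "y * slice_snd \<epsilon> (D3 a b) = y * (a * b)"
    by (simp add: slice_snd_act counit_linear counit_D2 mult.assoc)
qed

lemma counit_D4: "slice_fst \<epsilon> (D4 a b) = a * b"
proof (rule A.eq_leftI)
  fix y
  have "D4 a b \<lhd> (1 \<otimes>\<^sub>M to_multiplier y) = (1 \<otimes>\<^sub>M to_multiplier a) \<rhd> D1 b y"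
    by (simp add: to_multiplier_D4 to_multiplier_D1 mult.assoc
        flip: AA.to_multiplier_inject AA.mult_to_multiplier)
  from arg_cong[OF this, of "slice_fst \<epsilon>"] show "slice_fst \<epsilon> (D4 a b) * y = a * b * y"
    by (simp add: slice_fst_act counit_linear counit_D1 mult.assoc)
qed

text \<open>The mirror image \<open>x\<^sub>1 \<otimes> \<epsilon>(x\<^sub>2 1\<^sub>1) 1\<^sub>2 = (x \<otimes> 1) E\<close>, with the barred variant of \<open>\<Pi>\<^sup>L\<close> in the second leg.\<close>

lemma E_first_leg_right:
  "tensor_map id (\<lambda>v. slice_fst \<epsilon> ((v \<otimes> z) \<lhd> E)) (D3 x y) = ((x \<otimes> z) \<lhd> E) \<lhd> (to_multiplier y \<otimes>\<^sub>M 1)"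
proof -
  let ?h = "mtensor_hom \<Delta> to_multiplier"
  note lin = cbilinear_left[OF cbilinear_D3]
  have D3: "u * D3 p y = u \<lhd> \<Delta> p \<lhd> (to_multiplier y \<otimes>\<^sub>M 1)" for u p
    by (metis act_right_times act_right_to_multiplier to_multiplier_D3)
  have H: "(u \<otimes> c) * tensor_map (\<lambda>p. D3 p y) id r = (u \<otimes> c) \<lhd> ?h r \<lhd> ((to_multiplier y \<otimes>\<^sub>M 1) \<otimes>\<^sub>M 1)" for r u c
  proof (induction r rule: tensor_induct)
    case (pure p q)
    show ?case
      by (simp add: tensor_map_tensor lin clinear_ident clinear_id tensor_times_tensor DM_tensor D3)
  qed (simp add: tensor_map_add distrib_left mtensor_hom_add act_right_plus act_right_add)
  have *: "tensor_assoc (D3 x y \<otimes> z) \<lhd> E23 = tensor_assoc (tensor_map (\<lambda>p. D3 p y) id ((x \<otimes> z) \<lhd> E))"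
  proof (rule assoc_eq_rightI)
    fix u c
    have "tensor_assoc (u \<otimes> c) * (tensor_assoc (D3 x y \<otimes> z) \<lhd> E23) = tensor_assoc ((u * D3 x y) \<otimes> (c * z)) \<lhd> E23"
      by (simp add: AAA.act_right_mult tensor_times_tensor flip: tensor_assoc_mult)
    also have "\<dots> = tensor_assoc ((u \<lhd> \<Delta> x) \<otimes> (c * z)) \<lhd> E23 \<lhd> (to_multiplier y \<otimes>\<^sub>M 1)"
      unfolding D3 assoc_mtensor_first E23_def by (simp add: mtensor_mult multiplier_one flip: act_right_times)
    also have "\<dots> = tensor_assoc ((u \<otimes> c) \<lhd> ?h ((x \<otimes> z) \<lhd> E)) \<lhd> (to_multiplier y \<otimes>\<^sub>M 1)"
      by (simp only: E23_comult_right)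
    also have "\<dots> = tensor_assoc ((u \<otimes> c) \<lhd> ?h ((x \<otimes> z) \<lhd> E) \<lhd> ((to_multiplier y \<otimes>\<^sub>M 1) \<otimes>\<^sub>M 1))"
    proof -
      have "tensor_assoc w \<lhd> (to_multiplier y \<otimes>\<^sub>M 1) = tensor_assoc (w \<lhd> ((to_multiplier y \<otimes>\<^sub>M 1) \<otimes>\<^sub>M 1))"
        for w :: "(('a, 'a) tensor, 'a) tensor"
        by (induction w rule: tensor_induct)
          (simp_all add: assoc_mtensor_first tensor_assoc_add act_right_add)
      then show ?thesis by simp
    qed
    also have "\<dots> = tensor_assoc (u \<otimes> c) * tensor_assoc (tensor_map (\<lambda>p. D3 p y) id ((x \<otimes> z) \<lhd> E))"
      by (simp add: H flip: tensor_assoc_mult)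
    finally show "tensor_assoc (u \<otimes> c) * (tensor_assoc (D3 x y \<otimes> z) \<lhd> E23)
      = tensor_assoc (u \<otimes> c) * tensor_assoc (tensor_map (\<lambda>p. D3 p y) id ((x \<otimes> z) \<lhd> E))" .
  qed
  have "tensor_map id (slice_fst \<epsilon>) (tensor_assoc (t \<otimes> z) \<lhd> E23)
      = tensor_map id (\<lambda>v. slice_fst \<epsilon> ((v \<otimes> z) \<lhd> E)) t" for t
    by (induction t rule: tensor_induct)
      (simp_all add: tensor_add_left tensor_assoc_add act_right_add tensor_map_add tensor_assoc_tensor E23_def
        tensor_map_tensor clinear_ident clinear_id clinear_slice_fst clinear_slice_E)
  moreover have "tensor_map id (slice_fst \<epsilon>) (tensor_assoc (tensor_map (\<lambda>p. D3 p y) id t)) = t \<lhd> (to_multiplier y \<otimes>\<^sub>M 1)" for t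
    by (induction t rule: tensor_induct)
      (simp_all add: tensor_map_tensor lin clinear_ident clinear_id slice_middle[unfolded id_def] counit_D3 tensor_assoc_add act_right_add tensor_map_add)
  ultimately show ?thesis using * by metis
qed

text \<open>The first weak multiplicativity axiom for the counit, in the form that makes
  \<open>b \<mapsto> (\<epsilon> \<otimes> id)(\<Delta>(b) (a \<otimes> 1))\<close> the right action of \<open>\<Pi>\<^sup>L(a)\<close>.\<close>

lemma comult_E_left_act: "slice_fst \<epsilon> (D3 a b) * c = a * slice_fst \<epsilon> (E \<rhd> (b \<otimes> c))"
proof -
  have "\<Delta> a \<rhd> (b \<otimes> c) = D3 a b \<lhd> (1 \<otimes>\<^sub>M to_multiplier c)"
  proof (rule AA.eq_rightI)
    fix t
    have "t \<lhd> to_multiplier (D3 a b) = t \<lhd> (\<Delta> a * (to_multiplier b \<otimes>\<^sub>M 1))"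
      by (simp only: to_multiplier_D3)
    then show "t * (\<Delta> a \<rhd> (b \<otimes> c)) = t * (D3 a b \<lhd> (1 \<otimes>\<^sub>M to_multiplier c))"
      by (simp add: AA.act_right_mult act_elementary_tensor act_middle)
  qed
  with counit_left[of a b c] show ?thesis
    by (simp add: slice_fst_act counit_linear)
qed

lemma PiL_exists: "\<exists>m. \<forall>c. m \<rhd> c = slice_fst \<epsilon> (E \<rhd> (a \<otimes> c)) \<and> c \<lhd> m = slice_fst \<epsilon> (D3 c a)"
proof -
  let ?L = "\<lambda>c. slice_fst \<epsilon> (E \<rhd> (a \<otimes> c))" and ?R = "\<lambda>c. slice_fst \<epsilon> (D3 c a)"
  have "clinear ?R"
    by (rule clinear_compose[OF clinear_slice_fst cbilinear_left[OF cbilinear_D3]])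
  then have "Abs_multiplier (?L, ?R) \<rhd> c = ?L c" "c \<lhd> Abs_multiplier (?L, ?R) = ?R c" for c
    using clinear_slice_E(2)[of a] comult_E_left_act
    by (simp_all add: act_left_def act_right_def Abs_multiplier_inverse)
  then show ?thesis by blast
qed

text \<open>The definite description in \<open>PiL\<close> is resolved by the multiplier that has these two actions.\<close>

lemma PiL_act: "PiL E \<epsilon> a \<rhd> c = slice_fst \<epsilon> (E \<rhd> (a \<otimes> c))" "c \<lhd> PiL E \<epsilon> a = slice_fst \<epsilon> (D3 c a)"
proof -
  obtain m where m: "m \<rhd> c = slice_fst \<epsilon> (E \<rhd> (a \<otimes> c))" "c \<lhd> m = slice_fst \<epsilon> (D3 c a)" for c
    using PiL_exists by metis
  have eq: "slice_fst \<epsilon> (from_multiplier ((1 \<otimes>\<^sub>M to_multiplier b) * (E * (to_multiplier a \<otimes>\<^sub>M 1)) * (1 \<otimes>\<^sub>M to_multiplier c)))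
      = b * (m \<rhd> c)" for b c
  proof -
    have "(1 \<otimes>\<^sub>M to_multiplier b) * (E * (to_multiplier a \<otimes>\<^sub>M 1)) * (1 \<otimes>\<^sub>M to_multiplier c)
        = to_multiplier ((1 \<otimes>\<^sub>M to_multiplier b) \<rhd> (E \<rhd> (a \<otimes> c)))"
      by (simp add: to_multiplier_tensor mult.assoc mtensor_mult multiplier_one flip: AA.mult_to_multiplier)
    then show ?thesis by (simp add: slice_fst_act counit_linear m)
  qed
  have "PiL E \<epsilon> a = m"
    unfolding PiL_def mslice_fst_def eq
  proof (rule the_equality)
    fix n assume "\<forall>b c. b * (n \<rhd> c) = b * (m \<rhd> c)"
    then have "n \<rhd> c = m \<rhd> c" for c by (intro A.eq_rightI[of "n \<rhd> c" "m \<rhd> c"]) blast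
    then show "n = m" by (rule A.multiplier_eq_leftI)
  qed simp
  then show "PiL E \<epsilon> a \<rhd> c = slice_fst \<epsilon> (E \<rhd> (a \<otimes> c))" "c \<lhd> PiL E \<epsilon> a = slice_fst \<epsilon> (D3 c a)"
    using m by simp_all
qed

lemma clinear_PiL: "clinear (PiL E \<epsilon>)"
  by (rule clinearI; rule A.multiplier_eq_leftI)
    (simp_all add: PiL_act act_left_plus act_left_scaleC clinear_add[OF clinear_slice_E(1)]
      clinear_scale[OF clinear_slice_E(1)])

text \<open>\<open>a b = (\<epsilon> \<otimes> id)(\<Delta>(a) (1 \<otimes> b))\<close>, and \<open>E\<close> can be inserted in front of \<open>\<Delta>(a)\<close>.\<close>

lemma span_PiL_left: "UNIV \<subseteq> cvec.span {PiL E \<epsilon> a \<rhd> c | a c. True}"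
proof -
  have *: "slice_fst \<epsilon> (E \<rhd> t) \<in> cvec.span {PiL E \<epsilon> a \<rhd> c | a c. True}" for t
  proof (induction t rule: tensor_induct)
    case (pure a c)
    then show ?case by (intro cvec.span_base) (auto simp: PiL_act)
  qed (simp add: act_left_add slice_fst_add cvec.span_add)
  have "a * b \<in> cvec.span {PiL E \<epsilon> a \<rhd> c | a c. True}" for a b
  proof -
    have "E \<rhd> D1 a b = D1 a b"
      by (simp add: to_multiplier_D1 D.e_mult
          flip: AA.to_multiplier_inject AA.mult_to_multiplier mult.assoc)
    then show ?thesis using *[of "D1 a b"] by (simp add: counit_D1)
  qed
  then show ?thesis
    unfolding idempotent_algebra[symmetric]
    by (intro cvec.span_minimal cvec.subspace_span) blast
qed

lemma slice_fst_tensor_map: "clinear h \<Longrightarrow> clinear g \<Longrightarrow> slice_fst h (tensor_map id g t) = g (slice_fst h t)"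
  by (induction t rule: tensor_induct)
    (simp_all add: tensor_map_tensor clinear_ident clinear_id slice_fst_tensor clinear_scale tensor_map_add
      slice_fst_add clinear_add)

text \<open>Both \<open>E_first_leg_left\<close> and \<open>E_first_leg_right\<close> compute \<open>(x \<otimes> 1) E (y \<otimes> 1)\<close>, with second legs in
  the image of \<open>\<Pi>\<^sup>L\<close> and in that of its barred variant, respectively.  So the barred variant maps the
  second legs of \<open>\<Delta>(x) (y \<otimes> 1)\<close> into the image of \<open>\<Pi>\<^sup>L\<close>, and by fullness these legs exhaust \<open>A\<close>.\<close>

lemma barPiL_in_PiL:
  assumes "right_full \<Delta>"
  shows "\<exists>v. \<forall>z. slice_fst \<epsilon> ((w \<otimes> z) \<lhd> E) = z \<lhd> PiL E \<epsilon> v"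
proof -
  define W where "W = {w. \<exists>v. \<forall>z. slice_fst \<epsilon> ((w \<otimes> z) \<lhd> E) = z \<lhd> PiL E \<epsilon> v}"
  note add = clinear_add[OF clinear_slice_E(3)] clinear_add[OF clinear_PiL] act_right_plus
  note scale = clinear_scale[OF clinear_slice_E(3)] clinear_scale[OF clinear_PiL] act_right_scaleC
  have W: "cvec.subspace W"
    unfolding cvec.subspace_def W_def
  proof (intro conjI allI ballI)
    show "0 \<in> {w. \<exists>v. \<forall>z. slice_fst \<epsilon> ((w \<otimes> z) \<lhd> E) = z \<lhd> PiL E \<epsilon> v}"
      by (simp, intro exI[of _ 0]) (simp add: clinear_zero[OF clinear_PiL])
  next
    fix x y c
    assume "x \<in> {w. \<exists>v. \<forall>z. slice_fst \<epsilon> ((w \<otimes> z) \<lhd> E) = z \<lhd> PiL E \<epsilon> v}"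
      "y \<in> {w. \<exists>v. \<forall>z. slice_fst \<epsilon> ((w \<otimes> z) \<lhd> E) = z \<lhd> PiL E \<epsilon> v}"
    then obtain v v' where "\<forall>z. slice_fst \<epsilon> ((x \<otimes> z) \<lhd> E) = z \<lhd> PiL E \<epsilon> v"
      "\<forall>z. slice_fst \<epsilon> ((y \<otimes> z) \<lhd> E) = z \<lhd> PiL E \<epsilon> v'" by blast
    then show "x + y \<in> {w. \<exists>v. \<forall>z. slice_fst \<epsilon> ((w \<otimes> z) \<lhd> E) = z \<lhd> PiL E \<epsilon> v}"
      by (simp, intro exI[of _ "v + v'"]) (simp add: add)
  next
    fix c x
    assume "x \<in> {w. \<exists>v. \<forall>z. slice_fst \<epsilon> ((w \<otimes> z) \<lhd> E) = z \<lhd> PiL E \<epsilon> v}"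
    then obtain v where "\<forall>z. slice_fst \<epsilon> ((x \<otimes> z) \<lhd> E) = z \<lhd> PiL E \<epsilon> v" by blast
    then show "c *\<^sub>C x \<in> {w. \<exists>v. \<forall>z. slice_fst \<epsilon> ((w \<otimes> z) \<lhd> E) = z \<lhd> PiL E \<epsilon> v}"
      by (simp, intro exI[of _ "c *\<^sub>C v"]) (simp add: scale)
  qed
  \<comment> \<open>The two computations of \<open>(x \<otimes> 1) E (y \<otimes> 1)\<close> are compared in the first leg by a functional \<open>h\<close>.\<close>
  have D3_W: "slice_fst h (D3 x y) \<in> W" if h: "clinear h" for h x y
  proof -
    have "slice_fst \<epsilon> ((slice_fst h (D3 x y) \<otimes> z) \<lhd> E) = z \<lhd> PiL E \<epsilon> (slice_fst h (D2 x y))" for z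
    proof (rule A.eq_leftI)
      fix c
      have "slice_fst \<epsilon> ((slice_fst h (D3 x y) \<otimes> z) \<lhd> E) * c
          = slice_fst h (((x \<otimes> z) \<lhd> E) \<lhd> (to_multiplier y \<otimes>\<^sub>M 1)) * c"
        unfolding E_first_leg_right[symmetric] by (simp add: slice_fst_tensor_map h clinear_slice_E)
      also have "\<dots> = slice_fst h (((x \<otimes> z) \<lhd> E) \<lhd> (to_multiplier y \<otimes>\<^sub>M 1) \<lhd> (1 \<otimes>\<^sub>M to_multiplier c))"
        by (simp add: slice_fst_act h)
      also have "\<dots> = slice_fst h (((x \<otimes> z) \<lhd> E) * (y \<otimes> c))"
        by (simp only: act_elementary_tensor)
      also have "\<dots> = slice_fst h ((1 \<otimes>\<^sub>M to_multiplier z) \<rhd> (to_multiplier x \<otimes>\<^sub>M 1) \<rhd> E \<rhd> (y \<otimes> c))"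
        by (simp only: act_elementary_tensor act_middle)
      also have "\<dots> = z * slice_fst \<epsilon> (E \<rhd> (slice_fst h (D2 x y) \<otimes> c))"
        by (simp add: slice_fst_act h slice_fst_tensor_map clinear_slice_E flip: E_first_leg_left)
      also have "\<dots> = (z \<lhd> PiL E \<epsilon> (slice_fst h (D2 x y))) * c"
        by (simp add: PiL_act(1) flip: act_middle)
      finally show "slice_fst \<epsilon> ((slice_fst h (D3 x y) \<otimes> z) \<lhd> E) * c
        = (z \<lhd> PiL E \<epsilon> (slice_fst h (D2 x y))) * c" .
    qed
    then show ?thesis unfolding W_def by blast
  qed
  \<comment> \<open>Fullness is stated for \<open>(a \<otimes> 1) \<Delta>(b)\<close>; a functional vanishing on \<open>W\<close> carries the conclusion over.\<close>
  have D2_W: "slice_fst h (D2 a b) \<in> W" if h: "clinear h" for h a b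
  proof (rule ccontr)
    assume "slice_fst h (D2 a b) \<notin> W"
    then obtain g :: "'a \<Rightarrow> complex" where g: "clinear g" "\<And>w. w \<in> W \<Longrightarrow> g w = 0" "g (slice_fst h (D2 a b)) = 1"
      using functional_separates_subspace[OF W] by blast
    have "slice_snd g (D2 a b) = 0"
    proof (rule A.nondeg_left, rule functionals_eqI)
      fix y and f :: "'a \<Rightarrow> complex" assume f: "clinear f"
      have "D2 a b \<lhd> (to_multiplier y \<otimes>\<^sub>M 1) = (to_multiplier a \<otimes>\<^sub>M 1) \<rhd> D3 b y"
        by (simp add: to_multiplier_D3 to_multiplier_D2 mult.assoc
            flip: AA.to_multiplier_inject AA.mult_to_multiplier)
      from arg_cong[OF this, of "slice_snd g"]
      have "f (slice_snd g (D2 a b) * y) = f (slice_snd g ((to_multiplier a \<otimes>\<^sub>M 1) \<rhd> D3 b y))"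
        by (simp add: slice_snd_act g)
      also have "\<dots> = g (slice_fst (\<lambda>x. f (a * x)) (D3 b y))"
        using slice_exchange[OF g(1) f] by (simp add: slice_fst_act f flip: slice_exchange[OF g(1) f])
      also have "\<dots> = 0"
        by (intro g(2) D3_W clinear_compose[OF f clinear_mult_left[OF clinear_id]])
      finally show "f (slice_snd g (D2 a b) * y) = f 0" by (simp add: clinear_zero[OF f])
    qed
    then show False using g slice_exchange[OF g(1) h, of "D2 a b"] by (simp add: clinear_zero[OF h])
  qed
  have "D2 a b \<in> tensor_subspace UNIV W" for a b
    by (rule tensor_subspace_UNIV_leftI) (rule D2_W)
  then have "(to_multiplier a \<otimes>\<^sub>M 1) * \<Delta> b \<in> to_multiplier ` tensor_subspace UNIV W" for a b
    using to_multiplier_D2 by (metis imageI)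
  then have "W = UNIV" using assms W unfolding right_full_def by blast
  then show ?thesis unfolding W_def by blast
qed

lemma span_PiL_right:
  assumes "right_full \<Delta>"
  shows "UNIV \<subseteq> cvec.span {c \<lhd> PiL E \<epsilon> a | a c. True}"
proof -
  have *: "slice_fst \<epsilon> (t \<lhd> E) \<in> cvec.span {c \<lhd> PiL E \<epsilon> a | a c. True}" for t
  proof (induction t rule: tensor_induct)
    case (pure a c)
    then show ?case using barPiL_in_PiL[OF assms, of a] by (intro cvec.span_base) blast
  qed (simp add: act_right_add slice_fst_add cvec.span_add)
  have "a * b \<in> cvec.span {c \<lhd> PiL E \<epsilon> a | a c. True}" for a b
  proof -
    have "D4 a b \<lhd> E = D4 a b"
      by (simp add: to_multiplier_D4 D.mult_e mult.assoc
          flip: AA.to_multiplier_inject AA.mult_to_multiplier)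
    then show ?thesis using *[of "D4 a b"] by (simp add: counit_D4)
  qed
  then show ?thesis
    unfolding idempotent_algebra[symmetric]
    by (intro cvec.span_minimal cvec.subspace_span) blast
qed

end

section \<open>Base algebras of finitely supported functions\<close>

lemma mtensor_cancel_right:
  fixes m m' :: "'a::complex_algebra multiplier" and n :: "'b::complex_algebra multiplier"
  assumes "m \<otimes>\<^sub>M n = m' \<otimes>\<^sub>M n" "n \<noteq> 0" "nondegenerate_algebra TYPE('a)" "nondegenerate_algebra TYPE('b)"
  shows "m = m'"
proof -
  interpret A: nondegenerate_algebra "TYPE('a)" by fact
  interpret B: nondegenerate_algebra "TYPE('b)" by fact
  obtain c where c: "n \<rhd> c \<noteq> 0"
    using assms(2) B.multiplier_eq_leftI[of n 0] by auto
  have "(m \<rhd> x) \<otimes> (n \<rhd> c) = (m' \<rhd> x) \<otimes> (n \<rhd> c)" for x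
    using arg_cong[OF assms(1), of "\<lambda>M. M \<rhd> (x \<otimes> c)"] by simp
  then show ?thesis
    using c by (intro A.multiplier_eq_leftI) (rule tensor_cancel_right)
qed

lemma linear_eq_on_span:
  assumes "clinear f" "clinear g" "\<And>x. x \<in> S \<Longrightarrow> f x = g x" "UNIV \<subseteq> cvec.span S"
  shows "f x = g x"
proof -
  have "x \<in> cvec.span S" using assms(4) by blast
  then show ?thesis
  proof (induction rule: cvec.span_induct_alt)
    case base
    then show ?case by (simp add: clinear_zero assms(1,2))
  next
    case (step c x y)
    then show ?case by (simp add: clinear_add clinear_scale assms(1-3))
  qed
qed

lemma slice_snd_scaled: "clinear f \<Longrightarrow> slice_snd (\<lambda>v. s * f v) t = s *\<^sub>C slice_snd f t"
proof (induction t rule: tensor_induct)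
  case (pure a b)
  have "clinear (\<lambda>v. s * f v)"
    using clinear_scaleC[OF pure, of s] by (simp add: scaleC_complex_def)
  then show ?case using pure by (simp add: slice_snd_tensor scaleC_scaleC)
qed (simp add: slice_snd_add scaleC_add_right)

lemma act_both_legs:
  "(1 \<otimes>\<^sub>M n) \<rhd> (m \<otimes>\<^sub>M 1) \<rhd> t = (m \<otimes>\<^sub>M n) \<rhd> t"
  "(m \<otimes>\<^sub>M 1) \<rhd> (1 \<otimes>\<^sub>M n) \<rhd> t = (m \<otimes>\<^sub>M n) \<rhd> t"
  by (simp_all add: mtensor_mult multiplier_one flip: act_left_times)

context weak_multiplier_bialgebra
begin

lemma cancel_first_left:
  assumes "\<And>y. (to_multiplier y \<otimes>\<^sub>M 1) \<rhd> s = (to_multiplier y \<otimes>\<^sub>M 1) \<rhd> t"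
  shows "s = (t :: ('a, 'a) tensor)"
proof (rule AA.eq_rightI)
  fix u show "u * s = u * t"
  proof (induction u rule: tensor_induct)
    case (pure a b)
    show ?case using arg_cong[OF assms[of a], of "\<lambda>t. (1 \<otimes>\<^sub>M to_multiplier b) \<rhd> t"]
      by (simp only: act_elementary_tensor)
  qed (simp add: distrib_right)
qed

lemma cancel_second_right:
  assumes "\<And>y. s \<lhd> (1 \<otimes>\<^sub>M to_multiplier y) = t \<lhd> (1 \<otimes>\<^sub>M to_multiplier y)"
  shows "s = (t :: ('a, 'a) tensor)"
proof (rule AA.eq_leftI)
  have swap: "r \<lhd> (1 \<otimes>\<^sub>M to_multiplier b) \<lhd> (to_multiplier a \<otimes>\<^sub>M 1) = r * (a \<otimes> b)" for r :: "('a, 'a) tensor" and a b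
    by (subst act_elementary_tensor[symmetric]) (simp add: mtensor_mult multiplier_one flip: act_right_times)
  fix u show "s * u = t * u"
  proof (induction u rule: tensor_induct)
    case (pure a b)
    show ?case using arg_cong[OF assms[of b], of "\<lambda>t. t \<lhd> (to_multiplier a \<otimes>\<^sub>M 1)"]
      by (simp only: swap)
  qed (simp add: distrib_left)
qed

lemma slice_fst_assoc: "slice_fst \<epsilon> (tensor_assoc (t \<otimes> q)) = slice_fst \<epsilon> t \<otimes> q"
  by (induction t rule: tensor_induct)
    (simp_all add: tensor_assoc_tensor slice_fst_tensor counit_linear tensor_scale_left tensor_add_left
      tensor_assoc_add slice_fst_add)

lemma E12_act:
  "E12 \<rhd> (a \<otimes> (p \<otimes> q)) = tensor_assoc ((E \<rhd> (a \<otimes> p)) \<otimes> q)"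
  "(a \<otimes> (p \<otimes> q)) \<lhd> E12 = tensor_assoc (((a \<otimes> p) \<lhd> E) \<otimes> q)"
  by (simp_all add: E12_def multiplier_assoc_act flip: tensor_assoc_tensor)

lemma slice_fst_E12:
  "(\<And>p. slice_fst \<epsilon> (E \<rhd> (a \<otimes> p)) = m \<rhd> p) \<Longrightarrow> slice_fst \<epsilon> (E12 \<rhd> (a \<otimes> w)) = (m \<otimes>\<^sub>M 1) \<rhd> w"
  "(\<And>p. slice_fst \<epsilon> ((a \<otimes> p) \<lhd> E) = p \<lhd> m) \<Longrightarrow> slice_fst \<epsilon> ((a \<otimes> w) \<lhd> E12) = w \<lhd> (m \<otimes>\<^sub>M 1)"
  by (induction w rule: tensor_induct;
      simp add: E12_act slice_fst_assoc tensor_add_right act_left_add act_right_add slice_fst_add)+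

end

locale function_base = regular_weak_multiplier_bialgebra \<Delta> E \<epsilon>
  for \<Delta> :: "'a::complex_algebra \<Rightarrow> ('a, 'a) tensor multiplier"
    and E :: "('a, 'a) tensor multiplier"
    and \<epsilon> :: "'a \<Rightarrow> complex" +
  fixes I :: "'i set" and \<phi> :: "('i \<Rightarrow> complex) \<Rightarrow> 'a multiplier"
  assumes full: "right_full \<Delta>"
    and iso: "fun_fin_iso I (baseL E \<epsilon>) \<phi>"
begin

definition lam :: "'i \<Rightarrow> 'a multiplier" where
  "lam k = \<phi> (dirac k)"

lemma \<phi>_bij: "bij_betw \<phi> (fun_fin I) (baseL E \<epsilon>)"
  and \<phi>_add: "f \<in> fun_fin I \<Longrightarrow> g \<in> fun_fin I \<Longrightarrow> \<phi> (\<lambda>i. f i + g i) = \<phi> f + \<phi> g"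
  and \<phi>_scale: "f \<in> fun_fin I \<Longrightarrow> \<phi> (\<lambda>i. c * f i) = c *\<^sub>C \<phi> f"
  and \<phi>_mult: "f \<in> fun_fin I \<Longrightarrow> g \<in> fun_fin I \<Longrightarrow> \<phi> (\<lambda>i. f i * g i) = \<phi> f * \<phi> g"
  using iso unfolding fun_fin_iso_def by blast+

lemma zero_fun_fin: "(\<lambda>i. 0) \<in> fun_fin I"
  by (simp add: fun_fin_def)

lemma \<phi>_zero: "\<phi> (\<lambda>i. 0) = 0"
  using \<phi>_scale[OF zero_fun_fin, of 0] by simp

lemma dirac_fun_fin: "k \<in> I \<Longrightarrow> dirac k \<in> fun_fin I"
  by (simp add: fun_fin_def dirac_def)

text \<open>Minimality of the idempotent \<open>\<lambda>\<^sub>k\<close>: multiplication evaluates functions at \<open>k\<close>.\<close>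

lemma lam_mult_\<phi>:
  assumes "k \<in> I" "f \<in> fun_fin I"
  shows "lam k * \<phi> f = f k *\<^sub>C lam k" "\<phi> f * lam k = f k *\<^sub>C lam k"
proof -
  have eq: "(\<lambda>i. dirac k i * f i) = (\<lambda>i. f k * dirac k i)" "(\<lambda>i. f i * dirac k i) = (\<lambda>i. f k * dirac k i)"
    by (auto simp: dirac_def)
  show "lam k * \<phi> f = f k *\<^sub>C lam k" "\<phi> f * lam k = f k *\<^sub>C lam k"
    using \<phi>_mult[OF dirac_fun_fin[OF assms(1)] assms(2)] \<phi>_mult[OF assms(2) dirac_fun_fin[OF assms(1)]]
      \<phi>_scale[OF dirac_fun_fin[OF assms(1)], of "f k"]
    unfolding eq lam_def by simp_all
qed

lemma lam_orth: "k \<in> I \<Longrightarrow> l \<in> I \<Longrightarrow> lam k * lam l = (if k = l then lam k else 0)"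
  using lam_mult_\<phi>(1)[OF _ dirac_fun_fin, of k l] by (simp add: lam_def dirac_def scaleC_one)

lemma lam_nonzero: "k \<in> I \<Longrightarrow> lam k \<noteq> 0"
proof
  assume k: "k \<in> I" and "lam k = 0"
  then have "\<phi> (dirac k) = \<phi> (\<lambda>i. 0)" by (simp add: lam_def \<phi>_zero)
  then have "dirac k = (\<lambda>i. 0)"
    by (rule bij_betw_imp_inj_on[OF \<phi>_bij, THEN inj_onD, OF _ dirac_fun_fin[OF k] zero_fun_fin])
  from fun_cong[OF this, of k] show False by (simp add: dirac_def)
qed

lemma \<phi>_sum:
  assumes "finite F" "F \<subseteq> I" "\<And>i. i \<notin> F \<Longrightarrow> f i = 0"
  shows "\<phi> f = (\<Sum>i\<in>F. f i *\<^sub>C lam i)"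
  using assms
proof (induction F arbitrary: f rule: finite_induct)
  case empty
  then have "f = (\<lambda>i. 0)" by auto
  then show ?case by (simp add: \<phi>_zero)
next
  case (insert k F)
  have k: "k \<in> I" using insert by simp
  let ?g = "\<lambda>i. if i \<in> F then f i else 0"
  have g: "?g \<in> fun_fin I"
    unfolding fun_fin_def using insert(1,4) by (auto intro: finite_subset[OF _ insert(1)])
  have d: "(\<lambda>i. f k * dirac k i) \<in> fun_fin I"
    using k by (auto simp: fun_fin_def dirac_def)
  have "f = (\<lambda>i. f k * dirac k i + ?g i)"
    using insert by (auto simp: dirac_def)
  then have "\<phi> f = \<phi> (\<lambda>i. f k * dirac k i + ?g i)" by simp
  also have "\<dots> = f k *\<^sub>C lam k + \<phi> ?g"
    by (simp only: \<phi>_add[OF d g] \<phi>_scale[OF dirac_fun_fin[OF k]] lam_def)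
  also have "\<phi> ?g = (\<Sum>i\<in>F. ?g i *\<^sub>C lam i)"
    using insert by (intro insert.IH) auto
  finally show ?case using insert by simp
qed

lemma lam_baseL: "k \<in> I \<Longrightarrow> \<exists>a. PiL E \<epsilon> a = lam k"
  using bij_betwE[OF \<phi>_bij] dirac_fun_fin[of k] unfolding lam_def baseL_def by fastforce

lemma PiL_\<phi>: "\<exists>f\<in>fun_fin I. PiL E \<epsilon> a = \<phi> f"
  using \<phi>_bij unfolding baseL_def bij_betw_def by blast

text \<open>The \<open>k\<close>-th coordinate of \<open>\<Pi>\<^sup>L(a)\<close>; once \<open>\<rho>\<^sub>k\<close> is available it turns out to be \<open>\<epsilon>(\<rho>\<^sub>k a)\<close>.\<close>

definition coeff :: "'i \<Rightarrow> 'a \<Rightarrow> complex" where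
  "coeff k a = (SOME c. lam k * PiL E \<epsilon> a = c *\<^sub>C lam k \<and> PiL E \<epsilon> a * lam k = c *\<^sub>C lam k)"

lemma lam_PiL:
  assumes "k \<in> I"
  shows "lam k * PiL E \<epsilon> a = coeff k a *\<^sub>C lam k" "PiL E \<epsilon> a * lam k = coeff k a *\<^sub>C lam k"
proof -
  have "\<exists>c. lam k * PiL E \<epsilon> a = c *\<^sub>C lam k \<and> PiL E \<epsilon> a * lam k = c *\<^sub>C lam k"
    using PiL_\<phi>[of a] lam_mult_\<phi>[OF assms] by auto
  from someI_ex[OF this] show "lam k * PiL E \<epsilon> a = coeff k a *\<^sub>C lam k"
    "PiL E \<epsilon> a * lam k = coeff k a *\<^sub>C lam k"
    unfolding coeff_def by blast+
qed

lemma clinear_coeff: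
  assumes "k \<in> I"
  shows "clinear (coeff k)"
proof (rule clinearI)
  fix x y c
  have "coeff k (x + y) *\<^sub>C lam k = (coeff k x + coeff k y) *\<^sub>C lam k"
    by (simp add: lam_PiL[OF assms, symmetric] clinear_add[OF clinear_PiL] distrib_left scaleC_add_left)
  then show "coeff k (x + y) = coeff k x + coeff k y"
    using lam_nonzero[OF assms] by (simp only: cvec.scale_cancel_right) simp
  have "coeff k (c *\<^sub>C x) *\<^sub>C lam k = (c * coeff k x) *\<^sub>C lam k"
    by (simp add: lam_PiL[OF assms, symmetric] clinear_scale[OF clinear_PiL] mult_scaleC_right
        flip: scaleC_scaleC)
  then show "coeff k (c *\<^sub>C x) = c *\<^sub>C coeff k x"
    using lam_nonzero[OF assms] by (simp only: cvec.scale_cancel_right) (simp add: scaleC_complex_def)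
qed

lemma span_lam_left: "UNIV \<subseteq> cvec.span {lam k \<rhd> b | k b. k \<in> I}"
proof -
  have "PiL E \<epsilon> a \<rhd> c \<in> cvec.span {lam k \<rhd> b | k b. k \<in> I}" for a c
  proof -
    obtain f where f: "f \<in> fun_fin I" "PiL E \<epsilon> a = \<phi> f" using PiL_\<phi> by blast
    have "\<phi> f = (\<Sum>i\<in>{i. f i \<noteq> 0}. f i *\<^sub>C lam i)"
      using f(1) by (intro \<phi>_sum) (auto simp: fun_fin_def)
    then have "PiL E \<epsilon> a \<rhd> c = (\<Sum>i\<in>{i. f i \<noteq> 0}. f i *\<^sub>C (lam i \<rhd> c))"
      unfolding f(2) by (simp add: clinear_sum[OF clinear_eval_left[OF clinear_id]] act_left_scaleC)
    also have "\<dots> \<in> cvec.span {lam k \<rhd> b | k b. k \<in> I}"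
      using f(1) by (intro cvec.span_sum cvec.span_scale cvec.span_base) (auto simp: fun_fin_def)
    finally show ?thesis .
  qed
  then have "cvec.span {PiL E \<epsilon> a \<rhd> c | a c. True} \<subseteq> cvec.span {lam k \<rhd> b | k b. k \<in> I}"
    by (intro cvec.span_minimal cvec.subspace_span) blast
  then show ?thesis using span_PiL_left by blast
qed

lemma span_lam_right: "UNIV \<subseteq> cvec.span {b \<lhd> lam k | k b. k \<in> I}"
proof -
  have "c \<lhd> PiL E \<epsilon> a \<in> cvec.span {b \<lhd> lam k | k b. k \<in> I}" for a c
  proof -
    obtain f where f: "f \<in> fun_fin I" "PiL E \<epsilon> a = \<phi> f" using PiL_\<phi> by blast
    have "\<phi> f = (\<Sum>i\<in>{i. f i \<noteq> 0}. f i *\<^sub>C lam i)"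
      using f(1) by (intro \<phi>_sum) (auto simp: fun_fin_def)
    then have "c \<lhd> PiL E \<epsilon> a = (\<Sum>i\<in>{i. f i \<noteq> 0}. f i *\<^sub>C (c \<lhd> lam i))"
      unfolding f(2) by (simp add: clinear_sum[OF clinear_eval_right[OF clinear_id]] act_right_scaleC)
    also have "\<dots> \<in> cvec.span {b \<lhd> lam k | k b. k \<in> I}"
      using f(1) by (intro cvec.span_sum cvec.span_scale cvec.span_base) (auto simp: fun_fin_def)
    finally show ?thesis .
  qed
  then have "cvec.span {c \<lhd> PiL E \<epsilon> a | a c. True} \<subseteq> cvec.span {b \<lhd> lam k | k b. k \<in> I}"
    by (intro cvec.span_minimal cvec.subspace_span) blast
  then show ?thesis using span_PiL_right[OF full] by blast
qed

lemma lam_strict_sum: "has_strict_sum lam I 1"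
  by (rule orthogonal_family_strict_sum[OF lam_orth span_lam_left span_lam_right])

lemmas lam_separates = has_strict_sum_one_separates[OF lam_strict_sum]

lemma lam_act_nonzero:
  assumes "k \<in> I"
  obtains c where "lam k \<rhd> c \<noteq> 0"
  using A.multiplier_eq_leftI[of "lam k" 0] lam_nonzero[OF assms] by auto

lemma act_lam_nonzero:
  assumes "k \<in> I"
  obtains c where "c \<lhd> lam k \<noteq> 0"
  using A.multiplier_eq_rightI[of "lam k" 0] lam_nonzero[OF assms] by auto

lemma lam_scale_cancel: "k \<in> I \<Longrightarrow> c *\<^sub>C lam k = d *\<^sub>C lam k \<longleftrightarrow> c = d"
  using lam_nonzero by simp

text \<open>By \<open>E_first_leg_left\<close>, \<open>\<lambda>\<^sub>k\<close> in the second leg reduces \<open>(y \<otimes> 1) E (x \<otimes> z)\<close> to an elementary tensor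
  \<open>w y x \<otimes> \<lambda>\<^sub>k z\<close>, wherever \<open>\<lambda>\<^sub>k\<close> stands.  A functional that does not vanish on \<open>\<lambda>\<^sub>k z\<^sub>0\<close> extracts a left
  action \<open>L\<close> with \<open>y (L x) = w y x\<close>, another one extracts the right action, and the two are
  compatible because \<open>E\<close> commutes with \<open>1 \<otimes> \<lambda>\<^sub>k\<close>.\<close>

lemma rho_exists:
  assumes k: "k \<in> I"
  shows "\<exists>r. E * (1 \<otimes>\<^sub>M lam k) = r \<otimes>\<^sub>M lam k \<and> (1 \<otimes>\<^sub>M lam k) * E = r \<otimes>\<^sub>M lam k"
proof -
  obtain z0 where "lam k \<rhd> z0 \<noteq> 0" by (rule lam_act_nonzero[OF k])
  then obtain \<omega> :: "'a \<Rightarrow> complex" where \<omega>: "clinear \<omega>" "\<omega> (lam k \<rhd> z0) = 1"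
    using functional_exists by blast
  obtain z1 where "z1 \<lhd> lam k \<noteq> 0" by (rule act_lam_nonzero[OF k])
  then obtain \<omega>' :: "'a \<Rightarrow> complex" where \<omega>': "clinear \<omega>'" "\<omega>' (z1 \<lhd> lam k) = 1"
    using functional_exists by blast
  have slice: "lam k \<rhd> slice_fst \<epsilon> (E \<rhd> (v \<otimes> z)) = coeff k v *\<^sub>C (lam k \<rhd> z)"
    "slice_fst \<epsilon> (E \<rhd> (v \<otimes> (lam k \<rhd> z))) = coeff k v *\<^sub>C (lam k \<rhd> z)" for v z
    using lam_PiL[OF k, of v] by (metis PiL_act(1) act_left_scaleC act_left_times)+
  \<comment> \<open>\<open>w y x\<close> stands for \<open>y \<rho>\<^sub>k x\<close>.\<close>
  define w where "w y x = slice_snd (coeff k) (D2 y x)" for y x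
  note simps = tensor_map_tensor clinear_ident clinear_id clinear_slice_E tensor_map_add act_left_add
    slice_snd_tensor clinear_coeff[OF k] slice_snd_add tensor_add_left slice tensor_scale_left tensor_scale_right
  have 1: "(to_multiplier y \<otimes>\<^sub>M lam k) \<rhd> E \<rhd> (x \<otimes> z) = w y x \<otimes> (lam k \<rhd> z)" for x y z
  proof -
    have "(1 \<otimes>\<^sub>M lam k) \<rhd> tensor_map id (\<lambda>v. slice_fst \<epsilon> (E \<rhd> (v \<otimes> z))) t = slice_snd (coeff k) t \<otimes> (lam k \<rhd> z)" for t
      by (induction t rule: tensor_induct) (simp_all add: simps)
    from this[of "D2 y x"] show ?thesis
      unfolding E_first_leg_left w_def act_both_legs(1) .
  qed
  have 2: "(to_multiplier y \<otimes>\<^sub>M 1) \<rhd> E \<rhd> (x \<otimes> (lam k \<rhd> z)) = w y x \<otimes> (lam k \<rhd> z)" for x y z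
  proof -
    have "tensor_map id (\<lambda>v. slice_fst \<epsilon> (E \<rhd> (v \<otimes> (lam k \<rhd> z)))) t = slice_snd (coeff k) t \<otimes> (lam k \<rhd> z)" for t
      by (induction t rule: tensor_induct)
        (simp_all add: slice tensor_map_tensor clinear_ident clinear_id clinear_scaled[OF clinear_coeff[OF k]]
          tensor_map_add slice_snd_tensor clinear_coeff[OF k] slice_snd_add tensor_add_left
          tensor_scale_left tensor_scale_right)
    from this[of "D2 y x"] show ?thesis
      unfolding E_first_leg_left w_def .
  qed
  define L where "L x = slice_snd \<omega> (E \<rhd> (x \<otimes> (lam k \<rhd> z0)))" for x
  have yL: "y * L x = w y x" for x y
  proof -
    have "y * L x = slice_snd \<omega> ((to_multiplier y \<otimes>\<^sub>M 1) \<rhd> E \<rhd> (x \<otimes> (lam k \<rhd> z0)))"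
      by (simp add: L_def slice_snd_act \<omega>)
    then show ?thesis by (simp add: 2 slice_snd_tensor \<omega> scaleC_one)
  qed
  have EL: "E \<rhd> (x \<otimes> (lam k \<rhd> z)) = L x \<otimes> (lam k \<rhd> z)" for x z
    by (rule cancel_first_left) (simp add: 2 yL)
  have LE: "(1 \<otimes>\<^sub>M lam k) \<rhd> E \<rhd> (x \<otimes> z) = L x \<otimes> (lam k \<rhd> z)" for x z
    by (rule cancel_first_left) (simp add: act_both_legs 1 yL)
  define R where "R y = slice_snd \<omega>' ((y \<otimes> (z1 \<lhd> lam k)) \<lhd> E)" for y
  have RL: "y * L x = R y * x" for x y
  proof -
    let ?S = "(y \<otimes> (z1 \<lhd> lam k)) \<lhd> E"
    have "?S \<lhd> (to_multiplier x \<otimes>\<^sub>M 1) = (y * L x) \<otimes> (z1 \<lhd> lam k)"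
    proof (rule cancel_second_right)
      fix c
      have "?S \<lhd> (to_multiplier x \<otimes>\<^sub>M 1) \<lhd> (1 \<otimes>\<^sub>M to_multiplier c) = ?S * (x \<otimes> c)"
        by (rule act_elementary_tensor)
      also have "\<dots> = ((y \<otimes> z1) \<lhd> (1 \<otimes>\<^sub>M lam k)) * (E \<rhd> (x \<otimes> c))"
        by (simp add: act_middle)
      also have "\<dots> = (y \<otimes> z1) * (L x \<otimes> (lam k \<rhd> c))"
        by (simp only: LE flip: act_middle)
      finally show "?S \<lhd> (to_multiplier x \<otimes>\<^sub>M 1) \<lhd> (1 \<otimes>\<^sub>M to_multiplier c)
        = ((y * L x) \<otimes> (z1 \<lhd> lam k)) \<lhd> (1 \<otimes>\<^sub>M to_multiplier c)"
        by (simp add: tensor_times_tensor act_middle)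
    qed
    from arg_cong[OF this, of "slice_snd \<omega>'"] show ?thesis
      by (simp add: slice_snd_act \<omega>' slice_snd_tensor scaleC_one R_def)
  qed
  have "clinear L" "clinear R"
    unfolding L_def R_def
    by (intro clinear_compose[OF clinear_slice_snd] clinear_compose[OF clinear_act_left]
        clinear_compose[OF clinear_act_right] clinear_tensor_left clinear_id)+
  then have r: "Abs_multiplier (L, R) \<rhd> x = L x" for x
    using RL by (simp add: act_left_def Abs_multiplier_inverse)
  show ?thesis
    by (intro exI[of _ "Abs_multiplier (L, R)"] conjI
        A.multiplier_tensor_eq_leftI[OF A.nondegenerate_algebra_axioms]) (simp_all add: r EL LE)
qed

definition rho :: "'i \<Rightarrow> 'a multiplier" where
  "rho k = (SOME r. E * (1 \<otimes>\<^sub>M lam k) = r \<otimes>\<^sub>M lam k \<and> (1 \<otimes>\<^sub>M lam k) * E = r \<otimes>\<^sub>M lam k)"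

lemma E_lam:
  assumes "k \<in> I"
  shows "E * (1 \<otimes>\<^sub>M lam k) = rho k \<otimes>\<^sub>M lam k" "(1 \<otimes>\<^sub>M lam k) * E = rho k \<otimes>\<^sub>M lam k"
  using someI_ex[OF rho_exists[OF assms]] unfolding rho_def by blast+

lemma E_lam_act:
  assumes "k \<in> I"
  shows "E \<rhd> (x \<otimes> (lam k \<rhd> z)) = (rho k \<rhd> x) \<otimes> (lam k \<rhd> z)"
    "(x \<otimes> (z \<lhd> lam k)) \<lhd> E = (x \<lhd> rho k) \<otimes> (z \<lhd> lam k)"
  using arg_cong[OF E_lam(1)[OF assms], of "\<lambda>m. m \<rhd> (x \<otimes> z)"]
    arg_cong[OF E_lam(2)[OF assms], of "\<lambda>m. (x \<otimes> z) \<lhd> m"] by simp_all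

lemma coeff_eq:
  assumes "k \<in> I"
  shows "coeff k a = \<epsilon> (rho k \<rhd> a)"
proof -
  obtain c where c: "lam k \<rhd> c \<noteq> 0" by (rule lam_act_nonzero[OF assms])
  have "coeff k a *\<^sub>C (lam k \<rhd> c) = PiL E \<epsilon> a \<rhd> (lam k \<rhd> c)"
    using lam_PiL(2)[OF assms, of a] by (metis act_left_scaleC act_left_times)
  also have "\<dots> = \<epsilon> (rho k \<rhd> a) *\<^sub>C (lam k \<rhd> c)"
    by (simp add: PiL_act(1) E_lam_act assms slice_fst_tensor counit_linear)
  finally show ?thesis using c by simp
qed

lemma lam_PiL':
  assumes "k \<in> I"
  shows "lam k * PiL E \<epsilon> a = \<epsilon> (rho k \<rhd> a) *\<^sub>C lam k" "PiL E \<epsilon> a * lam k = \<epsilon> (rho k \<rhd> a) *\<^sub>C lam k"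
  using lam_PiL[OF assms, of a] by (simp_all only: coeff_eq[OF assms])

text \<open>The elements \<open>a\<close> with \<open>\<Pi>\<^sup>L(a) = \<lambda>\<^sub>k\<close> are dual to the \<open>\<rho>\<^sub>l\<close>.  They make it possible to isolate one term of a sum
  \<open>\<Sum>\<^sub>l \<rho>\<^sub>l \<otimes> \<dots>\<close> before the orthogonality of the \<open>\<rho>\<^sub>l\<close> is known.\<close>

lemma dual_left_exists:
  assumes "k \<in> I"
  obtains a where "PiL E \<epsilon> a = lam k" "\<And>l. l \<in> I \<Longrightarrow> \<epsilon> (rho l \<rhd> a) = (if l = k then 1 else 0)"
proof -
  obtain a where a: "PiL E \<epsilon> a = lam k" using lam_baseL[OF assms] by blast
  have "\<epsilon> (rho l \<rhd> a) = (if l = k then 1 else 0)" if l: "l \<in> I" for l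
  proof -
    have "\<epsilon> (rho l \<rhd> a) *\<^sub>C lam l = lam l * lam k"
      using lam_PiL(1)[OF l, of a] unfolding a coeff_eq[OF l] by (rule sym)
    also have "\<dots> = (if l = k then 1 else 0) *\<^sub>C lam l"
      by (cases "l = k") (simp_all add: lam_orth l assms scaleC_one)
    finally have "\<epsilon> (rho l \<rhd> a) *\<^sub>C lam l = (if l = k then 1 else 0) *\<^sub>C lam l" .
    then show ?thesis by (simp only: lam_scale_cancel[OF l])
  qed
  then show thesis using a that by blast
qed

lemma rho_nonzero: "k \<in> I \<Longrightarrow> rho k \<noteq> 0"
  using dual_left_exists[of k] clinear_zero[OF counit_linear]
  by (metis act_left_zero_multiplier zero_neq_one)

lemma rho_idem:
  assumes "k \<in> I"
  shows "rho k * rho k = rho k"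
proof (rule mtensor_cancel_right[OF _ lam_nonzero[OF assms] A.nondegenerate_algebra_axioms A.nondegenerate_algebra_axioms])
  have "(rho k * rho k) \<otimes>\<^sub>M lam k = (rho k \<otimes>\<^sub>M lam k) * (rho k \<otimes>\<^sub>M lam k)"
    by (simp add: mtensor_mult lam_orth assms)
  also have "\<dots> = (E * (1 \<otimes>\<^sub>M lam k)) * ((1 \<otimes>\<^sub>M lam k) * E)"
    by (simp add: E_lam assms)
  also have "\<dots> = E * ((1 \<otimes>\<^sub>M lam k) * E)"
    by (simp add: mult.assoc mtensor_mult lam_orth assms multiplier_one flip: mult.assoc[of "1 \<otimes>\<^sub>M lam k" "1 \<otimes>\<^sub>M lam k" E])
  also have "\<dots> = E * (E * (1 \<otimes>\<^sub>M lam k))" by (simp add: E_lam assms)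
  also have "\<dots> = E * E * (1 \<otimes>\<^sub>M lam k)" by (simp only: mult.assoc)
  also have "\<dots> = rho k \<otimes>\<^sub>M lam k" by (simp only: E_idempotent E_lam assms)
  finally show "(rho k * rho k) \<otimes>\<^sub>M lam k = rho k \<otimes>\<^sub>M lam k" .
qed

text \<open>Apply \<open>E\<^sub>1\<^sub>2 E\<^sub>2\<^sub>3 = E\<^sub>2\<^sub>3 E\<^sub>1\<^sub>2\<close> to an element with third leg in \<open>\<lambda>\<^sub>m A\<close>: the result is that \<open>E\<close> commutes with
  \<open>1 \<otimes> \<rho>\<^sub>m\<close>.  Then slice the first leg.\<close>

lemma lam_rho_commute:
  assumes k: "k \<in> I" and m: "m \<in> I"
  shows "lam k * rho m = rho m * lam k"
proof (rule A.multiplier_eq_leftI)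
  fix y
  obtain a where a: "PiL E \<epsilon> a = lam k" using lam_baseL[OF k] by blast
  obtain z where z: "lam m \<rhd> z \<noteq> 0" by (rule lam_act_nonzero[OF m])
  have E23: "E23 \<rhd> tensor_assoc (t \<otimes> (lam m \<rhd> z)) = tensor_assoc (((1 \<otimes>\<^sub>M rho m) \<rhd> t) \<otimes> (lam m \<rhd> z))" for t
    by (induction t rule: tensor_induct)
      (simp_all add: tensor_assoc_tensor E23_def E_lam_act m tensor_add_left tensor_assoc_add act_left_add)
  have "tensor_assoc ((E \<rhd> (a \<otimes> (rho m \<rhd> y))) \<otimes> (lam m \<rhd> z)) = E12 \<rhd> E23 \<rhd> (a \<otimes> (y \<otimes> (lam m \<rhd> z)))"
    by (simp add: E12_act E23_def E_lam_act m)
  also have "\<dots> = E23 \<rhd> E12 \<rhd> (a \<otimes> (y \<otimes> (lam m \<rhd> z)))"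
    using E12_E23 by (metis act_left_times)
  also have "\<dots> = tensor_assoc (((1 \<otimes>\<^sub>M rho m) \<rhd> E \<rhd> (a \<otimes> y)) \<otimes> (lam m \<rhd> z))"
    by (simp add: E12_act E23)
  finally have "slice_fst \<epsilon> (E \<rhd> (a \<otimes> (rho m \<rhd> y))) \<otimes> (lam m \<rhd> z)
      = slice_fst \<epsilon> ((1 \<otimes>\<^sub>M rho m) \<rhd> E \<rhd> (a \<otimes> y)) \<otimes> (lam m \<rhd> z)"
    by (metis slice_fst_assoc)
  then have "slice_fst \<epsilon> (E \<rhd> (a \<otimes> (rho m \<rhd> y))) = slice_fst \<epsilon> ((1 \<otimes>\<^sub>M rho m) \<rhd> E \<rhd> (a \<otimes> y))"
    using z by (rule tensor_cancel_right)
  then show "(lam k * rho m) \<rhd> y = (rho m * lam k) \<rhd> y"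
    by (simp add: slice_fst_act counit_linear a flip: PiL_act(1))
qed

lemma span_prod: "UNIV \<subseteq> cvec.span {a * b | a b :: 'a. True}"
  using idempotent_algebra by simp

text \<open>\<open>(id \<otimes> \<Delta>)(E) = E\<^sub>1\<^sub>2 E\<^sub>2\<^sub>3\<close> says that \<open>\<Sum>\<^sub>l \<rho>\<^sub>l \<otimes> \<Delta>(\<lambda>\<^sub>l z) = E\<^sub>1\<^sub>2 (1 \<otimes> \<Delta>(z))\<close>; slicing the first leg at an element dual to
  the \<open>\<rho>\<^sub>l\<close> selects \<open>l = k\<close>.\<close>

lemma comult_lam_left:
  assumes k: "k \<in> I"
  shows "\<Delta> (lam k \<rhd> z) = (lam k \<otimes>\<^sub>M 1) * \<Delta> z"
proof -
  have *: "(lam k \<otimes>\<^sub>M 1) * \<Delta> (lam l \<rhd> z) = (if k = l then \<Delta> (lam l \<rhd> z) else 0)" if l: "l \<in> I" for l z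
  proof (rule AA.multiplier_eq_leftI)
    fix u
    obtain a where a: "PiL E \<epsilon> a = lam k" "\<And>l. l \<in> I \<Longrightarrow> \<epsilon> (rho l \<rhd> a) = (if l = k then 1 else 0)"
      by (rule dual_left_exists[OF k]) (rule that)
    let ?w = "\<Delta> (lam l \<rhd> z) \<rhd> u"
    have "E12 \<rhd> (a \<otimes> ?w) = (rho l \<rhd> a) \<otimes> ?w"
    proof (rule linear_eq_on_span[where f = "\<lambda>a. E12 \<rhd> (a \<otimes> ?w)" and g = "\<lambda>a. (rho l \<rhd> a) \<otimes> ?w", OF _ _ _ span_prod])
      show "clinear (\<lambda>a. E12 \<rhd> (a \<otimes> ?w))" "clinear (\<lambda>a. (rho l \<rhd> a) \<otimes> ?w)"
        by (intro clinear_compose[OF clinear_act_left] clinear_tensor_left clinear_id clinear_act_left)+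
      fix a assume "a \<in> {a * b | a b :: 'a. True}"
      then obtain x y where "a = x * y" by blast
      then show "E12 \<rhd> (a \<otimes> ?w) = (rho l \<rhd> a) \<otimes> ?w"
        by (simp add: E12_comult_left E_lam_act l MD_tensor A.act_left_mult)
    qed
    from arg_cong[OF this, of "slice_fst \<epsilon>"] show "((lam k \<otimes>\<^sub>M 1) * \<Delta> (lam l \<rhd> z)) \<rhd> u
        = (if k = l then \<Delta> (lam l \<rhd> z) else 0) \<rhd> u"
      using slice_fst_E12(1)[of a "lam k" ?w] a l by (simp add: PiL_act(1)[symmetric] slice_fst_tensor counit_linear scaleC_one)
  qed
  show ?thesis
  proof (rule linear_eq_on_span[where f = "\<lambda>z. \<Delta> (lam k \<rhd> z)" and g = "\<lambda>z. (lam k \<otimes>\<^sub>M 1) * \<Delta> z", OF _ _ _ span_lam_left])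
    show "clinear (\<lambda>z. \<Delta> (lam k \<rhd> z))" "clinear (\<lambda>z. (lam k \<otimes>\<^sub>M 1) * \<Delta> z)"
      by (intro clinear_compose[OF comult_linear] clinear_act_left clinear_mult_left comult_linear)+
    fix z assume "z \<in> {lam k \<rhd> b | k b. k \<in> I}"
    then obtain l b where l: "l \<in> I" and z: "z = lam l \<rhd> b" by blast
    show "\<Delta> (lam k \<rhd> z) = (lam k \<otimes>\<^sub>M 1) * \<Delta> z"
      using lam_orth[OF k l] clinear_zero[OF comult_linear] unfolding z *[OF l]
      by (metis act_left_times act_left_zero_multiplier)
  qed
qed

text \<open>\<open>(\<Delta> \<otimes> id)(E) = E\<^sub>2\<^sub>3 E\<^sub>1\<^sub>2\<close> with \<open>\<lambda>\<^sub>k\<close> in the third leg, where \<open>E\<^sub>2\<^sub>3\<close> reduces to \<open>\<rho>\<^sub>k\<close> in the second leg.\<close>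

lemma comult_rho_left:
  assumes k: "k \<in> I"
  shows "\<Delta> (rho k \<rhd> x) = (1 \<otimes>\<^sub>M rho k) * \<Delta> x"
proof (rule AA.multiplier_eq_leftI)
  fix u
  obtain z where "lam k \<rhd> z \<noteq> 0" by (rule lam_act_nonzero[OF k])
  then obtain c where c: "lam k \<rhd> (z * c) \<noteq> 0" using A.nondeg_left by (metis A.act_left_mult)
  have E23: "E23 \<rhd> tensor_assoc (t \<otimes> (lam k \<rhd> q)) = tensor_assoc (((1 \<otimes>\<^sub>M rho k) \<rhd> t) \<otimes> (lam k \<rhd> q))" for t q
    by (induction t rule: tensor_induct)
      (simp_all add: tensor_assoc_tensor E23_def E_lam_act k tensor_add_left tensor_assoc_add act_left_add)
  have "tensor_assoc (((1 \<otimes>\<^sub>M rho k) \<rhd> \<Delta> x \<rhd> u) \<otimes> (lam k \<rhd> (z * c))) = tensor_assoc ((\<Delta> (rho k \<rhd> x) \<rhd> u) \<otimes> (lam k \<rhd> (z * c)))"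
    using E23_comult_left[of x u "lam k \<rhd> z" c]
    by (simp add: E_lam_act k DM_tensor A.act_left_mult E23)
  then have "((1 \<otimes>\<^sub>M rho k) \<rhd> \<Delta> x \<rhd> u) \<otimes> (lam k \<rhd> (z * c)) = (\<Delta> (rho k \<rhd> x) \<rhd> u) \<otimes> (lam k \<rhd> (z * c))"
    by (metis tensor_assoc_inverse(1))
  from tensor_cancel_right[OF this c] show "\<Delta> (rho k \<rhd> x) \<rhd> u = ((1 \<otimes>\<^sub>M rho k) * \<Delta> x) \<rhd> u" by simp
qed

lemma comult_rho_right:
  assumes k: "k \<in> I"
  shows "\<Delta> (x \<lhd> rho k) = \<Delta> x * (1 \<otimes>\<^sub>M rho k)"
proof (rule AA.multiplier_eq_rightI)
  fix u
  obtain z where "z \<lhd> lam k \<noteq> 0" by (rule act_lam_nonzero[OF k])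
  then obtain c where c: "(c * z) \<lhd> lam k \<noteq> 0" using A.nondeg_right by (metis A.act_right_mult)
  have E23: "tensor_assoc (t \<otimes> (q \<lhd> lam k)) \<lhd> E23 = tensor_assoc ((t \<lhd> (1 \<otimes>\<^sub>M rho k)) \<otimes> (q \<lhd> lam k))" for t q
    by (induction t rule: tensor_induct)
      (simp_all add: tensor_assoc_tensor E23_def E_lam_act k tensor_add_left tensor_assoc_add act_right_add)
  have "tensor_assoc ((u \<lhd> \<Delta> x \<lhd> (1 \<otimes>\<^sub>M rho k)) \<otimes> ((c * z) \<lhd> lam k)) = tensor_assoc ((u \<lhd> \<Delta> (x \<lhd> rho k)) \<otimes> ((c * z) \<lhd> lam k))"
    using E23_comult_right[of u x c "z \<lhd> lam k"]
    by (simp add: E_lam_act k DM_tensor A.act_right_mult E23)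
  then have "(u \<lhd> \<Delta> x \<lhd> (1 \<otimes>\<^sub>M rho k)) \<otimes> ((c * z) \<lhd> lam k) = (u \<lhd> \<Delta> (x \<lhd> rho k)) \<otimes> ((c * z) \<lhd> lam k)"
    by (metis tensor_assoc_inverse(1))
  from tensor_cancel_right[OF this c] show "u \<lhd> \<Delta> (x \<lhd> rho k) = u \<lhd> (\<Delta> x * (1 \<otimes>\<^sub>M rho k))" by simp
qed

text \<open>Both sides are values of \<open>\<epsilon>\<close> at \<open>a \<lambda>\<^sub>k \<Pi>\<^sup>L(b)\<close>, because \<open>\<epsilon>(a \<Pi>\<^sup>L(b)) = \<epsilon>(a b)\<close> and \<open>\<lambda>\<^sub>k \<Pi>\<^sup>L(b)\<close> is a
  multiple of \<open>\<lambda>\<^sub>k\<close>.\<close>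

lemma counit_lam_mult:
  assumes "k \<in> I"
  shows "\<epsilon> ((a \<lhd> lam k) * b) = \<epsilon> (a \<lhd> lam k) * \<epsilon> (rho k \<rhd> b)"
proof -
  have "\<epsilon> ((a \<lhd> lam k) * b) = \<epsilon> (slice_fst \<epsilon> (D3 (a \<lhd> lam k) b))"
    by (simp add: slice_exchange counit_linear counit_D3)
  also have "\<dots> = \<epsilon> (a \<lhd> (lam k * PiL E \<epsilon> b))"
    by (simp add: PiL_act(2))
  also have "\<dots> = \<epsilon> (a \<lhd> lam k) * \<epsilon> (rho k \<rhd> b)"
    by (simp add: lam_PiL' assms act_right_scaleC clinear_scale[OF counit_linear] scaleC_complex_def mult.commute
        del: act_right_times)
  finally show ?thesis .
qed

text \<open>The second weak multiplicativity axiom for the counit, with \<open>\<lambda>\<^sub>m\<close> moved through the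
  comultiplication and the result compared in the corner \<open>A \<lambda>\<^sub>k\<close>.\<close>

lemma counit_lam_rho:
  assumes k: "k \<in> I" and m: "m \<in> I"
  shows "\<epsilon> (a \<lhd> lam m \<lhd> rho k) = (if k = m then \<epsilon> (a \<lhd> rho k) else 0)"
proof -
  have right: "slice_fst \<epsilon> (((a \<otimes> (b \<lhd> lam k)) \<lhd> E) \<lhd> (1 \<otimes>\<^sub>M to_multiplier c)) = \<epsilon> (a \<lhd> rho k) *\<^sub>C ((b \<lhd> lam k) * c)" for a b c
    by (simp add: E_lam_act k slice_fst_tensor counit_linear)
  have "\<epsilon> (a \<lhd> lam m \<lhd> rho k) *\<^sub>C ((b \<lhd> lam k) * c) = \<epsilon> (a \<lhd> rho k) *\<^sub>C (b \<lhd> lam k \<lhd> lam m) * c" for b c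
  proof -
    have "\<epsilon> (a \<lhd> lam m \<lhd> rho k) *\<^sub>C ((b \<lhd> lam k) * c) = slice_fst \<epsilon> (((a \<lhd> lam m) \<otimes> (b \<lhd> lam k)) \<lhd> \<Delta> c)"
      using counit_right[of "a \<lhd> lam m" "b \<lhd> lam k" c] right[of "a \<lhd> lam m" b c] by simp
    also have "((a \<lhd> lam m) \<otimes> (b \<lhd> lam k)) \<lhd> \<Delta> c = (a \<otimes> (b \<lhd> lam k)) \<lhd> \<Delta> (lam m \<rhd> c)"
      by (simp add: comult_lam_left m)
    also have "slice_fst \<epsilon> \<dots> = \<epsilon> (a \<lhd> rho k) *\<^sub>C ((b \<lhd> lam k) * (lam m \<rhd> c))"
      using counit_right[of a "b \<lhd> lam k" "lam m \<rhd> c"] right[of a b "lam m \<rhd> c"] by simp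
    finally show ?thesis by (simp add: act_middle mult_scaleC_left)
  qed
  then have "(\<epsilon> (a \<lhd> lam m \<lhd> rho k) *\<^sub>C (b \<lhd> lam k)) * c = (\<epsilon> (a \<lhd> rho k) *\<^sub>C (b \<lhd> lam k \<lhd> lam m)) * c" for b c
    by (simp add: mult_scaleC_left)
  then have *: "\<epsilon> (a \<lhd> lam m \<lhd> rho k) *\<^sub>C (b \<lhd> lam k) = \<epsilon> (a \<lhd> rho k) *\<^sub>C (b \<lhd> lam k \<lhd> lam m)" for b
    by (rule A.eq_leftI)
  obtain b where b: "b \<lhd> lam k \<noteq> 0" by (rule act_lam_nonzero[OF k])
  have "b \<lhd> lam k \<lhd> lam m = (if k = m then b \<lhd> lam k else 0)"
    using lam_orth[OF k m] by (metis act_right_times act_right_zero_multiplier)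
  then show ?thesis using *[of b] b by (simp split: if_splits)
qed

text \<open>By \<open>counit_lam_mult\<close>, slicing the second leg of \<open>\<Delta>(c) (y \<otimes> 1)\<close> by the functional \<open>v \<mapsto> \<epsilon>(x \<lambda>\<^sub>k v)\<close> gives
  \<open>\<epsilon>(x \<lambda>\<^sub>k) \<rho>\<^sub>k c y\<close>.  A factor \<open>\<rho>\<^sub>m\<close> in front of \<open>v\<close> can be moved either to \<open>c\<close> or, past \<open>\<lambda>\<^sub>k\<close>, to \<open>x\<close>, and
  the comparison expresses \<open>\<rho>\<^sub>k \<rho>\<^sub>m\<close> as a multiple of \<open>\<rho>\<^sub>k\<close>.\<close>

lemma counit_rho_mult:
  assumes k: "k \<in> I" and m: "m \<in> I"
  shows "\<epsilon> (x \<lhd> lam k) *\<^sub>C (rho k * rho m) = (if k = m then \<epsilon> (x \<lhd> rho k) else 0) *\<^sub>C rho k"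
proof -
  have J: "slice_snd (\<lambda>v. \<epsilon> ((x \<lhd> lam k) * v)) (D3 c y) = \<epsilon> (x \<lhd> lam k) *\<^sub>C ((rho k \<rhd> c) * y)" for x c y
  proof -
    have "(1 \<otimes>\<^sub>M rho k) \<rhd> D3 c y = D3 (rho k \<rhd> c) y"
      by (simp add: to_multiplier_D3 comult_rho_left k mult.assoc
            flip: AA.to_multiplier_inject AA.mult_to_multiplier)
    then have "slice_snd (\<lambda>v. \<epsilon> (rho k \<rhd> v)) (D3 c y) = (rho k \<rhd> c) * y"
      by (metis counit_D3 counit_linear slice_snd_act(3))
    then show ?thesis
      by (simp add: counit_lam_mult k slice_snd_scaled clinear_compose[OF counit_linear clinear_act_left])
  qed
  have "(\<epsilon> (x \<lhd> lam k) *\<^sub>C (rho k \<rhd> rho m \<rhd> c)) * y = (\<epsilon> (x \<lhd> rho m \<lhd> lam k) *\<^sub>C (rho k \<rhd> c)) * y" for c y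
  proof -
    have "(1 \<otimes>\<^sub>M rho m) \<rhd> D3 c y = D3 (rho m \<rhd> c) y"
      by (simp add: to_multiplier_D3 comult_rho_left m mult.assoc
            flip: AA.to_multiplier_inject AA.mult_to_multiplier)
    then have "slice_snd (\<lambda>v. \<epsilon> ((x \<lhd> lam k) * (rho m \<rhd> v))) (D3 c y) = slice_snd (\<lambda>v. \<epsilon> ((x \<lhd> lam k) * v)) (D3 (rho m \<rhd> c) y)"
      using slice_snd_act(3)[of "\<lambda>v. \<epsilon> ((x \<lhd> lam k) * v)" "rho m" "D3 c y"]
        clinear_compose[OF counit_linear clinear_mult_left[OF clinear_id]] by simp
    also have "\<dots> = \<epsilon> (x \<lhd> lam k) *\<^sub>C ((rho k \<rhd> rho m \<rhd> c) * y)" by (rule J)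
    also have "(\<lambda>v. \<epsilon> ((x \<lhd> lam k) * (rho m \<rhd> v))) = (\<lambda>v. \<epsilon> ((x \<lhd> rho m \<lhd> lam k) * v))"
      using lam_rho_commute[OF k m] by (simp add: act_middle flip: act_right_times)
    finally show ?thesis unfolding J by (simp add: mult_scaleC_left)
  qed
  then have "\<epsilon> (x \<lhd> lam k) *\<^sub>C (rho k \<rhd> rho m \<rhd> c) = \<epsilon> (x \<lhd> rho m \<lhd> lam k) *\<^sub>C (rho k \<rhd> c)" for c
    by (rule A.eq_leftI)
  then have "\<epsilon> (x \<lhd> lam k) *\<^sub>C (rho k * rho m) = \<epsilon> (x \<lhd> rho m \<lhd> lam k) *\<^sub>C rho k"
    by (intro A.multiplier_eq_leftI) (simp add: act_left_scaleC)
  also have "x \<lhd> rho m \<lhd> lam k = x \<lhd> lam k \<lhd> rho m"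
    using lam_rho_commute[OF k m] by (simp flip: act_right_times)
  finally show ?thesis
    using counit_lam_rho[OF m k, of x] by auto
qed

lemma counit_lam_eq_rho_right:
  assumes "k \<in> I"
  shows "\<epsilon> (x \<lhd> lam k) = \<epsilon> (x \<lhd> rho k)"
  using counit_rho_mult[OF assms assms, of x] rho_nonzero[OF assms] by (simp add: rho_idem assms)

text \<open>The indices \<open>k\<close> for which \<open>counit_rho_mult\<close> determines \<open>\<rho>\<^sub>k \<rho>\<^sub>m\<close>.  They exhaust \<open>I\<close>: the products of
  \<open>A\<close> with the \<open>\<rho>\<^sub>k\<close> for supported \<open>k\<close> already span \<open>A\<close>, and they annihilate every other \<open>\<rho>\<^sub>m\<close>, which is
  not zero.\<close>

definition supported :: "'i set" where
  "supported = {k \<in> I. \<exists>x. \<epsilon> (x \<lhd> lam k) \<noteq> 0}"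

lemma rho_orth_supported:
  assumes "k \<in> supported" "m \<in> I" "k \<noteq> m"
  shows "rho k * rho m = 0"
proof -
  obtain x where "\<epsilon> (x \<lhd> lam k) \<noteq> 0" "k \<in> I" using assms(1) by (auto simp: supported_def)
  then show ?thesis using counit_rho_mult[of k m x] assms by simp
qed

text \<open>\<open>a b = (id \<otimes> \<epsilon>)((a \<otimes> 1) \<Delta>(b))\<close>, and \<open>E\<close> can be inserted behind \<open>\<Delta>(b)\<close>; a second leg in \<open>A \<lambda>\<^sub>k\<close> then
  contributes an element of \<open>A \<rho>\<^sub>k\<close> weighted by a value of \<open>\<epsilon>\<close> on \<open>A \<lambda>\<^sub>k\<close>.\<close>

lemma span_rho_supported: "UNIV \<subseteq> cvec.span {b \<lhd> rho k | k b. k \<in> supported}"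
proof -
  let ?S = "cvec.span {b \<lhd> rho k | k b. k \<in> supported}"
  have *: "slice_snd \<epsilon> ((x \<otimes> y) \<lhd> E) \<in> ?S" for x y
  proof -
    have "y \<in> cvec.span {b \<lhd> lam k | k b. k \<in> I}" using span_lam_right by blast
    then show ?thesis
    proof (induction rule: cvec.span_induct_alt)
      case base
      then show ?case by (simp add: cvec.span_zero)
    next
      case (step c u v)
      then obtain k b where k: "k \<in> I" and u: "u = b \<lhd> lam k" by blast
      have "slice_snd \<epsilon> ((x \<otimes> u) \<lhd> E) = \<epsilon> (b \<lhd> lam k) *\<^sub>C (x \<lhd> rho k)"
        by (simp add: u E_lam_act k slice_snd_tensor counit_linear)
      also have "\<dots> \<in> ?S"
      proof (cases "\<epsilon> (b \<lhd> lam k) = 0")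
        case False
        then have "k \<in> supported" using k by (auto simp: supported_def)
        then show ?thesis by (intro cvec.span_scale cvec.span_base) blast
      qed (simp add: cvec.span_zero)
      finally show ?case
        using step by (simp add: tensor_add_right tensor_scale_right act_right_add act_right_scale
            slice_snd_add clinear_scale[OF clinear_slice_snd] cvec.span_add cvec.span_scale)
    qed
  qed
  have **: "slice_snd \<epsilon> (t \<lhd> E) \<in> ?S" for t
  proof (induction t rule: tensor_induct)
    case (pure x y)
    show ?case by (rule *)
  qed (simp add: act_right_add slice_snd_add cvec.span_add)
  have "a * b \<in> ?S" for a b
  proof -
    have "D2 a b \<lhd> E = D2 a b"
      by (simp add: to_multiplier_D2 D.mult_e mult.assoc
          flip: AA.to_multiplier_inject AA.mult_to_multiplier)
    then show ?thesis using **[of "D2 a b"] by (simp add: counit_D2)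
  qed
  then show ?thesis
    unfolding idempotent_algebra[symmetric]
    by (intro cvec.span_minimal cvec.subspace_span) blast
qed

lemma supported_eq: "supported = I"
proof
  show "I \<subseteq> supported"
  proof
    fix k assume k: "k \<in> I"
    show "k \<in> supported"
    proof (rule ccontr)
      assume ns: "k \<notin> supported"
      have "x \<lhd> rho k = x \<lhd> 0" for x
      proof (rule linear_eq_on_span[where f = "\<lambda>x. x \<lhd> rho k" and g = "\<lambda>x. x \<lhd> 0", OF _ _ _ span_rho_supported])
        show "clinear (\<lambda>x. x \<lhd> rho k)" "clinear (\<lambda>x :: 'a. x \<lhd> 0)" by (fact clinear_act_right)+
        fix x assume "x \<in> {b \<lhd> rho k | k b. k \<in> supported}"
        then obtain l b where l: "l \<in> supported" "x = b \<lhd> rho l" by blast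
        then have "rho l * rho k = 0" using ns k by (intro rho_orth_supported) auto
        then show "x \<lhd> rho k = x \<lhd> 0"
          unfolding l(2) by (metis act_right_times act_right_zero_multiplier)
      qed
      then have "rho k = 0" by (rule A.multiplier_eq_rightI)
      then show False using rho_nonzero[OF k] by simp
    qed
  qed
qed (auto simp: supported_def)

lemma rho_orth: "k \<in> I \<Longrightarrow> m \<in> I \<Longrightarrow> rho k * rho m = (if k = m then rho k else 0)"
  using rho_orth_supported[of k m] by (simp add: rho_idem supported_eq)

lemma span_rho_left: "UNIV \<subseteq> cvec.span {rho k \<rhd> b | k b. k \<in> I}"
proof -
  let ?S = "cvec.span {rho k \<rhd> b | k b. k \<in> I}"
  have *: "slice_snd \<epsilon> (E \<rhd> (x \<otimes> y)) \<in> ?S" for x y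
  proof -
    have "y \<in> cvec.span {lam k \<rhd> b | k b. k \<in> I}" using span_lam_left by blast
    then show ?thesis
    proof (induction rule: cvec.span_induct_alt)
      case base
      then show ?case by (simp add: cvec.span_zero)
    next
      case (step c u v)
      then obtain k b where k: "k \<in> I" and u: "u = lam k \<rhd> b" by blast
      have "slice_snd \<epsilon> (E \<rhd> (x \<otimes> u)) = \<epsilon> (lam k \<rhd> b) *\<^sub>C (rho k \<rhd> x)"
        by (simp add: u E_lam_act k slice_snd_tensor counit_linear)
      also have "\<dots> \<in> ?S" using k by (intro cvec.span_scale cvec.span_base) blast
      finally show ?case
        using step by (simp add: tensor_add_right tensor_scale_right act_left_add act_left_scale
            slice_snd_add clinear_scale[OF clinear_slice_snd] cvec.span_add cvec.span_scale)
    qed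
  qed
  have **: "slice_snd \<epsilon> (E \<rhd> t) \<in> ?S" for t
  proof (induction t rule: tensor_induct)
    case (pure x y)
    show ?case by (rule *)
  qed (simp add: act_left_add slice_snd_add cvec.span_add)
  have "a * b \<in> ?S" for a b
  proof -
    have "E \<rhd> D3 a b = D3 a b"
      by (simp add: to_multiplier_D3 D.e_mult
          flip: AA.to_multiplier_inject AA.mult_to_multiplier mult.assoc)
    then show ?thesis using **[of "D3 a b"] by (simp add: counit_D3)
  qed
  then show ?thesis
    unfolding idempotent_algebra[symmetric]
    by (intro cvec.span_minimal cvec.subspace_span) blast
qed

lemma rho_strict_sum: "has_strict_sum rho I 1"
  by (rule orthogonal_family_strict_sum[OF rho_orth span_rho_left span_rho_supported[unfolded supported_eq]])

text \<open>The counterparts of the elements of \<open>dual_left_exists\<close> on the other side, with which \<open>\<Delta>(z \<lambda>\<^sub>k)\<close> is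
  computed; they also show that \<open>\<rho>\<^sub>k\<close> belongs to the second base algebra.\<close>

lemma dual_right_exists:
  assumes k: "k \<in> I"
  obtains x where "x \<lhd> lam k = x" "\<epsilon> x = 1" "\<And>l. l \<in> I \<Longrightarrow> \<epsilon> (x \<lhd> rho l) = (if l = k then 1 else 0)"
proof -
  obtain y where y: "\<epsilon> (y \<lhd> lam k) \<noteq> 0" using k supported_eq by (auto simp: supported_def)
  define x where "x = inverse (\<epsilon> (y \<lhd> lam k)) *\<^sub>C (y \<lhd> lam k)"
  have 1: "x \<lhd> lam k = x"
    using lam_orth[OF k k] by (simp add: x_def act_right_scale flip: act_right_times)
  have 2: "\<epsilon> x = 1"
    using y by (simp add: x_def clinear_scale[OF counit_linear] scaleC_complex_def)
  have "\<epsilon> (x \<lhd> rho l) = (if l = k then 1 else 0)" if "l \<in> I" for l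
    using counit_lam_rho[OF that k, of x] counit_lam_eq_rho_right[OF k, of x] 1 2
    by (cases "l = k") simp_all
  then show thesis using that 1 2 by blast
qed

lemma comult_lam_right:
  assumes k: "k \<in> I"
  shows "\<Delta> (z \<lhd> lam k) = \<Delta> z * (lam k \<otimes>\<^sub>M 1)"
proof -
  obtain a where a: "\<And>l. l \<in> I \<Longrightarrow> \<epsilon> (a \<lhd> rho l) = (if l = k then 1 else 0)"
    using dual_right_exists[OF k] by metis
  have bar: "slice_fst \<epsilon> ((a \<otimes> p) \<lhd> E) = p \<lhd> lam k" for p
  proof (rule linear_eq_on_span[where g = "\<lambda>p. p \<lhd> lam k", OF _ _ _ span_lam_right])
    show "clinear (\<lambda>p. slice_fst \<epsilon> ((a \<otimes> p) \<lhd> E))" "clinear (\<lambda>p. p \<lhd> lam k)"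
      by (fact clinear_slice_E clinear_act_right)+
    fix p assume "p \<in> {b \<lhd> lam k | k b. k \<in> I}"
    then obtain l b where l: "l \<in> I" and p: "p = b \<lhd> lam l" by blast
    have "b \<lhd> lam l \<lhd> lam k = (if l = k then 1 else 0) *\<^sub>C (b \<lhd> lam l)"
      using lam_orth[OF l k] by (auto simp: scaleC_one simp flip: act_right_times)
    then show "slice_fst \<epsilon> ((a \<otimes> p) \<lhd> E) = p \<lhd> lam k"
      by (simp add: p E_lam_act l slice_fst_tensor counit_linear a)
  qed
  have *: "\<Delta> (z \<lhd> lam l) * (lam k \<otimes>\<^sub>M 1) = (if k = l then \<Delta> (z \<lhd> lam l) else 0)" if l: "l \<in> I" for l z
  proof (rule AA.multiplier_eq_rightI)
    fix u
    let ?w = "u \<lhd> \<Delta> (z \<lhd> lam l)"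
    have "(a \<otimes> ?w) \<lhd> E12 = (a \<lhd> rho l) \<otimes> ?w"
    proof (rule linear_eq_on_span[where f = "\<lambda>a. (a \<otimes> ?w) \<lhd> E12" and g = "\<lambda>a. (a \<lhd> rho l) \<otimes> ?w", OF _ _ _ span_prod])
      show "clinear (\<lambda>a. (a \<otimes> ?w) \<lhd> E12)" "clinear (\<lambda>a. (a \<lhd> rho l) \<otimes> ?w)"
        by (intro clinear_compose[OF clinear_act_right] clinear_tensor_left clinear_id clinear_act_right)+
      fix a assume "a \<in> {a * b | a b :: 'a. True}"
      then obtain x y where "a = x * y" by blast
      then show "(a \<otimes> ?w) \<lhd> E12 = (a \<lhd> rho l) \<otimes> ?w"
        by (simp add: E12_comult_right E_lam_act l MD_tensor A.act_right_mult)
    qed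
    from arg_cong[OF this, of "slice_fst \<epsilon>"] show "u \<lhd> (\<Delta> (z \<lhd> lam l) * (lam k \<otimes>\<^sub>M 1))
        = u \<lhd> (if k = l then \<Delta> (z \<lhd> lam l) else 0)"
      using slice_fst_E12(2)[of a "lam k" ?w] a l bar by (simp add: slice_fst_tensor counit_linear scaleC_one)
  qed
  show ?thesis
  proof (rule linear_eq_on_span[where f = "\<lambda>z. \<Delta> (z \<lhd> lam k)" and g = "\<lambda>z. \<Delta> z * (lam k \<otimes>\<^sub>M 1)", OF _ _ _ span_lam_right])
    show "clinear (\<lambda>z. \<Delta> (z \<lhd> lam k))" "clinear (\<lambda>z. \<Delta> z * (lam k \<otimes>\<^sub>M 1))"
      by (intro clinear_compose[OF comult_linear] clinear_act_right clinear_mult_right comult_linear)+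
    fix z assume "z \<in> {b \<lhd> lam k | k b. k \<in> I}"
    then obtain l b where l: "l \<in> I" and z: "z = b \<lhd> lam l" by blast
    show "\<Delta> (z \<lhd> lam k) = \<Delta> z * (lam k \<otimes>\<^sub>M 1)"
      using lam_orth[OF l k] clinear_zero[OF comult_linear] unfolding z *[OF l]
      by (metis act_right_times act_right_zero_multiplier)
  qed
qed

lemma lam_mult_PiL:
  assumes "m \<in> I"
  shows "lam m * PiL E \<epsilon> b = PiL E \<epsilon> (lam m \<rhd> b)"
proof (rule A.multiplier_eq_leftI, rule A.eq_rightI)
  fix c a
  have left: "slice_fst \<epsilon> (\<Delta> a \<rhd> (b \<otimes> c)) = a * (PiL E \<epsilon> b \<rhd> c)" for a b c
    using counit_left[of a b c] by (simp add: slice_fst_act counit_linear PiL_act(1))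
  show "a * ((lam m * PiL E \<epsilon> b) \<rhd> c) = a * (PiL E \<epsilon> (lam m \<rhd> b) \<rhd> c)"
    using left[of "a \<lhd> lam m" b c] left[of a "lam m \<rhd> b" c]
    by (simp add: comult_lam_right assms act_middle)
qed

text \<open>Moving \<open>\<lambda>\<^sub>m\<close> through the comultiplication in the first weak multiplicativity axiom gives
  \<open>\<epsilon>(\<rho>\<^sub>l \<lambda>\<^sub>m x) = \<delta>\<^sub>l\<^sub>m \<epsilon>(\<rho>\<^sub>m x)\<close>, which is the assertion on each \<open>\<rho>\<^sub>l A\<close>.\<close>

lemma counit_lam_eq_rho_left:
  assumes m: "m \<in> I"
  shows "\<epsilon> (lam m \<rhd> b) = \<epsilon> (rho m \<rhd> b)"
proof (rule linear_eq_on_span[where f = "\<lambda>b. \<epsilon> (lam m \<rhd> b)" and g = "\<lambda>b. \<epsilon> (rho m \<rhd> b)", OF _ _ _ span_rho_left])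
  show "clinear (\<lambda>b. \<epsilon> (lam m \<rhd> b))" "clinear (\<lambda>b. \<epsilon> (rho m \<rhd> b))"
    by (intro clinear_compose[OF counit_linear] clinear_act_left)+
  fix b assume "b \<in> {rho k \<rhd> b | k b. k \<in> I}"
  then obtain l x where l: "l \<in> I" and b: "b = rho l \<rhd> x" by blast
  have "\<epsilon> (rho l \<rhd> lam m \<rhd> x) *\<^sub>C lam l = lam l * lam m * PiL E \<epsilon> x"
    by (simp add: lam_PiL'(1)[OF l, symmetric] lam_mult_PiL m mult.assoc)
  also have "\<dots> = (if l = m then \<epsilon> (rho m \<rhd> x) else 0) *\<^sub>C lam l"
    by (simp add: lam_orth l m lam_PiL')
  finally have "\<epsilon> (rho l \<rhd> lam m \<rhd> x) = (if l = m then \<epsilon> (rho m \<rhd> x) else 0)"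
    by (simp only: lam_scale_cancel[OF l])
  moreover have "rho l \<rhd> lam m \<rhd> x = lam m \<rhd> rho l \<rhd> x"
    using lam_rho_commute[OF m l] by (simp flip: act_left_times)
  moreover have "rho m \<rhd> rho l \<rhd> x = (if l = m then rho m \<rhd> x else 0)"
    using rho_orth[OF m l] by (auto simp flip: act_left_times)
  ultimately show "\<epsilon> (lam m \<rhd> b) = \<epsilon> (rho m \<rhd> b)"
    by (simp add: b clinear_zero[OF counit_linear] split: if_splits)
qed

lemma rho_baseR:
  assumes k: "k \<in> I"
  shows "rho k \<in> baseR E \<epsilon>"
proof -
  obtain x where x: "x \<lhd> lam k = x" "\<epsilon> x = 1" using dual_right_exists[OF k] by metis
  have eq: "slice_snd \<epsilon> (from_multiplier ((to_multiplier b \<otimes>\<^sub>M 1) * ((1 \<otimes>\<^sub>M to_multiplier x) * E) * (to_multiplier c \<otimes>\<^sub>M 1)))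
      = b * (rho k \<rhd> c)" for b c
  proof -
    have "(to_multiplier b \<otimes>\<^sub>M 1) * ((1 \<otimes>\<^sub>M to_multiplier x) * E) * (to_multiplier c \<otimes>\<^sub>M 1)
        = to_multiplier (((b \<otimes> (x \<lhd> lam k)) \<lhd> E) \<lhd> (to_multiplier c \<otimes>\<^sub>M 1))"
      by (simp add: x to_multiplier_tensor mtensor_mult multiplier_one flip: AA.mult_to_multiplier mult.assoc)
    also have "\<dots> = to_multiplier ((b * (rho k \<rhd> c)) \<otimes> x)"
      unfolding E_lam_act(2)[OF k] by (simp add: x act_middle)
    finally show ?thesis by (simp add: slice_snd_tensor counit_linear x scaleC_one)
  qed
  have "PiR E \<epsilon> x = rho k"
    unfolding PiR_def mslice_snd_def eq
  proof (rule the_equality)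
    fix n assume "\<forall>b c. b * (n \<rhd> c) = b * (rho k \<rhd> c)"
    then have "n \<rhd> c = rho k \<rhd> c" for c by (intro A.eq_rightI[of "n \<rhd> c" "rho k \<rhd> c"]) blast
    then show "n = rho k" by (rule A.multiplier_eq_leftI)
  qed simp
  then show ?thesis unfolding baseR_def by (metis rangeI)
qed

text \<open>The strict sum exists because the \<open>\<lambda>\<^sub>l\<close> in the second leg are locally finite, and it agrees with
  \<open>E\<close> on each \<open>A \<otimes> \<lambda>\<^sub>k A\<close>.\<close>

lemma E_strict_sum: "has_strict_sum (\<lambda>l. rho l \<otimes>\<^sub>M lam l) I E"
proof -
  note D = has_strict_sumD[OF lam_strict_sum]
  have fin_left: "finite {l \<in> I. (rho l \<otimes>\<^sub>M lam l) \<rhd> t \<noteq> 0}" for t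
  proof (induction t rule: tensor_induct)
    case (pure x z)
    show ?case by (rule finite_subset[OF _ D(1)[of z]]) auto
  next
    case (add s t)
    then show ?case
      by (rule finite_subset[rotated, OF finite_UnI]) (auto simp: act_left_add)
  qed
  have fin_right: "finite {l \<in> I. t \<lhd> (rho l \<otimes>\<^sub>M lam l) \<noteq> 0}" for t
  proof (induction t rule: tensor_induct)
    case (pure x z)
    show ?case by (rule finite_subset[OF _ D(3)[of z]]) auto
  next
    case (add s t)
    then show ?case
      by (rule finite_subset[rotated, OF finite_UnI]) (auto simp: act_right_add)
  qed
  obtain m where m: "has_strict_sum (\<lambda>l. rho l \<otimes>\<^sub>M lam l) I m"
    using strict_sum_exists[OF fin_left fin_right] by blast
  have m_lam: "m * (1 \<otimes>\<^sub>M lam k) = rho k \<otimes>\<^sub>M lam k" if "k \<in> I" for k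
    using has_strict_sum_mult(2)[OF m that, of "1 \<otimes>\<^sub>M lam k"] that
    by (simp add: mtensor_mult lam_orth multiplier_one)
  have "m \<rhd> (x \<otimes> z) = E \<rhd> (x \<otimes> z)" for x z
  proof (rule linear_eq_on_span[OF _ _ _ span_lam_left])
    show "clinear (\<lambda>z. m \<rhd> (x \<otimes> z))" "clinear (\<lambda>z. E \<rhd> (x \<otimes> z))"
      by (intro clinear_compose[OF clinear_act_left] clinear_tensor_right clinear_id)+
    fix z assume "z \<in> {lam k \<rhd> b | k b. k \<in> I}"
    then obtain k b where k: "k \<in> I" and z: "z = lam k \<rhd> b" by blast
    have "m \<rhd> (1 \<otimes>\<^sub>M lam k) \<rhd> (x \<otimes> b) = E \<rhd> (1 \<otimes>\<^sub>M lam k) \<rhd> (x \<otimes> b)"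
      using m_lam[OF k] E_lam(1)[OF k] by (metis act_left_times)
    then show "m \<rhd> (x \<otimes> z) = E \<rhd> (x \<otimes> z)" by (simp add: z)
  qed
  then have "m = E" by (rule A.multiplier_tensor_eq_leftI[OF A.nondegenerate_algebra_axioms])
  then show ?thesis using m by simp
qed

end

section \<open>The partial bialgebra\<close>

lemma tensor_map_ident: "tensor_map (\<lambda>x. x) (\<lambda>x. x) t = t"
  by (induction t rule: tensor_induct) (simp_all add: tensor_map_tensor clinear_id tensor_map_add)

lemma tensor_sandwich: "(a \<otimes> b) * t * (c \<otimes> d) = tensor_map (\<lambda>x. a * x * c) (\<lambda>y. b * y * d) t"
proof (induction t rule: tensor_induct)
  case (pure x y)
  have "clinear (\<lambda>x. a * x * c)" "clinear (\<lambda>y. b * y * d)"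
    by (intro clinear_mult_right clinear_mult_left clinear_id)+
  then show ?case by (simp add: tensor_times_tensor tensor_map_tensor)
qed (simp add: distrib_left distrib_right tensor_map_add)

lemma slice_fst_sandwich:
  assumes "clinear f"
  shows "slice_fst f ((a \<otimes> b) * t * (c \<otimes> d)) = b * slice_fst (\<lambda>x. f (a * x * c)) t * d"
proof (induction t rule: tensor_induct)
  case (pure x y)
  have "clinear (\<lambda>x. f (a * x * c))"
    by (intro clinear_compose[OF assms] clinear_mult_right clinear_mult_left clinear_id)
  then show ?case
    by (simp add: tensor_times_tensor slice_fst_tensor assms mult_scaleC_left mult_scaleC_right)
qed (simp add: distrib_left distrib_right slice_fst_add)

lemma slice_snd_sandwich:
  assumes "clinear f"
  shows "slice_snd f ((a \<otimes> b) * t * (c \<otimes> d)) = a * slice_snd (\<lambda>x. f (b * x * d)) t * c"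
proof (induction t rule: tensor_induct)
  case (pure x y)
  have "clinear (\<lambda>x. f (b * x * d))"
    by (intro clinear_compose[OF assms] clinear_mult_right clinear_mult_left clinear_id)
  then show ?case
    by (simp add: tensor_times_tensor slice_snd_tensor assms mult_scaleC_left mult_scaleC_right)
qed (simp add: distrib_left distrib_right slice_snd_add)

lemma has_strict_sum_mult_const:
  assumes "has_strict_sum f S 1"
  shows "has_strict_sum (\<lambda>i. g * f i) S g" "has_strict_sum (\<lambda>i. f i * g) S g"
proof -
  note D = has_strict_sumD[OF assms]
  have one: "b = (\<Sum>i\<in>{i \<in> S. f i \<rhd> b \<noteq> 0}. f i \<rhd> b)" "b = (\<Sum>i\<in>{i \<in> S. b \<lhd> f i \<noteq> 0}. b \<lhd> f i)" for b
    using D(2)[of b] D(4)[of b] by simp_all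
  show "has_strict_sum (\<lambda>i. g * f i) S g"
  proof (rule has_strict_sumI)
    fix b
    show "\<exists>F. finite F \<and> F \<subseteq> S \<and> (\<forall>i\<in>S - F. (g * f i) \<rhd> b = 0) \<and> g \<rhd> b = (\<Sum>i\<in>F. (g * f i) \<rhd> b)"
      using D(1)[of b] arg_cong[OF one(1)[of b], of "\<lambda>x. g \<rhd> x"]
      by (intro exI[of _ "{i \<in> S. f i \<rhd> b \<noteq> 0}"]) (auto simp: act_left_sum)
    show "\<exists>F. finite F \<and> F \<subseteq> S \<and> (\<forall>i\<in>S - F. b \<lhd> (g * f i) = 0) \<and> b \<lhd> g = (\<Sum>i\<in>F. b \<lhd> (g * f i))"
      using D(3)[of "b \<lhd> g"] one(2)[of "b \<lhd> g"]
      by (intro exI[of _ "{i \<in> S. b \<lhd> g \<lhd> f i \<noteq> 0}"]) auto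
  qed
  show "has_strict_sum (\<lambda>i. f i * g) S g"
  proof (rule has_strict_sumI)
    fix b
    show "\<exists>F. finite F \<and> F \<subseteq> S \<and> (\<forall>i\<in>S - F. (f i * g) \<rhd> b = 0) \<and> g \<rhd> b = (\<Sum>i\<in>F. (f i * g) \<rhd> b)"
      using D(1)[of "g \<rhd> b"] one(1)[of "g \<rhd> b"]
      by (intro exI[of _ "{i \<in> S. f i \<rhd> g \<rhd> b \<noteq> 0}"]) auto
    show "\<exists>F. finite F \<and> F \<subseteq> S \<and> (\<forall>i\<in>S - F. b \<lhd> (f i * g) = 0) \<and> b \<lhd> g = (\<Sum>i\<in>F. b \<lhd> (f i * g))"
      using D(3)[of b] arg_cong[OF one(2)[of b], of "\<lambda>x. x \<lhd> g"]
      by (intro exI[of _ "{i \<in> S. b \<lhd> f i \<noteq> 0}"]) (auto simp: act_right_sum)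
  qed
qed

lemma has_strict_sum_cong:
  assumes "has_strict_sum f S m" "\<And>i. i \<in> S \<Longrightarrow> f i = g i"
  shows "has_strict_sum g S m"
proof -
  have "{i \<in> S. g i \<rhd> b \<noteq> 0} = {i \<in> S. f i \<rhd> b \<noteq> 0}" "{i \<in> S. b \<lhd> g i \<noteq> 0} = {i \<in> S. b \<lhd> f i \<noteq> 0}" for b
    using assms(2) by auto
  then show ?thesis
    using assms unfolding has_strict_sum_def by simp
qed

locale unital_function_base = function_base \<Delta> E \<epsilon> I \<phi>
  for \<Delta> :: "'a::complex_algebra \<Rightarrow> ('a, 'a) tensor multiplier"
    and E :: "('a, 'a) tensor multiplier"
    and \<epsilon> :: "'a \<Rightarrow> complex"
    and I :: "'i set" and \<phi> :: "('i \<Rightarrow> complex) \<Rightarrow> 'a multiplier" +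
  assumes base_product: "\<forall>x\<in>baseL E \<epsilon>. \<forall>y\<in>baseR E \<epsilon>. x * y \<in> range to_multiplier"
begin

text \<open>The unit \<open>1\<^sup>k\<^sub>m\<close>.\<close>

definition u :: "'i \<Rightarrow> 'i \<Rightarrow> 'a" where
  "u k m = from_multiplier (lam k * rho m)"

lemma to_multiplier_u:
  assumes "k \<in> I" "m \<in> I"
  shows "to_multiplier (u k m) = lam k * rho m"
proof -
  have "lam k \<in> baseL E \<epsilon>" using lam_baseL[OF assms(1)] unfolding baseL_def by (metis rangeI)
  then have "lam k * rho m \<in> range to_multiplier"
    using base_product rho_baseR[OF assms(2)] by blast
  then show ?thesis unfolding u_def by (rule A.to_from_multiplier)
qed

lemma u_mult_left: "k \<in> I \<Longrightarrow> m \<in> I \<Longrightarrow> u k m * a = lam k \<rhd> rho m \<rhd> a"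
  and u_mult_right: "k \<in> I \<Longrightarrow> m \<in> I \<Longrightarrow> a * u k m = a \<lhd> lam k \<lhd> rho m"
  using arg_cong[OF to_multiplier_u, of k m "\<lambda>M. M \<rhd> a"] arg_cong[OF to_multiplier_u, of k m "\<lambda>M. a \<lhd> M"]
  by simp_all

lemma lam_u: "k \<in> I \<Longrightarrow> l \<in> I \<Longrightarrow> m \<in> I \<Longrightarrow> lam k \<rhd> u l m = (if k = l then u l m else 0)"
  and u_lam: "k \<in> I \<Longrightarrow> l \<in> I \<Longrightarrow> m \<in> I \<Longrightarrow> u l m \<lhd> lam k = (if k = l then u l m else 0)"
  and rho_u: "k \<in> I \<Longrightarrow> l \<in> I \<Longrightarrow> m \<in> I \<Longrightarrow> rho k \<rhd> u l m = (if k = m then u l m else 0)"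
  and u_rho: "k \<in> I \<Longrightarrow> l \<in> I \<Longrightarrow> m \<in> I \<Longrightarrow> u l m \<lhd> rho k = (if k = m then u l m else 0)"
proof -
  assume I: "k \<in> I" "l \<in> I" "m \<in> I"
  have zero: "to_multiplier 0 = (0 :: 'a multiplier)"
    by (rule clinear_zero[OF clinear_to_multiplier])
  have 1: "lam k * (lam l * rho m) = (if k = l then lam l * rho m else 0)"
    using lam_orth[OF I(1,2)] by (simp flip: mult.assoc)
  have "lam l * rho m * lam k = lam l * (lam k * rho m)"
    using lam_rho_commute[OF I(1,3)] by (simp add: mult.assoc)
  also have "\<dots> = (if k = l then lam l * rho m else 0)"
    using lam_orth[OF I(2,1)] by (simp flip: mult.assoc)
  finally have 2: "lam l * rho m * lam k = (if k = l then lam l * rho m else 0)" .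
  have "rho k * (lam l * rho m) = lam l * (rho k * rho m)"
    using lam_rho_commute[OF I(2,1)] by (simp flip: mult.assoc)
  also have "\<dots> = (if k = m then lam l * rho m else 0)"
    using rho_orth[OF I(1,3)] by simp
  finally have 3: "rho k * (lam l * rho m) = (if k = m then lam l * rho m else 0)" .
  have 4: "lam l * rho m * rho k = (if k = m then lam l * rho m else 0)"
    using rho_orth[OF I(3,1)] by (simp add: mult.assoc)
  show "lam k \<rhd> u l m = (if k = l then u l m else 0)" "u l m \<lhd> lam k = (if k = l then u l m else 0)"
    "rho k \<rhd> u l m = (if k = m then u l m else 0)" "u l m \<lhd> rho k = (if k = m then u l m else 0)"
    using 1 2 3 4 I by (simp_all add: zero to_multiplier_u split: if_splits
        flip: A.to_multiplier_inject A.mult_to_multiplier)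
qed

lemma u_u:
  assumes "k \<in> I" "m \<in> I" "l \<in> I" "n \<in> I"
  shows "u k m * u l n = (if k = l \<and> m = n then u k m else 0)"
  using assms by (simp add: u_mult_left rho_u lam_u)

text \<open>The component \<open>A\<^sup>k\<^sup>l\<^sub>m\<^sub>n\<close>, a corner of \<open>A\<close>.\<close>

definition block :: "'i \<Rightarrow> 'i \<Rightarrow> 'i \<Rightarrow> 'i \<Rightarrow> 'a set" where
  "block k l m n = {a. u k m * a = a \<and> a * u l n = a}"

lemma block_act:
  assumes "k \<in> I" "l \<in> I" "m \<in> I" "n \<in> I" "a \<in> block k l m n"
  shows "lam k \<rhd> a = a" "rho m \<rhd> a = a" "a \<lhd> lam l = a" "a \<lhd> rho n = a"
proof -
  have a: "u k m * a = a" "a * u l n = a" using assms(5) by (auto simp: block_def)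
  have "lam k \<rhd> (u k m * a) = u k m * a" "rho m \<rhd> (u k m * a) = u k m * a"
    "(a * u l n) \<lhd> lam l = a * u l n" "(a * u l n) \<lhd> rho n = a * u l n"
    using assms by (simp_all add: lam_u rho_u u_lam u_rho flip: A.act_left_mult A.act_right_mult)
  then show "lam k \<rhd> a = a" "rho m \<rhd> a = a" "a \<lhd> lam l = a" "a \<lhd> rho n = a"
    unfolding a .
qed

lemma u_sandwich_block:
  assumes "k \<in> I" "l \<in> I" "m \<in> I" "n \<in> I"
  shows "u k m * a * u l n \<in> block k l m n"
  unfolding block_def using assms by (auto simp: u_u mult.assoc simp flip: mult.assoc[of "u k m" "u k m"])

lemma comult_u_left: "k \<in> I \<Longrightarrow> m \<in> I \<Longrightarrow> \<Delta> (u k m * a) = (lam k \<otimes>\<^sub>M rho m) * \<Delta> a"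
  and comult_u_right: "k \<in> I \<Longrightarrow> m \<in> I \<Longrightarrow> \<Delta> (a * u k m) = \<Delta> a * (lam k \<otimes>\<^sub>M rho m)"
  by (simp_all add: u_mult_left u_mult_right comult_lam_left comult_rho_left comult_lam_right
      comult_rho_right mtensor_mult multiplier_one flip: mult.assoc)
    (simp add: mtensor_mult multiplier_one mult.assoc)

lemma comult_block:
  assumes "k \<in> I" "l \<in> I" "m \<in> I" "n \<in> I" "a \<in> block k l m n"
  shows "(lam k \<otimes>\<^sub>M rho m) * \<Delta> a = \<Delta> a" "\<Delta> a * (lam l \<otimes>\<^sub>M rho n) = \<Delta> a"
  using assms comult_u_left[of k m a] comult_u_right[of l n a] by (auto simp: block_def)

text \<open>Both sides agree after multiplication by any \<open>\<Delta>(b)\<close> from the left, and both absorb \<open>E\<close> there.\<close>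

lemma comult_u:
  assumes "k \<in> I" "m \<in> I"
  shows "\<Delta> (u k m) = E * (lam k \<otimes>\<^sub>M rho m)"
proof (rule AA.multiplier_eq_leftI)
  fix t
  have "\<Delta> b \<rhd> (\<Delta> (u k m) \<rhd> t) = \<Delta> b \<rhd> ((lam k \<otimes>\<^sub>M rho m) \<rhd> t)" for b
    using comult_u_right[OF assms, of b] comult_mult[of b "u k m"] by (simp flip: act_left_times)
  from D.cancel_left[OF this] show "\<Delta> (u k m) \<rhd> t = (E * (lam k \<otimes>\<^sub>M rho m)) \<rhd> t" by simp
qed

lemma E_rho: "k \<in> I \<Longrightarrow> (rho k \<otimes>\<^sub>M 1) * E = rho k \<otimes>\<^sub>M lam k" "k \<in> I \<Longrightarrow> E * (rho k \<otimes>\<^sub>M 1) = rho k \<otimes>\<^sub>M lam k"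
  using has_strict_sum_mult(1)[OF E_strict_sum, of k "rho k \<otimes>\<^sub>M 1"]
    has_strict_sum_mult(2)[OF E_strict_sum, of k "rho k \<otimes>\<^sub>M 1"]
  by (simp_all add: mtensor_mult rho_orth multiplier_one)

text \<open>\<open>E\<close> can be inserted next to \<open>\<Delta>(a)\<close>, and there \<open>1 \<otimes> \<lambda>\<^sub>k\<close> and \<open>\<rho>\<^sub>k \<otimes> 1\<close> both become \<open>\<rho>\<^sub>k \<otimes> \<lambda>\<^sub>k\<close>.  This is why the
  two descriptions of \<open>\<Delta>\<^sub>r\<^sub>s\<close> in the total algebra agree.\<close>

lemma comult_leg:
  assumes "k \<in> I"
  shows "(1 \<otimes>\<^sub>M lam k) * \<Delta> a = (rho k \<otimes>\<^sub>M lam k) * \<Delta> a" "\<Delta> a * (1 \<otimes>\<^sub>M lam k) = \<Delta> a * (rho k \<otimes>\<^sub>M lam k)"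
    "(rho k \<otimes>\<^sub>M 1) * \<Delta> a = (rho k \<otimes>\<^sub>M lam k) * \<Delta> a" "\<Delta> a * (rho k \<otimes>\<^sub>M 1) = \<Delta> a * (rho k \<otimes>\<^sub>M lam k)"
proof -
  have 1: "M * \<Delta> a = (M * E) * \<Delta> a" for M by (simp add: mult.assoc D.e_mult)
  have 2: "\<Delta> a * M = \<Delta> a * (E * M)" for M by (simp add: D.mult_e flip: mult.assoc)
  show "(1 \<otimes>\<^sub>M lam k) * \<Delta> a = (rho k \<otimes>\<^sub>M lam k) * \<Delta> a" "(rho k \<otimes>\<^sub>M 1) * \<Delta> a = (rho k \<otimes>\<^sub>M lam k) * \<Delta> a"
    by (subst 1, simp only: E_lam E_rho assms)+
  show "\<Delta> a * (1 \<otimes>\<^sub>M lam k) = \<Delta> a * (rho k \<otimes>\<^sub>M lam k)" "\<Delta> a * (rho k \<otimes>\<^sub>M 1) = \<Delta> a * (rho k \<otimes>\<^sub>M lam k)"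
    by (subst 2, simp only: E_lam E_rho assms)+
qed

text \<open>The map \<open>\<Delta>\<^sub>r\<^sub>s\<close> on \<open>A\<^sup>k\<^sup>l\<^sub>m\<^sub>n\<close>.  Cutting with units that lie in \<open>A\<close>, and not only with \<open>\<lambda>\<^sub>r\<close> and \<open>\<lambda>\<^sub>s\<close>, makes the value
  an element of \<open>A \<otimes> A\<close> for every \<open>a\<close>, so that the map is linear on all of \<open>A\<close>.\<close>

definition block_comult :: "'i \<Rightarrow> 'i \<Rightarrow> 'i \<Rightarrow> 'i \<Rightarrow> 'i \<Rightarrow> 'i \<Rightarrow> 'a \<Rightarrow> ('a, 'a) tensor" where
  "block_comult r s k l m n a = (u k r \<otimes> u r m) * (\<Delta> a \<rhd> (u l s \<otimes> u s n))"

lemma to_multiplier_uu: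
  assumes "k \<in> I" "r \<in> I" "m \<in> I"
  shows "to_multiplier (u k r \<otimes> u r m) = (rho r \<otimes>\<^sub>M lam r) * (lam k \<otimes>\<^sub>M rho m)"
    "to_multiplier (u k r \<otimes> u r m) = (lam k \<otimes>\<^sub>M rho m) * (rho r \<otimes>\<^sub>M lam r)"
  using assms by (simp_all add: to_multiplier_tensor to_multiplier_u mtensor_mult lam_rho_commute)

lemma to_multiplier_block_comult_def:
  "to_multiplier (block_comult r s k l m n a) = to_multiplier (u k r \<otimes> u r m) * \<Delta> a * to_multiplier (u l s \<otimes> u s n)"
  by (simp add: block_comult_def to_multiplier_mult mult.assoc flip: AA.mult_to_multiplier)

lemma to_multiplier_block_comult:
  assumes "r \<in> I" "s \<in> I" "k \<in> I" "l \<in> I" "m \<in> I" "n \<in> I" "a \<in> block k l m n"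
  shows "to_multiplier (block_comult r s k l m n a) = (rho r \<otimes>\<^sub>M lam r) * \<Delta> a * (rho s \<otimes>\<^sub>M lam s)"
proof -
  have "to_multiplier (block_comult r s k l m n a)
      = (rho r \<otimes>\<^sub>M lam r) * (((lam k \<otimes>\<^sub>M rho m) * \<Delta> a) * (lam l \<otimes>\<^sub>M rho n)) * (rho s \<otimes>\<^sub>M lam s)"
    unfolding to_multiplier_block_comult_def to_multiplier_uu(1)[OF assms(3,1,5)] to_multiplier_uu(2)[OF assms(4,2,6)]
    by (simp only: mult.assoc)
  then show ?thesis by (simp only: comult_block[OF assms(3-7)])
qed

lemma clinear_block_comult: "clinear (block_comult r s k l m n)"
  unfolding block_comult_def by (intro clinear_mult_left clinear_eval_left comult_linear)

lemma block_comult_D1: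
  assumes "k \<in> I" "r \<in> I" "m \<in> I" "l \<in> I" "s \<in> I" "n \<in> I"
  shows "block_comult r s k l m n a = (u k r \<otimes> u r m) * D1 a (u s n) * (u l s \<otimes> u s n)"
proof -
  have "to_multiplier (u l s \<otimes> u s n) = (1 \<otimes>\<^sub>M to_multiplier (u s n)) * to_multiplier (u l s \<otimes> u s n)"
    using assms by (simp add: to_multiplier_tensor mtensor_mult multiplier_one u_u flip: to_multiplier_mult)
  then show ?thesis
    by (simp add: to_multiplier_block_comult_def to_multiplier_D1 to_multiplier_mult mult.assoc flip: AA.to_multiplier_inject)
qed

lemma block_comult_D2:
  assumes "k \<in> I" "r \<in> I" "m \<in> I" "l \<in> I" "s \<in> I" "n \<in> I"
  shows "block_comult r s k l m n a = (u k r \<otimes> u r m) * D2 (u k r) a * (u l s \<otimes> u s n)"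
proof -
  have "to_multiplier (u k r \<otimes> u r m) = to_multiplier (u k r \<otimes> u r m) * (to_multiplier (u k r) \<otimes>\<^sub>M 1)"
    using assms by (simp add: to_multiplier_tensor mtensor_mult multiplier_one u_u flip: to_multiplier_mult)
  then show ?thesis
    by (simp add: to_multiplier_block_comult_def to_multiplier_D2 to_multiplier_mult flip: AA.to_multiplier_inject mult.assoc)
qed

lemma block_comult_sandwich:
  assumes "k \<in> I" "r \<in> I" "m \<in> I" "l \<in> I" "s \<in> I" "n \<in> I"
  shows "block_comult r s k l m n (u k m * a * u l n) = block_comult r s k l m n a"
proof -
  have "to_multiplier (u k r \<otimes> u r m) * (lam k \<otimes>\<^sub>M rho m) = to_multiplier (u k r \<otimes> u r m)"
    "(lam l \<otimes>\<^sub>M rho n) * to_multiplier (u l s \<otimes> u s n) = to_multiplier (u l s \<otimes> u s n)"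
    using assms by (simp_all add: AA.mult_to_multiplier u_lam u_rho lam_u rho_u)
  then show ?thesis
    using assms by (simp add: to_multiplier_block_comult_def comult_u_left comult_u_right
        flip: AA.to_multiplier_inject mult.assoc) (simp add: mult.assoc)
qed

text \<open>As \<open>1\<^sup>k\<^sub>k = \<lambda>\<^sub>k \<rho>\<^sub>k\<close> and \<open>\<lambda>\<^sub>k\<close> and \<open>\<rho>\<^sub>k\<close> have the same effect next to the counit, one of them suffices.\<close>

lemma counit_u:
  assumes "k \<in> I" "l \<in> I"
  shows "\<epsilon> (u k k * x * u l l) = \<epsilon> ((lam k \<rhd> x) \<lhd> lam l)" "\<epsilon> (u k k * x * u l l) = \<epsilon> ((rho k \<rhd> x) \<lhd> rho l)"
proof -
  have left: "\<epsilon> (u k k * y) = \<epsilon> (lam k \<rhd> y)" for y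
  proof -
    have "\<epsilon> (u k k * y) = \<epsilon> ((rho k * rho k) \<rhd> y)"
      by (simp add: u_mult_left assms counit_lam_eq_rho_left)
    then show ?thesis by (simp add: rho_idem counit_lam_eq_rho_left assms del: act_left_times)
  qed
  have right: "\<epsilon> (y * u l l) = \<epsilon> (y \<lhd> lam l)" for y
  proof -
    have "\<epsilon> (y * u l l) = \<epsilon> (y \<lhd> (lam l * lam l))"
      by (simp add: u_mult_right assms flip: counit_lam_eq_rho_right)
    then show ?thesis by (simp add: lam_orth assms del: act_right_times)
  qed
  show "\<epsilon> (u k k * x * u l l) = \<epsilon> ((lam k \<rhd> x) \<lhd> lam l)"
    using left[of "x * u l l"] right[of "lam k \<rhd> x"] by (simp add: mult.assoc A.act_left_mult)
  also have "\<dots> = \<epsilon> (lam k \<rhd> (x \<lhd> rho l))"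
    by (subst counit_lam_eq_rho_right[OF assms(2)]) (simp only: A.act_left_right)
  also have "\<dots> = \<epsilon> ((rho k \<rhd> x) \<lhd> rho l)"
    by (subst counit_lam_eq_rho_left[OF assms(1)]) (simp only: A.act_left_right)
  finally show "\<epsilon> (u k k * x * u l l) = \<epsilon> ((rho k \<rhd> x) \<lhd> rho l)" .
qed

definition pb :: "('i, 'a) partial_bialgebra_data" where
  "pb = \<lparr>component = block, pmul = (\<lambda>k l p m n q. (*)), punit = u, pcomul = block_comult, pcounit = (\<lambda>k l. \<epsilon>)\<rparr>"

lemma pb_simps [simp]:
  "component pb = block" "pmul pb k l p m n q = (*)" "punit pb = u" "pcomul pb = block_comult" "pcounit pb k l = \<epsilon>"
  by (simp_all add: pb_def)

lemma block_subspace: "cvec.subspace (block k l m n)"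
  by (simp add: cvec.subspace_def block_def distrib_left distrib_right mult_scaleC_left mult_scaleC_right)

lemma block_mult: "a \<in> block k l m n \<Longrightarrow> b \<in> block l p n q \<Longrightarrow> a * b \<in> block k p m q"
  by (simp add: block_def mult.assoc flip: mult.assoc[of "u k m" a])

lemma block_comult_in:
  assumes "k \<in> I" "r \<in> I" "m \<in> I" "l \<in> I" "s \<in> I" "n \<in> I"
  shows "block_comult r s k l m n a \<in> tensor_subspace (block k l r s) (block r s m n)"
proof -
  have "block_comult r s k l m n a = tensor_map (\<lambda>x. u k r * x * u l s) (\<lambda>y. u r m * y * u s n) (D1 a (u s n))"
    using assms by (simp add: block_comult_D1 tensor_sandwich)
  then show ?thesis
    using assms by (simp only:) (intro tensor_map_in_subspace u_sandwich_block clinear_mult_right clinear_mult_left clinear_id)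
qed

text \<open>Evaluate the coassociativity axiom at \<open>1\<^sup>k\<^sub>p \<otimes> a \<otimes> 1\<^sup>s\<^sub>n\<close> and cut out the blocks: each side of the axiom
  turns into a composite of two maps \<open>\<Delta>\<^sub>r\<^sub>s\<close>, because these only see the corner of their argument.\<close>

lemma block_comult_coassoc:
  assumes "p \<in> I" "q \<in> I" "r \<in> I" "s \<in> I" "k \<in> I" "l \<in> I" "m \<in> I" "n \<in> I"
  shows "tensor_assoc (tensor_map (block_comult p q k l r s) id (block_comult r s k l m n a))
    = tensor_map id (block_comult r s p q m n) (block_comult p q k l m n a)"
proof -
  let ?x = "u k p" and ?y = "u s n"
  let ?P = "u k p \<otimes> (u p r \<otimes> u r m)" and ?Q = "u l q \<otimes> (u q s \<otimes> u s n)"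
  have lin: "clinear (T2 \<Delta>)" "clinear (T1 \<Delta>)"
    unfolding T1_def T2_def by (rule clinear_tensor_lift)+
  have t2: "tensor_map (T2 \<Delta>) id (tensor_assoc_inv (?x \<otimes> t)) = tensor_map (D2 ?x) id t" for t
    by (induction t rule: tensor_induct)
      (simp_all add: tensor_assoc_inv_tensor tensor_map_tensor lin clinear_ident clinear_id T2_tensor
        cbilinear_right[OF cbilinear_D2] tensor_add_right tensor_assoc_inv_add tensor_map_add)
  have t1: "tensor_map id (T1 \<Delta>) (tensor_assoc (t \<otimes> ?y)) = tensor_map id (\<lambda>c. D1 c ?y) t" for t
    by (induction t rule: tensor_induct)
      (simp_all add: tensor_assoc_tensor tensor_map_tensor lin clinear_ident clinear_id T1_tensor
        cbilinear_left[OF cbilinear_D1] tensor_add_left tensor_assoc_add tensor_map_add)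
  have "tensor_map (T2 \<Delta>) id (tensor_assoc_inv (?x \<otimes> D1 a ?y))
      = tensor_assoc_inv (tensor_map id (T1 \<Delta>) (tensor_assoc (D2 ?x a \<otimes> ?y)))"
    using fun_cong[OF coassoc, of "(?x \<otimes> a) \<otimes> ?y"]
    by (simp add: tensor_assoc_tensor tensor_map_tensor lin clinear_ident clinear_id T1_tensor T2_tensor)
  then have main: "tensor_assoc (tensor_map (D2 ?x) id (D1 a ?y)) = tensor_map id (\<lambda>c. D1 c ?y) (D2 ?x a)"
    unfolding t1 t2 by (simp add: tensor_assoc_inverse)
  have left: "?P * tensor_assoc (tensor_map (D2 ?x) id t) * ?Q
      = tensor_assoc (tensor_map (block_comult p q k l r s) id ((u k r \<otimes> u r m) * t * (u l s \<otimes> u s n)))" for t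
  proof (induction t rule: tensor_induct)
    case (pure b c)
    have "?P * tensor_assoc (D2 ?x b \<otimes> c) * ?Q
        = tensor_assoc (((u k p \<otimes> u p r) * D2 ?x b * (u l q \<otimes> u q s)) \<otimes> (u r m * c * u s n))"
      by (simp add: tensor_times_tensor flip: tensor_assoc_tensor tensor_assoc_mult)
    also have "(u k p \<otimes> u p r) * D2 ?x b * (u l q \<otimes> u q s) = block_comult p q k l r s (u k r * b * u l s)"
      by (rule trans[OF block_comult_D2[OF assms(5,1,3,6,2,4), symmetric] block_comult_sandwich[OF assms(5,1,3,6,2,4), symmetric]])
    finally show ?case
      by (simp add: tensor_map_tensor cbilinear_right[OF cbilinear_D2] clinear_ident clinear_id clinear_block_comult tensor_times_tensor)
  qed (simp add: tensor_map_add tensor_assoc_add distrib_left distrib_right)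
  have right: "?P * tensor_map id (\<lambda>c. D1 c ?y) t * ?Q
      = tensor_map id (block_comult r s p q m n) ((u k p \<otimes> u p m) * t * (u l q \<otimes> u q n))" for t
  proof (induction t rule: tensor_induct)
    case (pure b c)
    have "(u p r \<otimes> u r m) * D1 c ?y * (u q s \<otimes> u s n) = block_comult r s p q m n (u p m * c * u q n)"
      by (rule trans[OF block_comult_D1[OF assms(1,3,7,2,4,8), symmetric] block_comult_sandwich[OF assms(1,3,7,2,4,8), symmetric]])
    then show ?case
      by (simp add: tensor_map_tensor cbilinear_left[OF cbilinear_D1] clinear_ident clinear_id clinear_block_comult tensor_times_tensor)
  qed (simp add: tensor_map_add distrib_left distrib_right)
  show ?thesis
    using arg_cong[OF main, of "\<lambda>t. ?P * t * ?Q"] assms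
    unfolding left right by (simp add: block_comult_D1[of k r m l s n a] block_comult_D2[of k p m l q n a])
qed

lemma block_comult_counit_left:
  assumes "k \<in> I" "l \<in> I" "m \<in> I" "n \<in> I" "a \<in> block k l m n"
  shows "slice_fst \<epsilon> (block_comult k l k l m n a) = a"
proof -
  have "slice_fst \<epsilon> (block_comult k l k l m n a) = u k m * slice_fst (\<lambda>x. \<epsilon> (u k k * x * u l l)) (D1 a (u l n)) * u l n"
    using assms by (simp add: block_comult_D1 slice_fst_sandwich counit_linear)
  also have "(\<lambda>x. \<epsilon> (u k k * x * u l l)) = (\<lambda>x. \<epsilon> ((lam k \<rhd> x) \<lhd> lam l))"
    using assms by (simp add: counit_u(1))
  also have "slice_fst (\<lambda>x. \<epsilon> ((lam k \<rhd> x) \<lhd> lam l)) (D1 a (u l n))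
      = slice_fst \<epsilon> (((lam k \<otimes>\<^sub>M 1) \<rhd> D1 a (u l n)) \<lhd> (lam l \<otimes>\<^sub>M 1))"
    using slice_fst_act(4)[OF counit_linear, of "(lam k \<otimes>\<^sub>M 1) \<rhd> D1 a (u l n)" "lam l"]
      slice_fst_act(3)[OF clinear_compose[OF counit_linear clinear_act_right], of "lam l" "lam k" "D1 a (u l n)"]
    by (simp add: AA.act_left_right)
  also have "((lam k \<otimes>\<^sub>M 1) \<rhd> D1 a (u l n)) \<lhd> (lam l \<otimes>\<^sub>M 1) = D1 ((lam k \<rhd> a) \<lhd> lam l) (u l n)"
    using assms by (simp add: to_multiplier_D1 comult_lam_left comult_lam_right mult.assoc mtensor_mult multiplier_one
        flip: AA.to_multiplier_inject AA.mult_to_multiplier)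
  also have "(lam k \<rhd> a) \<lhd> lam l = a" using block_act[OF assms] by simp
  finally show ?thesis using assms(5) by (simp add: counit_D1 block_def)
qed

lemma block_comult_counit_right:
  assumes "k \<in> I" "l \<in> I" "m \<in> I" "n \<in> I" "a \<in> block k l m n"
  shows "slice_snd \<epsilon> (block_comult m n k l m n a) = a"
proof -
  have "slice_snd \<epsilon> (block_comult m n k l m n a) = u k m * slice_snd (\<lambda>x. \<epsilon> (u m m * x * u n n)) (D2 (u k m) a) * u l n"
    using assms by (simp add: block_comult_D2 slice_snd_sandwich counit_linear)
  also have "(\<lambda>x. \<epsilon> (u m m * x * u n n)) = (\<lambda>x. \<epsilon> ((rho m \<rhd> x) \<lhd> rho n))"
    using assms by (simp add: counit_u(2))
  also have "slice_snd (\<lambda>x. \<epsilon> ((rho m \<rhd> x) \<lhd> rho n)) (D2 (u k m) a)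
      = slice_snd \<epsilon> (((1 \<otimes>\<^sub>M rho m) \<rhd> D2 (u k m) a) \<lhd> (1 \<otimes>\<^sub>M rho n))"
    using slice_snd_act(4)[OF counit_linear, of "(1 \<otimes>\<^sub>M rho m) \<rhd> D2 (u k m) a" "rho n"]
      slice_snd_act(3)[OF clinear_compose[OF counit_linear clinear_act_right], of "rho n" "rho m" "D2 (u k m) a"]
    by (simp add: AA.act_left_right)
  also have "((1 \<otimes>\<^sub>M rho m) \<rhd> D2 (u k m) a) \<lhd> (1 \<otimes>\<^sub>M rho n) = D2 (u k m) ((rho m \<rhd> a) \<lhd> rho n)"
    using assms by (simp add: to_multiplier_D2 comult_rho_left comult_rho_right mtensor_mult multiplier_one
        flip: AA.to_multiplier_inject AA.mult_to_multiplier mult.assoc)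
  also have "(rho m \<rhd> a) \<lhd> rho n = a" using block_act[OF assms] by simp
  finally show ?thesis using assms(5) by (simp add: counit_D2 block_def)
qed

lemma block_comult_unit:
  assumes "k \<in> I" "m \<in> I" "l \<in> I" "l' \<in> I"
  shows "block_comult l l' k k m m (u k m) = (if l = l' then u k l \<otimes> u l m else 0)"
proof -
  have "\<Delta> (u k m) \<rhd> (u k l' \<otimes> u l' m) = E \<rhd> (u k l' \<otimes> u l' m)"
    using assms by (simp add: comult_u lam_u rho_u)
  also have "\<dots> = E \<rhd> (u k l' \<otimes> (lam l' \<rhd> u l' m))"
    using assms by (simp add: lam_u)
  also have "\<dots> = u k l' \<otimes> u l' m"
    unfolding E_lam_act(1)[OF assms(4)] using assms by (simp add: lam_u rho_u)
  finally show ?thesis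
    using assms by (simp add: block_comult_def tensor_times_tensor u_u)
qed

lemma counit_block:
  assumes "k \<in> I" "l \<in> I" "m \<in> I" "n \<in> I" "a \<in> block k l m n"
  shows "counit_ext pb k l m n a = \<epsilon> a"
proof -
  note act = block_act[OF assms]
  have "\<epsilon> a = 0" if "k \<noteq> m"
  proof -
    have "\<epsilon> a = \<epsilon> (rho k \<rhd> rho m \<rhd> a)"
      using counit_lam_eq_rho_left[OF assms(1), of a] act by simp
    also have "rho k \<rhd> rho m \<rhd> a = (rho k * rho m) \<rhd> a" by simp
    finally show ?thesis
      unfolding rho_orth[OF assms(1,3)] using that by (simp add: clinear_zero[OF counit_linear])
  qed
  moreover have "\<epsilon> a = 0" if "l \<noteq> n"
  proof -
    have "\<epsilon> a = \<epsilon> (a \<lhd> rho n \<lhd> rho l)"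
      using counit_lam_eq_rho_right[OF assms(2), of a] act by simp
    also have "a \<lhd> rho n \<lhd> rho l = a \<lhd> (rho n * rho l)" by simp
    finally show ?thesis
      unfolding rho_orth[OF assms(4,2)] using that by (simp add: clinear_zero[OF counit_linear])
  qed
  ultimately show ?thesis by (auto simp: counit_ext_def)
qed

lemma counit_mult:
  assumes "k \<in> I" "l \<in> I" "m \<in> I" "n \<in> I" "p \<in> I" "q \<in> I" "a \<in> block k l m n" "b \<in> block l p n q"
  shows "\<epsilon> (a * b) = \<epsilon> a * \<epsilon> b"
  using counit_lam_mult[OF assms(2), of a b] block_act[OF assms(1-4,7)] block_act[OF assms(2,5,4,6,8)]
    counit_lam_eq_rho_left[OF assms(2), of b] by simp

text \<open>The counit is multiplicative on composable blocks and does not vanish on \<open>\<rho>\<^sub>k A\<close>, so its value at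
  the unit is \<open>1\<close>.\<close>

lemma counit_unit_u:
  assumes k: "k \<in> I"
  shows "\<epsilon> (u k k) = 1"
proof -
  obtain a where a: "\<epsilon> (rho k \<rhd> a) = 1"
    using dual_left_exists[OF k] k by metis
  have "\<epsilon> (rho k \<rhd> a) = \<epsilon> (u k k * a)"
    using counit_lam_eq_rho_left[OF k, of "rho k \<rhd> a"] rho_idem[OF k]
    by (simp add: u_mult_left k flip: act_left_times)
  also have "\<dots> = \<epsilon> ((u k k \<lhd> lam k) * a)" using k by (simp add: u_lam)
  also have "\<dots> = \<epsilon> (u k k \<lhd> lam k) * \<epsilon> (rho k \<rhd> a)" by (rule counit_lam_mult[OF k])
  finally show ?thesis using a k by (simp add: u_lam)
qed

lemma block_comult_eq_right: "block_comult r s k l m n a = ((u k r \<otimes> u r m) \<lhd> \<Delta> a) * (u l s \<otimes> u s n)"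
  by (simp add: block_comult_def act_middle)

lemma block_comult_finite_right:
  assumes "l \<in> I" "n \<in> I"
  shows "finite {s \<in> I. block_comult r s k l m n a \<noteq> 0}"
proof -
  have "finite {s \<in> I. t * (u l s \<otimes> u s n) \<noteq> 0}" for t
  proof (induction t rule: tensor_induct)
    case (pure x y)
    have "y * u s n = 0" if "y \<lhd> lam s = 0" "s \<in> I" for s
      using that assms by (simp add: u_mult_right)
    then show ?case
      by (intro finite_subset[OF _ has_strict_sumD(3)[OF lam_strict_sum, of y]])
        (auto simp: tensor_times_tensor)
  next
    case (add s t)
    then show ?case
      by (rule finite_subset[rotated, OF finite_UnI]) (auto simp: distrib_right)
  qed
  then show ?thesis by (simp add: block_comult_eq_right)
qed

lemma block_comult_finite_left:
  assumes "k \<in> I" "m \<in> I"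
  shows "finite {r \<in> I. block_comult r s k l m n a \<noteq> 0}"
proof -
  have "finite {r \<in> I. (u k r \<otimes> u r m) * t \<noteq> 0}" for t
  proof (induction t rule: tensor_induct)
    case (pure x y)
    have "u r m * y = 0" if "lam r \<rhd> y = 0" "r \<in> I" for r
    proof -
      have "u r m * y = (rho m * lam r) \<rhd> y"
        using that assms lam_rho_commute[of r m] by (simp add: u_mult_left flip: act_left_times)
      then show ?thesis using that by simp
    qed
    then show ?case
      by (intro finite_subset[OF _ has_strict_sumD(1)[OF lam_strict_sum, of y]])
        (auto simp: tensor_times_tensor)
  next
    case (add s t)
    then show ?case
      by (rule finite_subset[rotated, OF finite_UnI]) (auto simp: distrib_left)
  qed
  then show ?thesis by (simp add: block_comult_def)
qed

text \<open>Insert \<open>E = \<Sum>\<^sub>t \<rho>\<^sub>t \<otimes> \<lambda>\<^sub>t\<close> between \<open>\<Delta>(a)\<close> and \<open>\<Delta>(b)\<close>; the terms of the sum are the elements \<open>\<Delta>\<^sub>r\<^sub>t(a)\<close>.\<close>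

lemma block_comult_mult:
  assumes "r \<in> I" "s \<in> I" "k \<in> I" "l \<in> I" "p \<in> I" "m \<in> I" "n \<in> I" "q \<in> I"
    and a: "a \<in> block k l m n" and b: "b \<in> block l p n q"
  shows "block_comult r s k p m q (a * b) = (\<Sum>t\<in>{t \<in> I. block_comult r t k l m n a \<noteq> 0}. block_comult r t k l m n a * block_comult t s l p n q b)"
proof -
  define X where "X = (u k r \<otimes> u r m) \<lhd> \<Delta> a"
  define Y where "Y = \<Delta> b \<rhd> (u p s \<otimes> u s q)"
  have cmX: "block_comult r t k l m n a = X * (u l t \<otimes> u t n)" for t
    by (simp add: block_comult_eq_right X_def)
  have X: "X \<lhd> (rho t \<otimes>\<^sub>M lam t) = block_comult r t k l m n a" if "t \<in> I" for t
  proof -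
    have "block_comult r t k l m n a = (u k r \<otimes> u r m) \<lhd> (\<Delta> a * to_multiplier (u l t \<otimes> u t n))"
      by (simp add: block_comult_eq_right)
    also have "\<Delta> a * to_multiplier (u l t \<otimes> u t n) = \<Delta> a * (rho t \<otimes>\<^sub>M lam t)"
      using comult_block(2)[OF assms(3,4,6,7) a] unfolding to_multiplier_uu(2)[OF assms(4) that assms(7)]
      by (metis mult.assoc)
    finally show ?thesis by (simp add: X_def)
  qed
  have "X = X \<lhd> E" by (simp add: X_def)
  also have "\<dots> = (\<Sum>t\<in>{t \<in> I. X \<lhd> (rho t \<otimes>\<^sub>M lam t) \<noteq> 0}. X \<lhd> (rho t \<otimes>\<^sub>M lam t))"
    by (rule has_strict_sumD(4)[OF E_strict_sum])
  also have "\<dots> = (\<Sum>t\<in>{t \<in> I. block_comult r t k l m n a \<noteq> 0}. block_comult r t k l m n a)"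
    by (rule sum.cong) (auto simp: X)
  finally have X_sum: "X = (\<Sum>t\<in>{t \<in> I. block_comult r t k l m n a \<noteq> 0}. block_comult r t k l m n a)" .
  have "block_comult r s k p m q (a * b) = X * Y"
    by (simp add: block_comult_def X_def Y_def comult_mult act_middle)
  also have "\<dots> = (\<Sum>t\<in>{t \<in> I. block_comult r t k l m n a \<noteq> 0}. block_comult r t k l m n a * Y)"
    by (subst X_sum) (rule sum_distrib_right)
  also have "\<dots> = (\<Sum>t\<in>{t \<in> I. block_comult r t k l m n a \<noteq> 0}. block_comult r t k l m n a * block_comult t s l p n q b)"
  proof (rule sum.cong)
    fix t assume "t \<in> {t \<in> I. block_comult r t k l m n a \<noteq> 0}"
    then have t: "t \<in> I" by simp
    have "(u l t \<otimes> u t n) * (u l t \<otimes> u t n) = u l t \<otimes> u t n"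
      using assms t by (simp add: tensor_times_tensor u_u)
    then have "(u l t \<otimes> u t n) * Y = (u l t \<otimes> u t n) * block_comult t s l p n q b"
      by (simp add: block_comult_def Y_def flip: mult.assoc)
    then show "block_comult r t k l m n a * Y = block_comult r t k l m n a * block_comult t s l p n q b"
      by (simp add: cmX mult.assoc)
  qed simp
  finally show ?thesis .
qed

lemma partial_bialgebra_pb: "partial_bialgebra I pb"
proof (rule partial_bialgebra.intro)
  show "cbilinear (pmul pb k l p m n q)" for k l p m n q
    by (simp add: cbilinear_mult)
  show "rcf_on I (\<lambda>r s. pcomul pb r s k l m n a)" if "k \<in> I" "l \<in> I" "m \<in> I" "n \<in> I" for k l m n a
    using that by (simp add: rcf_on_def block_comult_finite_left block_comult_finite_right)
  show "counit_ext pb k p m q (pmul pb k l p m n q a b) = counit_ext pb k l m n a * counit_ext pb l p n q b"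
    if "k \<in> I" "l \<in> I" "p \<in> I" "m \<in> I" "n \<in> I" "q \<in> I" "a \<in> component pb k l m n" "b \<in> component pb l p n q"
    for k l p m n q a b
    using that block_mult[of a k l m n b p q] by (simp add: counit_block counit_mult)
  show "pmul pb k k l m m n (punit pb k m) a = a" if "a \<in> component pb k l m n" for k l m n a
    using that by (simp add: block_def)
  show "pmul pb k l l m n n a (punit pb l n) = a" if "a \<in> component pb k l m n" for k l m n a
    using that by (simp add: block_def)
  show "punit pb k m \<in> component pb k k m m" if "k \<in> I" "m \<in> I" for k m
    using that by (simp add: block_def u_u)
qed (simp_all add: block_subspace block_mult mult.assoc clinear_block_comult block_comult_in block_comult_coassoc counit_linear block_comult_counit_left
    block_comult_counit_right block_comult_unit counit_unit_u block_comult_mult flip: times_tensor_def)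

lemma total_lambda_pb: "k \<in> I \<Longrightarrow> total_lambda I pb (\<lambda>_ _ _ _ a. a) k = lam k"
  unfolding total_lambda_def
  by (rule strict_sum_eq, rule has_strict_sum_cong[OF has_strict_sum_mult_const(1)[OF rho_strict_sum]])
    (simp add: to_multiplier_u)

lemma total_rho_pb: "m \<in> I \<Longrightarrow> total_rho I pb (\<lambda>_ _ _ _ a. a) m = rho m"
  unfolding total_rho_def
  by (rule strict_sum_eq, rule has_strict_sum_cong[OF has_strict_sum_mult_const(2)[OF lam_strict_sum]])
    (simp add: to_multiplier_u)

lemma u_separates:
  assumes "\<And>k l m n. k \<in> I \<Longrightarrow> l \<in> I \<Longrightarrow> m \<in> I \<Longrightarrow> n \<in> I \<Longrightarrow> u k m * a * u l n = u k m * b * u l n"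
  shows "a = b"
proof -
  note rho_separates = has_strict_sum_one_separates[OF rho_strict_sum]
  have "u k m * a = u k m * b" if "k \<in> I" "m \<in> I" for k m
  proof (rule lam_separates(2), rule rho_separates(2))
    fix l n assume "l \<in> I" "n \<in> I"
    then show "(u k m * a) \<lhd> lam l \<lhd> rho n = (u k m * b) \<lhd> lam l \<lhd> rho n"
      using assms[of k l m n] that by (simp flip: u_mult_right)
  qed
  then have "lam k \<rhd> rho m \<rhd> a = lam k \<rhd> rho m \<rhd> b" if "k \<in> I" "m \<in> I" for k m
    using that by (simp flip: u_mult_left)
  then have "rho m \<rhd> a = rho m \<rhd> b" if "m \<in> I" for m
    by (rule lam_separates(1)[of "rho m \<rhd> a" "rho m \<rhd> b"]) (use that in auto)
  then show ?thesis by (rule rho_separates(1))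
qed

lemma u_sandwich_other:
  assumes "k \<in> I" "l \<in> I" "m \<in> I" "n \<in> I" "k' \<in> I" "l' \<in> I" "m' \<in> I" "n' \<in> I" "a \<in> block k' l' m' n'"
  shows "u k m * a * u l n = (if (k, l, m, n) = (k', l', m', n') then a else 0)"
proof -
  have a: "u k' m' * a = a" "a * u l' n' = a" using assms(9) by (simp_all add: block_def)
  have "u k m * a * u l n = (u k m * u k' m') * a * (u l' n' * u l n)"
    using a by (metis mult.assoc)
  then show ?thesis using assms a by (auto simp: u_u)
qed

lemma direct_sum_pbD:
  assumes "x \<in> direct_sum I pb"
  shows "{k, l, m, n} \<subseteq> I \<Longrightarrow> x (k, l, m, n) \<in> block k l m n"
    "\<not> {k, l, m, n} \<subseteq> I \<Longrightarrow> x (k, l, m, n) = 0"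
proof -
  have "if {k, l, m, n} \<subseteq> I then x (k, l, m, n) \<in> block k l m n else x (k, l, m, n) = 0"
    using assms unfolding direct_sum_def pb_simps by blast
  then show "{k, l, m, n} \<subseteq> I \<Longrightarrow> x (k, l, m, n) \<in> block k l m n"
    "\<not> {k, l, m, n} \<subseteq> I \<Longrightarrow> x (k, l, m, n) = 0" by presburger+
qed

text \<open>The corners of the sum recover the summands.  As corners separate the elements of \<open>A\<close>
  (\<open>u_separates\<close>), this shows both that the sum is direct and that it is everything.\<close>

lemma direct_sum_component:
  assumes x: "x \<in> direct_sum I pb" and I: "k \<in> I" "l \<in> I" "m \<in> I" "n \<in> I"
  shows "u k m * direct_sum_map (\<lambda>_ _ _ _ a. a) x * u l n = x (k, l, m, n)"
proof -
  have fin: "finite {i. x i \<noteq> 0}" using x by (simp add: direct_sum_def)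
  have x_comp: "k' \<in> I \<and> l' \<in> I \<and> m' \<in> I \<and> n' \<in> I \<and> x (k', l', m', n') \<in> block k' l' m' n'"
    if "x (k', l', m', n') \<noteq> 0" for k' l' m' n'
  proof -
    show ?thesis using direct_sum_pbD[OF x, of k' l' m' n'] that by auto
  qed
  have "u k m * direct_sum_map (\<lambda>_ _ _ _ a. a) x * u l n = (\<Sum>i\<in>{i. x i \<noteq> 0}. u k m * x i * u l n)"
    by (simp add: direct_sum_map_def case_prod_unfold sum_distrib_left sum_distrib_right)
  also have "\<dots> = (\<Sum>i\<in>{i. x i \<noteq> 0}. if i = (k, l, m, n) then x (k, l, m, n) else 0)"
  proof (rule sum.cong)
    fix i assume "i \<in> {i. x i \<noteq> 0}"
    moreover obtain k' l' m' n' :: 'i where i: "i = (k', l', m', n')" by (metis prod_cases4)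
    ultimately show "u k m * x i * u l n = (if i = (k, l, m, n) then x (k, l, m, n) else 0)"
      using u_sandwich_other[OF I, of k' l' m' n' "x i"] x_comp[of k' l' m' n'] by auto
  qed simp
  also have "\<dots> = x (k, l, m, n)" using fin by simp
  finally show ?thesis .
qed

lemma direct_sum_bij: "bij_betw (direct_sum_map (\<lambda>_ _ _ _ a. a)) (direct_sum I pb) UNIV"
proof (rule bij_betw_imageI)
  show "inj_on (direct_sum_map (\<lambda>_ _ _ _ a. a)) (direct_sum I pb)"
  proof (rule inj_onI, rule ext)
    fix x y i
    assume x: "x \<in> direct_sum I pb" and y: "y \<in> direct_sum I pb"
      and eq: "direct_sum_map (\<lambda>_ _ _ _ a. a) x = direct_sum_map (\<lambda>_ _ _ _ a. a) y"
    obtain k l m n :: 'i where i: "i = (k, l, m, n)" by (metis prod_cases4)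
    show "x i = y i"
    proof (cases "{k, l, m, n} \<subseteq> I")
      case True
      then show ?thesis
        using direct_sum_component[OF x, of k l m n] direct_sum_component[OF y, of k l m n] eq i by simp
    next
      case False
      then show ?thesis using direct_sum_pbD(2)[OF x] direct_sum_pbD(2)[OF y] i by metis
    qed
  qed
  show "direct_sum_map (\<lambda>_ _ _ _ a. a) ` direct_sum I pb = UNIV"
  proof (intro set_eqI iffI UNIV_I)
    fix a :: 'a
    define x where "x = (\<lambda>(k, l, m, n). if {k, l, m, n} \<subseteq> I then u k m * a * u l n else 0)"
    have supp: "{i. x i \<noteq> 0} \<subseteq> {k \<in> I. lam k \<rhd> a \<noteq> 0} \<times> {l \<in> I. a \<lhd> lam l \<noteq> 0} \<times> {m \<in> I. rho m \<rhd> a \<noteq> 0} \<times> {n \<in> I. a \<lhd> rho n \<noteq> 0}"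
    proof
      fix i assume i: "i \<in> {i. x i \<noteq> 0}"
      obtain k l m n :: 'i where klmn: "i = (k, l, m, n)" by (metis prod_cases4)
      have I: "k \<in> I" "l \<in> I" "m \<in> I" "n \<in> I" and ne: "u k m * a * u l n \<noteq> 0"
        using i by (auto simp: klmn x_def split: if_splits)
      have eqs: "u k m * a = lam k \<rhd> rho m \<rhd> a" "u k m * a = rho m \<rhd> lam k \<rhd> a"
        "a * u l n = a \<lhd> lam l \<lhd> rho n" "a * u l n = a \<lhd> rho n \<lhd> lam l"
        using I lam_rho_commute[OF I(1,3)] lam_rho_commute[OF I(2,4)]
        by (simp_all add: u_mult_left u_mult_right flip: act_left_times act_right_times)
      have "u k m * a \<noteq> 0" using ne by auto
      then have "rho m \<rhd> a \<noteq> 0" "lam k \<rhd> a \<noteq> 0"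
        using eqs(1,2) act_left_zero by metis+
      moreover have "a * u l n \<noteq> 0" using ne by (auto simp: mult.assoc)
      then have "a \<lhd> lam l \<noteq> 0" "a \<lhd> rho n \<noteq> 0"
        using eqs(3,4) act_right_zero by metis+
      ultimately show "i \<in> {k \<in> I. lam k \<rhd> a \<noteq> 0} \<times> {l \<in> I. a \<lhd> lam l \<noteq> 0} \<times> {m \<in> I. rho m \<rhd> a \<noteq> 0} \<times> {n \<in> I. a \<lhd> rho n \<noteq> 0}"
        using I by (simp add: klmn)
    qed
    have "finite {i. x i \<noteq> 0}"
      by (rule finite_subset[OF supp])
        (intro finite_cartesian_product has_strict_sumD[OF lam_strict_sum] has_strict_sumD[OF rho_strict_sum])
    then have x: "x \<in> direct_sum I pb"
      unfolding direct_sum_def by (auto simp: x_def u_sandwich_block)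
    have "direct_sum_map (\<lambda>_ _ _ _ a. a) x = a"
      by (rule u_separates) (simp add: direct_sum_component[OF x], simp add: x_def)
    then show "a \<in> direct_sum_map (\<lambda>_ _ _ _ a. a) ` direct_sum I pb" using x by (metis imageI)
  qed
qed

lemma total_pb: "total_weak_multiplier_bialgebra I pb (\<lambda>_ _ _ _ a. a) \<Delta> E \<epsilon>"
proof (rule total_weak_multiplier_bialgebra.intro[OF partial_bialgebra_pb], rule total_weak_multiplier_bialgebra_axioms.intro)
  show "clinear \<epsilon>" "clinear \<Delta>" "\<Delta> (x * y) = \<Delta> x * \<Delta> y" for x y
    by (fact counit_linear comult_linear comult_mult)+
  show "clinear (\<lambda>a :: 'a. a)" by (rule clinear_id)
  show "a * b = (if l = l' \<and> n = n' then pmul pb k l p m n q a b else 0)"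
    if "k \<in> I" "l \<in> I" "m \<in> I" "n \<in> I" "l' \<in> I" "p \<in> I" "n' \<in> I" "q \<in> I" "a \<in> component pb k l m n" "b \<in> component pb l' p n' q"
    for k l m n l' p n' q a b
  proof -
    have ab: "a * u l n = a" "u l' n' * b = b" using that by (simp_all add: block_def)
    have "a * b = a * (u l n * u l' n') * b" using ab by (metis mult.assoc)
    then show ?thesis using that by (auto simp: u_u)
  qed
  show "has_strict_sum (\<lambda>l. total_rho I pb (\<lambda>_ _ _ _ a. a) l \<otimes>\<^sub>M total_lambda I pb (\<lambda>_ _ _ _ a. a) l) I E"
    by (rule has_strict_sum_cong[OF E_strict_sum]) (simp add: total_lambda_pb total_rho_pb)
  fix r s k l m n a
  assume I: "r \<in> I" "s \<in> I" "k \<in> I" "l \<in> I" "m \<in> I" "n \<in> I" and a: "a \<in> component pb k l m n"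
  have block_comult: "to_multiplier (tensor_map (\<lambda>a. a) (\<lambda>a. a) (pcomul pb r s k l m n a)) = (rho r \<otimes>\<^sub>M lam r) * \<Delta> a * (rho s \<otimes>\<^sub>M lam s)"
    using I a by (simp add: tensor_map_ident to_multiplier_block_comult)
  show "(1 \<otimes>\<^sub>M total_lambda I pb (\<lambda>_ _ _ _ a. a) r) * \<Delta> a * (1 \<otimes>\<^sub>M total_lambda I pb (\<lambda>_ _ _ _ a. a) s)
    = to_multiplier (tensor_map (\<lambda>a. a) (\<lambda>a. a) (pcomul pb r s k l m n a))"
    unfolding block_comult total_lambda_pb[OF I(1)] total_lambda_pb[OF I(2)]
    by (simp add: comult_leg(1)[OF I(1)] mult.assoc comult_leg(2)[OF I(2)])
  show "(total_rho I pb (\<lambda>_ _ _ _ a. a) r \<otimes>\<^sub>M 1) * \<Delta> a * (total_rho I pb (\<lambda>_ _ _ _ a. a) s \<otimes>\<^sub>M 1)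
    = to_multiplier (tensor_map (\<lambda>a. a) (\<lambda>a. a) (pcomul pb r s k l m n a))"
    unfolding block_comult total_rho_pb[OF I(1)] total_rho_pb[OF I(2)]
    by (simp add: comult_leg(3)[OF I(1)] mult.assoc comult_leg(4)[OF I(2)])
qed (simp_all add: direct_sum_bij counit_block)

end

section \<open>Uniqueness\<close>

lemma has_strict_sum_single:
  assumes "has_strict_sum f S m" "j \<in> S"
  shows "(\<And>i. i \<in> S \<Longrightarrow> i \<noteq> j \<Longrightarrow> f i \<rhd> b = 0) \<Longrightarrow> m \<rhd> b = f j \<rhd> b"
    and "(\<And>i. i \<in> S \<Longrightarrow> i \<noteq> j \<Longrightarrow> b \<lhd> f i = 0) \<Longrightarrow> b \<lhd> m = b \<lhd> f j"
proof -
  note D = has_strict_sumD[OF assms(1)]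
  show "m \<rhd> b = f j \<rhd> b" if *: "\<And>i. i \<in> S \<Longrightarrow> i \<noteq> j \<Longrightarrow> f i \<rhd> b = 0"
  proof -
    have "(\<Sum>i\<in>{i \<in> S. f i \<rhd> b \<noteq> 0}. f i \<rhd> b) = (\<Sum>i\<in>{j}. f i \<rhd> b)"
      by (rule sum.mono_neutral_left) (use * assms(2) in auto)
    then show ?thesis using D(2)[of b] by simp
  qed
  show "b \<lhd> m = b \<lhd> f j" if *: "\<And>i. i \<in> S \<Longrightarrow> i \<noteq> j \<Longrightarrow> b \<lhd> f i = 0"
  proof -
    have "(\<Sum>i\<in>{i \<in> S. b \<lhd> f i \<noteq> 0}. b \<lhd> f i) = (\<Sum>i\<in>{j}. b \<lhd> f i)"
      by (rule sum.mono_neutral_left) (use * assms(2) in auto)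
    then show ?thesis using D(4)[of b] by simp
  qed
qed

lemma finite_support_span:
  assumes "\<And>i. clinear (f i)" "\<And>x. x \<in> S \<Longrightarrow> finite {i \<in> J. f i x \<noteq> 0}" "UNIV \<subseteq> cvec.span S"
  shows "finite {i \<in> J. f i x \<noteq> 0}"
proof -
  have "x \<in> cvec.span S" using assms(3) by blast
  then show ?thesis
  proof (induction rule: cvec.span_induct_alt)
    case base
    then show ?case by (simp add: clinear_zero[OF assms(1)])
  next
    case (step c x y)
    show ?case
      by (rule finite_subset[OF _ finite_UnI[OF assms(2)[OF step(1)] step(2)]])
        (auto simp: clinear_add[OF assms(1)] clinear_scale[OF assms(1)])
  qed
qed

context total_weak_multiplier_bialgebra
begin

text \<open>The families \<open>\<lambda>'\<^sub>k\<close> and \<open>\<rho>'\<^sub>l\<close> of a given total weak multiplier bialgebra.\<close>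

abbreviation "L \<equiv> total_lambda I \<A> \<iota>"
abbreviation "R \<equiv> total_rho I \<A> \<iota>"

definition homogeneous :: "'a set" where
  "homogeneous = {\<iota> k l m n a | k l m n a. k \<in> I \<and> l \<in> I \<and> m \<in> I \<and> n \<in> I \<and> a \<in> component \<A> k l m n}"

lemma homogeneousE:
  assumes "x \<in> homogeneous"
  obtains k l m n a where "k \<in> I" "l \<in> I" "m \<in> I" "n \<in> I" "a \<in> component \<A> k l m n" "x = \<iota> k l m n a"
  using assms unfolding homogeneous_def by blast

lemma span_homogeneous: "UNIV \<subseteq> cvec.span homogeneous"
proof
  fix x
  obtain y where y: "y \<in> direct_sum I \<A>" "x = direct_sum_map \<iota> y"
    using total_direct_sum unfolding bij_betw_def by blast
  have "(case i of (k, l, m, n) \<Rightarrow> \<iota> k l m n (y (k, l, m, n))) \<in> cvec.span homogeneous" if "y i \<noteq> 0" for i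
  proof -
    obtain k l m n :: 'i where i: "i = (k, l, m, n)" by (metis prod_cases4)
    have "if {k, l, m, n} \<subseteq> I then y (k, l, m, n) \<in> component \<A> k l m n else y (k, l, m, n) = 0"
      using y(1) unfolding direct_sum_def by blast
    then have I: "{k, l, m, n} \<subseteq> I" and "y (k, l, m, n) \<in> component \<A> k l m n"
      using that i by (auto split: if_split_asm)
    then have "\<iota> k l m n (y (k, l, m, n)) \<in> homogeneous"
      unfolding homogeneous_def by blast
    then show ?thesis unfolding i by (simp add: cvec.span_base)
  qed
  then show "x \<in> cvec.span homogeneous"
    unfolding y(2) direct_sum_map_def by (intro cvec.span_sum) blast
qed

text \<open>The units of the components, as elements of the total algebra.\<close>

definition e :: "'i \<Rightarrow> 'i \<Rightarrow> 'a" where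
  "e k m = \<iota> k k m m (punit \<A> k m)"

lemma e_mult:
  assumes "k \<in> I" "l \<in> I" "m \<in> I" "n \<in> I" "a \<in> component \<A> k l m n" "i \<in> I" "j \<in> I"
  shows "e i j * \<iota> k l m n a = (if i = k \<and> j = m then \<iota> k l m n a else 0)"
    "\<iota> k l m n a * e i j = (if i = l \<and> j = n then \<iota> k l m n a else 0)"
  using assms total_mult[of i i j j k l m n "punit \<A> i j" a] total_mult[of k l m n i i j j a "punit \<A> i j"]
  by (auto simp: e_def unit_comp unit_mul mul_unit)

lemma e_finite:
  shows "k \<in> I \<Longrightarrow> finite {l \<in> I. e k l * x \<noteq> 0}" "k \<in> I \<Longrightarrow> finite {l \<in> I. x * e k l \<noteq> 0}"
    "l \<in> I \<Longrightarrow> finite {k \<in> I. e k l * x \<noteq> 0}" "l \<in> I \<Longrightarrow> finite {k \<in> I. x * e k l \<noteq> 0}"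
proof -
  have *: "finite {i \<in> I. f i x \<noteq> 0}"
    if lin: "\<And>i. clinear (f i)"
      and single: "\<And>k l m n a i. \<lbrakk>k \<in> I; l \<in> I; m \<in> I; n \<in> I; a \<in> component \<A> k l m n; i \<in> I; i \<noteq> j k l m n\<rbrakk>
        \<Longrightarrow> f i (\<iota> k l m n a) = 0"
    for f :: "'i \<Rightarrow> 'a \<Rightarrow> 'a" and j
  proof (rule finite_support_span[OF lin _ span_homogeneous])
    fix x assume "x \<in> homogeneous"
    then obtain k l m n a where x: "k \<in> I" "l \<in> I" "m \<in> I" "n \<in> I" "a \<in> component \<A> k l m n" "x = \<iota> k l m n a"
      by (rule homogeneousE)
    have "{i \<in> I. f i x \<noteq> 0} \<subseteq> {j k l m n}" using single[OF x(1-5)] x(6) by blast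
    then show "finite {i \<in> I. f i x \<noteq> 0}" by (rule finite_subset) simp
  qed
  note lin = clinear_mult_left[OF clinear_id] clinear_mult_right[OF clinear_id]
  show "finite {l \<in> I. e k l * x \<noteq> 0}" if "k \<in> I"
    by (rule *[where f = "\<lambda>l x. e k l * x" and j = "\<lambda>k l m n. m", OF lin(1)]) (simp add: e_mult that)
  show "finite {l \<in> I. x * e k l \<noteq> 0}" if "k \<in> I"
    by (rule *[where f = "\<lambda>l x. x * e k l" and j = "\<lambda>k l m n. n", OF lin(2)]) (simp add: e_mult that)
  show "finite {k \<in> I. e k l * x \<noteq> 0}" if "l \<in> I"
    by (rule *[where f = "\<lambda>k x. e k l * x" and j = "\<lambda>k l m n. k", OF lin(1)]) (simp add: e_mult that)
  show "finite {k \<in> I. x * e k l \<noteq> 0}" if "l \<in> I"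
    by (rule *[where f = "\<lambda>k x. x * e k l" and j = "\<lambda>k l m n. l", OF lin(2)]) (simp add: e_mult that)
qed

lemma L_strict_sum: "k \<in> I \<Longrightarrow> has_strict_sum (\<lambda>l. to_multiplier (e k l)) I (L k)"
  using strict_sum_exists[of I "\<lambda>l. to_multiplier (e k l)"] e_finite(1,2)[of k] strict_sum_eq
  unfolding total_lambda_def e_def by fastforce

lemma R_strict_sum: "l \<in> I \<Longrightarrow> has_strict_sum (\<lambda>k. to_multiplier (e k l)) I (R l)"
  using strict_sum_exists[of I "\<lambda>k. to_multiplier (e k l)"] e_finite(3,4)[of l] strict_sum_eq
  unfolding total_rho_def e_def by fastforce

lemma L_R_act:
  assumes "k \<in> I" "l \<in> I" "m \<in> I" "n \<in> I" "a \<in> component \<A> k l m n" "i \<in> I"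
  shows "L i \<rhd> \<iota> k l m n a = (if i = k then \<iota> k l m n a else 0)"
    "\<iota> k l m n a \<lhd> L i = (if i = l then \<iota> k l m n a else 0)"
    "R i \<rhd> \<iota> k l m n a = (if i = m then \<iota> k l m n a else 0)"
    "\<iota> k l m n a \<lhd> R i = (if i = n then \<iota> k l m n a else 0)"
  using has_strict_sum_single(1)[OF L_strict_sum[OF assms(6)] assms(3), of "\<iota> k l m n a"]
    has_strict_sum_single(2)[OF L_strict_sum[OF assms(6)] assms(4), of "\<iota> k l m n a"]
    has_strict_sum_single(1)[OF R_strict_sum[OF assms(6)] assms(1), of "\<iota> k l m n a"]
    has_strict_sum_single(2)[OF R_strict_sum[OF assms(6)] assms(2), of "\<iota> k l m n a"]
  using assms by (simp_all add: e_mult)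

lemma e_act:
  assumes "k \<in> I" "m \<in> I"
  shows "e k m * x = L k \<rhd> R m \<rhd> x"
proof (rule linear_eq_on_span[where f = "\<lambda>x. e k m * x" and g = "\<lambda>x. L k \<rhd> R m \<rhd> x", OF _ _ _ span_homogeneous])
  show "clinear (\<lambda>x. e k m * x)" "clinear (\<lambda>x. L k \<rhd> R m \<rhd> x)"
    by (intro clinear_mult_left clinear_id clinear_compose[OF clinear_act_left] clinear_act_left)+
  fix x assume "x \<in> homogeneous"
  then obtain k' l m' n a where "k' \<in> I" "l \<in> I" "m' \<in> I" "n \<in> I" "a \<in> component \<A> k' l m' n" "x = \<iota> k' l m' n a"
    by (rule homogeneousE)
  then show "e k m * x = L k \<rhd> R m \<rhd> x" using assms by (simp add: e_mult L_R_act)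
qed

lemma L_orth_act:
  assumes "i \<in> I" "j \<in> I"
  shows "L i \<rhd> L j \<rhd> x = (if i = j then L i \<rhd> x else 0)"
proof (rule linear_eq_on_span[where f = "\<lambda>x. L i \<rhd> L j \<rhd> x" and g = "\<lambda>x. if i = j then L i \<rhd> x else 0", OF _ _ _ span_homogeneous])
  show "clinear (\<lambda>x. L i \<rhd> L j \<rhd> x)"
    by (intro clinear_compose[OF clinear_act_left] clinear_act_left)
  show "clinear (\<lambda>x. if i = j then L i \<rhd> x else 0)"
    by (rule clinearI) (simp_all add: act_left_add act_left_scale)
  fix x assume "x \<in> homogeneous"
  then obtain k' l m' n a where "k' \<in> I" "l \<in> I" "m' \<in> I" "n \<in> I" "a \<in> component \<A> k' l m' n" "x = \<iota> k' l m' n a"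
    by (rule homogeneousE)
  then show "L i \<rhd> L j \<rhd> x = (if i = j then L i \<rhd> x else 0)" using assms by (simp add: L_R_act)
qed

lemma counit_e:
  assumes "k \<in> I"
  shows "\<epsilon> (e k k) = 1"
  using assms by (simp add: e_def total_counit unit_comp counit_ext_def counit_unit)

text \<open>Directness of the sum, applied to families with a single non-zero member.\<close>

lemma incl_inj:
  assumes I: "k \<in> I" "l \<in> I" "m \<in> I" "n \<in> I"
    and a: "a \<in> component \<A> k l m n" and b: "b \<in> component \<A> k l m n" and eq: "\<iota> k l m n a = \<iota> k l m n b"
  shows "a = b"
proof -
  \<comment> \<open>The member of the direct sum that is concentrated in one component.\<close>
  define x where "x c = (\<lambda>i. if i = (k, l, m, n) then c else (0 :: 'v))" for c
  have in_sum: "x c \<in> direct_sum I \<A>" if "c \<in> component \<A> k l m n" for c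
  proof -
    have "finite {i. x c i \<noteq> 0}"
      by (rule finite_subset[of _ "{(k, l, m, n)}"]) (auto simp: x_def)
    moreover have "if {k', l', m', n'} \<subseteq> I then x c (k', l', m', n') \<in> component \<A> k' l' m' n' else x c (k', l', m', n') = 0"
      for k' l' m' n'
      using that I cvec.subspace_0[OF comp_subspace, of k' l' m' n'] by (auto simp: x_def)
    ultimately show ?thesis unfolding direct_sum_def by blast
  qed
  have map: "direct_sum_map \<iota> (x c) = \<iota> k l m n c" for c
  proof -
    have "direct_sum_map \<iota> (x c) = (\<Sum>i\<in>{(k, l, m, n)}. case i of (k, l, m, n) \<Rightarrow> \<iota> k l m n (x c (k, l, m, n)))"
      unfolding direct_sum_map_def
      by (rule sum.mono_neutral_left) (auto simp: x_def clinear_zero[OF incl_linear[OF I]])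
    then show ?thesis by (simp add: x_def)
  qed
  have "x a = x b"
    using bij_betw_imp_inj_on[OF total_direct_sum] in_sum[OF a] in_sum[OF b] map[of a] map[of b] eq
    by (metis inj_onD)
  from fun_cong[OF this, of "(k, l, m, n)"] show ?thesis by (simp add: x_def)
qed

end

locale total_over_function_base = unital_function_base \<Delta> E \<epsilon> I \<phi> +
  B: total_weak_multiplier_bialgebra I \<B> \<kappa> \<Delta> E \<epsilon>
  for \<Delta> :: "'a::complex_algebra \<Rightarrow> ('a, 'a) tensor multiplier"
    and E :: "('a, 'a) tensor multiplier"
    and \<epsilon> :: "'a \<Rightarrow> complex"
    and I :: "'i set" and \<phi> :: "('i \<Rightarrow> complex) \<Rightarrow> 'a multiplier"
    and \<B> :: "('i, 'b::complex_vector) partial_bialgebra_data"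
    and \<kappa> :: "'i \<Rightarrow> 'i \<Rightarrow> 'i \<Rightarrow> 'i \<Rightarrow> 'b \<Rightarrow> 'a"
begin

lemma L_orth: "i \<in> I \<Longrightarrow> j \<in> I \<Longrightarrow> B.L i * B.L j = (if i = j then B.L i else 0)"
  by (rule A.multiplier_eq_leftI) (simp add: B.L_orth_act)

lemma L_nonzero: "k \<in> I \<Longrightarrow> B.L k \<noteq> 0"
proof
  assume k: "k \<in> I" and "B.L k = 0"
  then have "B.L k \<rhd> B.e k k = 0" by simp
  then have "B.e k k = 0"
    using B.L_R_act(1)[of k k k k "punit \<B> k k" k] k by (simp add: B.e_def B.unit_comp)
  then show False using B.counit_e[OF k] by (simp add: clinear_zero[OF counit_linear])
qed

lemma E_L:
  assumes "k \<in> I"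
  shows "E * (1 \<otimes>\<^sub>M B.L k) = B.R k \<otimes>\<^sub>M B.L k"
proof -
  have "E * (1 \<otimes>\<^sub>M B.L k) = (B.R k \<otimes>\<^sub>M B.L k) * (1 \<otimes>\<^sub>M B.L k)"
    by (rule has_strict_sum_mult(2)[OF B.total_E assms]) (simp add: mtensor_mult L_orth assms)
  then show ?thesis by (simp add: mtensor_mult L_orth assms multiplier_one)
qed

lemma PiL_L:
  assumes "k \<in> I"
  shows "PiL E \<epsilon> a \<rhd> (B.L k \<rhd> c) = \<epsilon> (B.R k \<rhd> a) *\<^sub>C (B.L k \<rhd> c)"
  using arg_cong[OF E_L[OF assms], of "\<lambda>M. slice_fst \<epsilon> (M \<rhd> (a \<otimes> c))"]
  by (simp add: PiL_act(1) slice_fst_tensor counit_linear)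

text \<open>\<open>\<Pi>\<^sup>L(a) = \<Sum>\<^sub>l \<epsilon>(\<rho>'\<^sub>l a) \<lambda>'\<^sub>l\<close>, and the unit \<open>1\<^sup>k\<^sub>k\<close>, on which the counit is \<open>1\<close>, selects \<open>\<lambda>'\<^sub>k\<close>.\<close>

lemma L_baseL:
  assumes k: "k \<in> I"
  shows "PiL E \<epsilon> (B.e k k) = B.L k"
proof (rule A.multiplier_eq_leftI)
  fix x
  show "PiL E \<epsilon> (B.e k k) \<rhd> x = B.L k \<rhd> x"
  proof (rule linear_eq_on_span[where f = "\<lambda>x. PiL E \<epsilon> (B.e k k) \<rhd> x" and g = "\<lambda>x. B.L k \<rhd> x", OF _ _ _ B.span_homogeneous])
    show "clinear (\<lambda>x. PiL E \<epsilon> (B.e k k) \<rhd> x)" "clinear (\<lambda>x. B.L k \<rhd> x)"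
      by (rule clinear_act_left)+
    fix x assume "x \<in> B.homogeneous"
    then obtain l l' m n a where x: "l \<in> I" "l' \<in> I" "m \<in> I" "n \<in> I" "a \<in> component \<B> l l' m n" "x = \<kappa> l l' m n a"
      by (rule B.homogeneousE)
    have "B.R l \<rhd> B.e k k = (if l = k then B.e k k else 0)"
      unfolding B.e_def using k x(1) by (simp add: B.L_R_act B.unit_comp)
    moreover have "x = B.L l \<rhd> x" using x by (simp add: B.L_R_act)
    ultimately show "PiL E \<epsilon> (B.e k k) \<rhd> x = B.L k \<rhd> x"
      using PiL_L[OF x(1), of "B.e k k" x] B.L_orth_act[OF k x(1), of x] B.counit_e[OF k] k
      by (auto simp: scaleC_one clinear_zero[OF counit_linear] split: if_splits)
  qed
qed

text \<open>For \<open>j\<close> in the support of the function that represents \<open>\<lambda>'\<^sub>k\<close>, the product \<open>\<lambda>\<^sub>j \<lambda>'\<^sub>k\<close> is a non-zero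
  multiple of \<open>\<lambda>\<^sub>j\<close> and a multiple of \<open>\<lambda>'\<^sub>k\<close>.  So the two idempotents are proportional, hence equal.\<close>

lemma L_is_lam:
  assumes k: "k \<in> I"
  shows "\<exists>j\<in>I. B.L k = lam j"
proof -
  obtain f where f: "f \<in> fun_fin I" "B.L k = \<phi> f"
    using PiL_\<phi>[of "B.e k k"] L_baseL[OF k] by metis
  have "f \<noteq> (\<lambda>i. 0)" using L_nonzero[OF k] f(2) \<phi>_zero by auto
  then obtain j where j: "f j \<noteq> 0" by auto
  then have jI: "j \<in> I" using f(1) by (auto simp: fun_fin_def)
  have 1: "lam j * B.L k = f j *\<^sub>C lam j"
    unfolding f(2) by (rule lam_mult_\<phi>(1)[OF jI f(1)])
  obtain a where a: "PiL E \<epsilon> a = lam j" using lam_baseL[OF jI] by blast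
  have 2: "lam j * B.L k = \<epsilon> (B.R k \<rhd> a) *\<^sub>C B.L k"
    by (rule A.multiplier_eq_leftI) (simp add: act_left_scaleC PiL_L[OF k] flip: a)
  \<comment> \<open>The factor of proportionality is a non-zero idempotent of the scalars.\<close>
  define d where "d = inverse (f j) * \<epsilon> (B.R k \<rhd> a)"
  have lam: "lam j = d *\<^sub>C B.L k"
  proof -
    have "lam j = inverse (f j) *\<^sub>C (f j *\<^sub>C lam j)" using j by (simp add: scaleC_scaleC scaleC_one)
    also have "\<dots> = inverse (f j) *\<^sub>C (\<epsilon> (B.R k \<rhd> a) *\<^sub>C B.L k)" using 1 2 by simp
    finally show ?thesis by (simp add: d_def scaleC_scaleC)
  qed
  have "(d * d) *\<^sub>C B.L k = d *\<^sub>C B.L k"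
    using lam_orth[OF jI jI] unfolding lam
    by (simp add: mult_scaleC_left mult_scaleC_right L_orth k scaleC_scaleC)
  then have "d * d = d" using L_nonzero[OF k] by (simp only: cvec.scale_cancel_right) simp
  moreover have "d \<noteq> 0" using lam lam_nonzero[OF jI] by auto
  ultimately have "d = 1" by simp
  then have "B.L k = lam j" using lam by (simp add: scaleC_one)
  then show ?thesis using jI by (rule bexI)
qed

definition \<sigma> :: "'i \<Rightarrow> 'i" where
  "\<sigma> k = (SOME j. j \<in> I \<and> B.L k = lam j)"

lemma \<sigma>: "k \<in> I \<Longrightarrow> \<sigma> k \<in> I" "k \<in> I \<Longrightarrow> B.L k = lam (\<sigma> k)"
proof -
  assume "k \<in> I"
  from someI_ex[OF L_is_lam[OF this, unfolded Bex_def]] show "\<sigma> k \<in> I" "B.L k = lam (\<sigma> k)"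
    unfolding \<sigma>_def by blast+
qed

lemma L_inj: "i \<in> I \<Longrightarrow> j \<in> I \<Longrightarrow> B.L i = B.L j \<Longrightarrow> i = j"
  using L_orth[of i j] L_orth[of i i] L_nonzero[of i] by (auto split: if_splits)

lemma \<sigma>_bij: "bij_betw \<sigma> I I"
proof (rule bij_betw_imageI)
  show "inj_on \<sigma> I"
    by (rule inj_onI) (metis L_inj \<sigma>(2))
  show "\<sigma> ` I = I"
  proof
    show "I \<subseteq> \<sigma> ` I"
    proof
      fix j assume j: "j \<in> I"
      show "j \<in> \<sigma> ` I"
      proof (rule ccontr)
        assume *: "j \<notin> \<sigma> ` I"
        have "lam j \<rhd> x = 0 \<rhd> x" for x
        proof (rule linear_eq_on_span[where f = "\<lambda>x. lam j \<rhd> x" and g = "\<lambda>x. 0 \<rhd> x", OF _ _ _ B.span_homogeneous])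
          show "clinear (\<lambda>x. lam j \<rhd> x)" "clinear (\<lambda>x :: 'a. 0 \<rhd> x)" by (rule clinear_act_left)+
          fix x assume "x \<in> B.homogeneous"
          then obtain k l m n a where x: "k \<in> I" "l \<in> I" "m \<in> I" "n \<in> I" "a \<in> component \<B> k l m n" "x = \<kappa> k l m n a"
            by (rule B.homogeneousE)
          then have "x = lam (\<sigma> k) \<rhd> x" using B.L_R_act(1)[OF x(1-5) x(1)] \<sigma>(2)[OF x(1)] by simp
          moreover have "j \<noteq> \<sigma> k" using * x(1) by blast
          then have "lam j * lam (\<sigma> k) = 0" using lam_orth[OF j \<sigma>(1)[OF x(1)]] by simp
          ultimately show "lam j \<rhd> x = 0 \<rhd> x" by (metis act_left_times)
        qed
        then have "lam j = 0" by (rule A.multiplier_eq_leftI)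
        then show False using lam_nonzero[OF j] by simp
      qed
    qed
  qed (use \<sigma>(1) in blast)
qed

definition \<pi> :: "'i \<Rightarrow> 'i" where
  "\<pi> = inv_into I \<sigma>"

lemma \<pi>_bij: "bij_betw \<pi> I I"
  unfolding \<pi>_def by (rule bij_betw_inv_into[OF \<sigma>_bij])

lemma \<pi>_in: "k \<in> I \<Longrightarrow> \<pi> k \<in> I"
  using \<pi>_bij by (rule bij_betw_apply)

lemma L_\<pi>: "k \<in> I \<Longrightarrow> B.L (\<pi> k) = lam k"
  using \<sigma>(2)[OF \<pi>_in, of k] bij_betw_inv_into_right[OF \<sigma>_bij, of k] by (simp add: \<pi>_def)

lemma R_\<pi>:
  assumes "k \<in> I"
  shows "B.R (\<pi> k) = rho k"
  using E_L[OF \<pi>_in[OF assms]] E_lam(1)[OF assms] L_\<pi>[OF assms]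
  by (intro mtensor_cancel_right[OF _ lam_nonzero[OF assms] A.nondegenerate_algebra_axioms A.nondegenerate_algebra_axioms]) simp

lemma \<pi>_id:
  assumes "\<And>k. k \<in> I \<Longrightarrow> B.L k = lam k" "k \<in> I"
  shows "\<pi> k = k"
  using L_inj[of "\<pi> k" k] L_\<pi>[of k] assms \<pi>_in by simp

lemma e_\<pi>:
  assumes "k \<in> I" "m \<in> I"
  shows "B.e (\<pi> k) (\<pi> m) = u k m"
  by (rule A.eq_leftI) (simp add: B.e_act \<pi>_in assms L_\<pi> R_\<pi> u_mult_left)

abbreviation "Bc k l m n \<equiv> component \<B> (\<pi> k) (\<pi> l) (\<pi> m) (\<pi> n)"
abbreviation "\<kappa>' k l m n \<equiv> \<kappa> (\<pi> k) (\<pi> l) (\<pi> m) (\<pi> n)"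

lemma incl_block:
  assumes "k \<in> I" "l \<in> I" "m \<in> I" "n \<in> I" "b \<in> Bc k l m n"
  shows "\<kappa>' k l m n b \<in> block k l m n"
  unfolding block_def e_\<pi>[OF assms(1,3), symmetric] e_\<pi>[OF assms(2,4), symmetric]
  using assms by (simp add: B.e_mult \<pi>_in)

lemma incl_surj:
  assumes I: "k \<in> I" "l \<in> I" "m \<in> I" "n \<in> I"
  shows "\<exists>b\<in>Bc k l m n. \<kappa>' k l m n b = u k m * a * u l n"
proof -
  note lin = B.incl_linear[OF \<pi>_in[OF I(1)] \<pi>_in[OF I(2)] \<pi>_in[OF I(3)] \<pi>_in[OF I(4)]]
  note sub = B.comp_subspace[OF \<pi>_in[OF I(1)] \<pi>_in[OF I(2)] \<pi>_in[OF I(3)] \<pi>_in[OF I(4)]]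
  have "a \<in> cvec.span B.homogeneous" using B.span_homogeneous by blast
  then show ?thesis
  proof (induction rule: cvec.span_induct_alt)
    case base
    then show ?case
      by (intro bexI[of _ 0]) (simp_all add: clinear_zero[OF lin] cvec.subspace_0[OF sub])
  next
    case (step c x y)
    then obtain b where b: "b \<in> Bc k l m n" "\<kappa>' k l m n b = u k m * y * u l n" by blast
    from step(1) obtain k' l' m' n' a where x: "k' \<in> I" "l' \<in> I" "m' \<in> I" "n' \<in> I"
      "a \<in> component \<B> k' l' m' n'" "x = \<kappa> k' l' m' n' a" by (rule B.homogeneousE)
    have "u k m * x * u l n = (if \<pi> k = k' \<and> \<pi> m = m' \<and> \<pi> l = l' \<and> \<pi> n = n' then x else 0)"
      unfolding e_\<pi>[OF I(1,3), symmetric] e_\<pi>[OF I(2,4), symmetric] x(6)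
      using I x(1-5) by (auto simp: B.e_mult \<pi>_in)
    then obtain b' where b': "b' \<in> Bc k l m n" "\<kappa>' k l m n b' = u k m * x * u l n"
      using x clinear_zero[OF lin] cvec.subspace_0[OF sub] by (metis (full_types))
    show ?case
      by (intro bexI[of _ "c *\<^sub>C b' + b"])
        (simp_all add: clinear_add[OF lin] clinear_scale[OF lin] b b' distrib_left distrib_right
          mult_scaleC_left mult_scaleC_right cvec.subspace_add[OF sub] cvec.subspace_scale[OF sub])
  qed
qed

text \<open>The inverse of the inclusion of a component of \<open>\<B>\<close>, composed with the projection onto its image;
  the projection makes the map linear on all of \<open>A\<close>.\<close>

definition \<theta> :: "'i \<Rightarrow> 'i \<Rightarrow> 'i \<Rightarrow> 'i \<Rightarrow> 'a \<Rightarrow> 'b" where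
  "\<theta> k l m n a = (SOME b. b \<in> Bc k l m n \<and> \<kappa>' k l m n b = u k m * a * u l n)"

context
  fixes k l m n assumes I: "k \<in> I" "l \<in> I" "m \<in> I" "n \<in> I"
begin

lemma \<theta>: "\<theta> k l m n a \<in> Bc k l m n" "\<kappa>' k l m n (\<theta> k l m n a) = u k m * a * u l n"
  using someI_ex[OF incl_surj[OF I, of a, unfolded Bex_def]] unfolding \<theta>_def by blast+

lemma \<kappa>_\<theta>: "a \<in> block k l m n \<Longrightarrow> \<kappa>' k l m n (\<theta> k l m n a) = a"
  by (simp add: \<theta> block_def)

lemma \<theta>_eqI: "b \<in> Bc k l m n \<Longrightarrow> \<kappa>' k l m n b = u k m * a * u l n \<Longrightarrow> \<theta> k l m n a = b"
  using B.incl_inj[OF \<pi>_in[OF I(1)] \<pi>_in[OF I(2)] \<pi>_in[OF I(3)] \<pi>_in[OF I(4)]] \<theta> by metis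

lemma \<theta>_\<kappa>: "b \<in> Bc k l m n \<Longrightarrow> \<theta> k l m n (\<kappa>' k l m n b) = b"
  using incl_block[OF I, of b] by (intro \<theta>_eqI) (simp_all add: block_def)

lemma clinear_\<theta>: "clinear (\<theta> k l m n)"
proof -
  note lin = B.incl_linear[OF \<pi>_in[OF I(1)] \<pi>_in[OF I(2)] \<pi>_in[OF I(3)] \<pi>_in[OF I(4)]]
  note sub = B.comp_subspace[OF \<pi>_in[OF I(1)] \<pi>_in[OF I(2)] \<pi>_in[OF I(3)] \<pi>_in[OF I(4)]]
  show ?thesis
    by (rule clinearI; rule \<theta>_eqI)
      (simp_all add: \<theta> clinear_add[OF lin] clinear_scale[OF lin] distrib_left distrib_right
        mult_scaleC_left mult_scaleC_right cvec.subspace_add[OF sub] cvec.subspace_scale[OF sub])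
qed

lemma \<theta>_bij: "bij_betw (\<theta> k l m n) (block k l m n) (Bc k l m n)"
  by (rule bij_betw_byWitness[where f' = "\<kappa>' k l m n"])
    (use \<kappa>_\<theta> \<theta>_\<kappa> \<theta>(1) incl_block[OF I] in auto)

end

text \<open>In the total algebra both comultiplications are the same corner of \<open>\<Delta>(a)\<close>, and on tensors of
  components the maps \<open>\<theta>\<close> invert the inclusions.\<close>

lemma \<theta>_comult:
  assumes I: "r \<in> I" "s \<in> I" "k \<in> I" "l \<in> I" "m \<in> I" "n \<in> I" and a: "a \<in> block k l m n"
  shows "tensor_map (\<theta> k l r s) (\<theta> r s m n) (block_comult r s k l m n a)
    = pcomul \<B> (\<pi> r) (\<pi> s) (\<pi> k) (\<pi> l) (\<pi> m) (\<pi> n) (\<theta> k l m n a)"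
proof -
  let ?t = "pcomul \<B> (\<pi> r) (\<pi> s) (\<pi> k) (\<pi> l) (\<pi> m) (\<pi> n) (\<theta> k l m n a)"
  note \<theta>_in = \<theta>(1)[OF I(3-6), of a]
  note lin1 = B.incl_linear[OF \<pi>_in[OF I(3)] \<pi>_in[OF I(4)] \<pi>_in[OF I(1)] \<pi>_in[OF I(2)]]
  note lin2 = B.incl_linear[OF \<pi>_in[OF I(1)] \<pi>_in[OF I(2)] \<pi>_in[OF I(5)] \<pi>_in[OF I(6)]]
  note lin\<theta> = clinear_\<theta>[OF I(3,4,1,2)] clinear_\<theta>[OF I(1,2,5,6)]
  have "to_multiplier (tensor_map (\<kappa>' k l r s) (\<kappa>' r s m n) ?t) = (1 \<otimes>\<^sub>M lam r) * \<Delta> a * (1 \<otimes>\<^sub>M lam s)"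
    using B.total_comult_lambda[OF \<pi>_in[OF I(1)] \<pi>_in[OF I(2)] \<pi>_in[OF I(3)] \<pi>_in[OF I(4)] \<pi>_in[OF I(5)] \<pi>_in[OF I(6)] \<theta>_in]
    by (simp add: L_\<pi> I \<kappa>_\<theta> a)
  also have "\<dots> = to_multiplier (block_comult r s k l m n a)"
    using to_multiplier_block_comult[OF I a]
    by (simp add: comult_leg(1)[OF I(1)] mult.assoc comult_leg(2)[OF I(2)])
  finally have "block_comult r s k l m n a = tensor_map (\<kappa>' k l r s) (\<kappa>' r s m n) ?t"
    by (simp add: AA.to_multiplier_inject)
  moreover have "tensor_map (\<theta> k l r s) (\<theta> r s m n) (tensor_map (\<kappa>' k l r s) (\<kappa>' r s m n) t) = t"
    if "t \<in> tensor_subspace (Bc k l r s) (Bc r s m n)" for t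
    using that unfolding tensor_subspace_def
  proof (induction rule: cvec.span_induct_alt)
    case base
    then show ?case by (simp add: clinear_zero[OF clinear_tensor_map])
  next
    case (step c x y)
    then obtain v w where "v \<in> Bc k l r s" "w \<in> Bc r s m n" "x = v \<otimes> w" by blast
    then have "tensor_map (\<theta> k l r s) (\<theta> r s m n) (tensor_map (\<kappa>' k l r s) (\<kappa>' r s m n) x) = x"
      using I by (simp add: tensor_map_tensor lin1 lin2 lin\<theta> \<theta>_\<kappa>)
    then show ?case
      using step by (simp add: clinear_add[OF clinear_tensor_map] clinear_scale[OF clinear_tensor_map])
  qed
  moreover have "?t \<in> tensor_subspace (Bc k l r s) (Bc r s m n)"
    using B.comul_comp[OF \<pi>_in[OF I(1)] \<pi>_in[OF I(2)] \<pi>_in[OF I(3)] \<pi>_in[OF I(4)] \<pi>_in[OF I(5)] \<pi>_in[OF I(6)] \<theta>_in] .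
  ultimately show ?thesis by simp
qed

lemma iso_pb: "partial_bialgebra_iso I \<pi> pb \<B> \<theta>"
proof (rule partial_bialgebra_iso.intro)
  show "bij_betw \<pi> I I" by (rule \<pi>_bij)
  fix k l assume "k \<in> I" "l \<in> I"
  note kl = this
  show "\<theta> k k l l (punit pb k l) = punit \<B> (\<pi> k) (\<pi> l)"
    using kl e_\<pi>[OF kl] by (intro \<theta>_eqI) (simp_all add: B.unit_comp \<pi>_in u_u B.e_def)
  show "pcounit \<B> (\<pi> k) (\<pi> l) (\<theta> k l k l a) = pcounit pb k l a" if "a \<in> component pb k l k l" for a
  proof -
    note \<theta>_in = \<theta>(1)[OF kl kl, of a]
    have "\<epsilon> (\<kappa>' k l k l (\<theta> k l k l a)) = pcounit \<B> (\<pi> k) (\<pi> l) (\<theta> k l k l a)"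
      using B.total_counit[OF \<pi>_in[OF kl(1)] \<pi>_in[OF kl(2)] \<pi>_in[OF kl(1)] \<pi>_in[OF kl(2)] \<theta>_in]
      by (simp add: counit_ext_def)
    then show ?thesis using that kl by (simp add: \<kappa>_\<theta>)
  qed
  fix m n assume "m \<in> I" "n \<in> I"
  note mn = this
  show "clinear (\<theta> k l m n)" by (rule clinear_\<theta>[OF kl mn])
  show "bij_betw (\<theta> k l m n) (component pb k l m n) (Bc k l m n)"
    using \<theta>_bij[OF kl mn] by simp
  show "\<theta> k p m q (pmul pb k l p m n q a b) = pmul \<B> (\<pi> k) (\<pi> l) (\<pi> p) (\<pi> m) (\<pi> n) (\<pi> q) (\<theta> k l m n a) (\<theta> l p n q b)"
    if "p \<in> I" "q \<in> I" and a: "a \<in> component pb k l m n" and b: "b \<in> component pb l p n q" for p q a b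
  proof (rule \<theta>_eqI[OF kl(1) that(1) mn(1) that(2)])
    note \<theta>_a = \<theta>(1)[OF kl mn, of a] and \<theta>_b = \<theta>(1)[OF kl(2) that(1) mn(2) that(2), of b]
    show "pmul \<B> (\<pi> k) (\<pi> l) (\<pi> p) (\<pi> m) (\<pi> n) (\<pi> q) (\<theta> k l m n a) (\<theta> l p n q b) \<in> Bc k p m q"
      using \<theta>_a \<theta>_b kl mn that by (intro B.mul_comp) (simp_all add: \<pi>_in)
    have "\<kappa>' k l m n (\<theta> k l m n a) * \<kappa>' l p n q (\<theta> l p n q b)
      = \<kappa>' k p m q (pmul \<B> (\<pi> k) (\<pi> l) (\<pi> p) (\<pi> m) (\<pi> n) (\<pi> q) (\<theta> k l m n a) (\<theta> l p n q b))"
      using B.total_mult[OF \<pi>_in[OF kl(1)] \<pi>_in[OF kl(2)] \<pi>_in[OF mn(1)] \<pi>_in[OF mn(2)]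
          \<pi>_in[OF kl(2)] \<pi>_in[OF that(1)] \<pi>_in[OF mn(2)] \<pi>_in[OF that(2)] \<theta>_a \<theta>_b] by simp
    then have "\<kappa>' k p m q (pmul \<B> (\<pi> k) (\<pi> l) (\<pi> p) (\<pi> m) (\<pi> n) (\<pi> q) (\<theta> k l m n a) (\<theta> l p n q b)) = a * b"
      using a b kl mn that(1,2) by (simp add: \<kappa>_\<theta>)
    moreover have "u k m * (a * b) * u p q = a * b"
      using block_mult[of a k l m n b p q] a b by (simp add: block_def)
    ultimately show "\<kappa>' k p m q (pmul \<B> (\<pi> k) (\<pi> l) (\<pi> p) (\<pi> m) (\<pi> n) (\<pi> q) (\<theta> k l m n a) (\<theta> l p n q b))
      = u k m * pmul pb k l p m n q a b * u p q" by simp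
  qed
  show "tensor_map (\<theta> k l r s) (\<theta> r s m n) (pcomul pb r s k l m n a)
    = pcomul \<B> (\<pi> r) (\<pi> s) (\<pi> k) (\<pi> l) (\<pi> m) (\<pi> n) (\<theta> k l m n a)"
    if "r \<in> I" "s \<in> I" "a \<in> component pb k l m n" for r s a
    using \<theta>_comult[OF that(1,2) kl mn] that(3) by simp
qed

end

theorem proposition1p23:
  fixes I :: "'i set"
    and \<Delta> :: "'a::complex_algebra \<Rightarrow> ('a, 'a) tensor multiplier"
    and E :: "('a, 'a) tensor multiplier"
    and \<epsilon> :: "'a \<Rightarrow> complex"
    and \<phi> :: "('i \<Rightarrow> complex) \<Rightarrow> 'a multiplier"
  assumes "regular_weak_multiplier_bialgebra \<Delta> E \<epsilon>"
    and "left_full \<Delta>" and "right_full \<Delta>"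
    and "fun_fin_iso I (baseL E \<epsilon>) \<phi>"
    and "\<forall>x\<in>baseL E \<epsilon>. \<forall>y\<in>baseR E \<epsilon>. x * y \<in> range to_multiplier"
  shows "\<exists>(\<A> :: ('i, 'a) partial_bialgebra_data) \<iota>.
    total_weak_multiplier_bialgebra I \<A> \<iota> \<Delta> E \<epsilon> \<and>
    (\<forall>k\<in>I. total_lambda I \<A> \<iota> k = \<phi> (dirac k)) \<and>
    (\<forall>(\<B> :: ('i, 'b::complex_vector) partial_bialgebra_data) \<kappa>.
      total_weak_multiplier_bialgebra I \<B> \<kappa> \<Delta> E \<epsilon> \<longrightarrow>
      (\<exists>\<pi> \<theta>. partial_bialgebra_iso I \<pi> \<A> \<B> \<theta> \<and>
        (\<forall>k\<in>I. total_lambda I \<B> \<kappa> (\<pi> k) = \<phi> (dirac k)) \<and>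
        ((\<forall>k\<in>I. total_lambda I \<B> \<kappa> k = \<phi> (dirac k)) \<longrightarrow> (\<forall>k\<in>I. \<pi> k = k)) \<and>
        (\<forall>k\<in>I. \<forall>l\<in>I. \<forall>m\<in>I. \<forall>n\<in>I. \<forall>a\<in>component \<A> k l m n.
          \<kappa> (\<pi> k) (\<pi> l) (\<pi> m) (\<pi> n) (\<theta> k l m n a) = \<iota> k l m n a)))"
proof -
  interpret unital_function_base \<Delta> E \<epsilon> I \<phi>
    using assms by (intro unital_function_base.intro unital_function_base_axioms.intro
        function_base.intro function_base_axioms.intro)
  have "\<exists>\<pi> \<theta>. partial_bialgebra_iso I \<pi> pb \<B> \<theta> \<and>
      (\<forall>k\<in>I. total_lambda I \<B> \<kappa> (\<pi> k) = \<phi> (dirac k)) \<and>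
      ((\<forall>k\<in>I. total_lambda I \<B> \<kappa> k = \<phi> (dirac k)) \<longrightarrow> (\<forall>k\<in>I. \<pi> k = k)) \<and>
      (\<forall>k\<in>I. \<forall>l\<in>I. \<forall>m\<in>I. \<forall>n\<in>I. \<forall>a\<in>component pb k l m n.
        \<kappa> (\<pi> k) (\<pi> l) (\<pi> m) (\<pi> n) (\<theta> k l m n a) = a)"
    if "total_weak_multiplier_bialgebra I \<B> \<kappa> \<Delta> E \<epsilon>"
    for \<B> :: "('i, 'b) partial_bialgebra_data" and \<kappa>
  proof -
    interpret B: total_weak_multiplier_bialgebra I \<B> \<kappa> \<Delta> E \<epsilon> by (rule that)
    interpret total_over_function_base \<Delta> E \<epsilon> I \<phi> \<B> \<kappa> ..
    show ?thesis
    proof (intro exI[of _ \<pi>] exI[of _ \<theta>] conjI impI ballI)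
      show "partial_bialgebra_iso I \<pi> pb \<B> \<theta>" by (rule iso_pb)
      show "total_lambda I \<B> \<kappa> (\<pi> k) = \<phi> (dirac k)" if "k \<in> I" for k
        using L_\<pi>[OF that] by (simp add: lam_def)
      show "\<pi> k = k" if "\<forall>k\<in>I. total_lambda I \<B> \<kappa> k = \<phi> (dirac k)" "k \<in> I" for k
        using \<pi>_id that by (simp add: lam_def)
      show "\<kappa> (\<pi> k) (\<pi> l) (\<pi> m) (\<pi> n) (\<theta> k l m n a) = a"
        if "k \<in> I" "l \<in> I" "m \<in> I" "n \<in> I" "a \<in> component pb k l m n" for k l m n a
        using \<kappa>_\<theta> that by simp
    qed
  qed
  then show ?thesis
    using total_pb total_lambda_pb
    by (intro exI[of _ pb] exI[of _ "\<lambda>_ _ _ _ a. a"]) (simp add: lam_def)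
qed

end
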